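(* Let $M$ be a connected manifold of dimension $n=2$, and let $F=F_{g,\tau}$ be a Randers Finsler metric on $M$, i.e. $F(x,y)=\sqrt{g_x(y,y)}+\tau(y)$ for a Riemannian metric $g$ and a 1-form $\tau$ with $|\tau|_g<1$ at every point. Suppose that it is not the case that both $g$ has constant sectional curvature and $\tau$ is closed. If the vector space of almost Killing vector fields of $F$ has dimension at least $\tfrac{n^2-n}{2}+1+1=3$, then $g$ has constant sectional curvature and there is a constant $c\neq 0$ such that $d\tau=c\cdot\omega$, where $\omega$ is the volume form of $g$ (given by $\sqrt{\det g}\,dx\wedge dy$ in local coordinates, for a suitable orientation).
   Context: All objects are assumed sufficiently smooth. The (generally nonsymmetric) distance associated with a Finsler metric $F$ is $d(p,q)=\inf\{\int_0^1 F(c(t),c'(t))\,dt : c\in C^1([0,1];M),\ c(0)=p,\ c(1)=q\}$. Put $T(p,q,r):=d(p,q)+d(q,r)-d(p,r)$. A diffeomorphism $\phi:U\to V$ with $U,V\subseteq M$ is an almost isometry if $T(p,q,r)=T(\phi(p),\phi(q),\phi(r))$ for all $p,q,r\in U$. A vector field $K$ is almost Killing if its local flow acts by almost isometries; all considerations being local, this means that every point has a neighborhood $U$ such that, for all sufficiently small $|t|$, the time-$t$ flow of $K$ restricted to $U$ is an almost isometry onto its image. $|\tau|_g$ denotes the pointwise $g$-norm of the 1-form $\tau$. For a surface, constant sectional curvature means constant Gauss curvature. *)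

theory Defs
  imports "HOL-Analysis.Analysis" "HOL-Library.Function_Algebras"
begin

instantiation "fun" :: (type, real_vector) real_vector
begin

definition scaleR_fun :: "real \<Rightarrow> ('a \<Rightarrow> 'b) \<Rightarrow> 'a \<Rightarrow> 'b"
  where "scaleR_fun a f = (\<lambda>x. a *\<^sub>R f x)"

instance
  by standard
    (simp_all add: scaleR_fun_def plus_fun_def fun_eq_iff scaleR_add_right scaleR_add_left)

end

text \<open>For a set of vectors that is not known to be a finite-dimensional subspace, \<^const>\<open>dim\<close>
  is unsuitable: it is 0 in the infinite-dimensional case.\<close>

definition dim_at_least :: "nat \<Rightarrow> 'v::real_vector set \<Rightarrow> bool" where
  "dim_at_least n V \<longleftrightarrow> (\<exists>B \<subseteq> V. independent B \<and> finite B \<and> card B = n)"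


subsection \<open>Smooth maps between open subsets of normed spaces\<close>

text \<open>The two notions below are meant for open \<open>S\<close> and finite-dimensional \<open>'b\<close>.\<close>

primrec Ck_on :: "nat \<Rightarrow> 'b set \<Rightarrow> ('b::real_normed_vector \<Rightarrow> 'c::real_normed_vector) \<Rightarrow> bool" where
  "Ck_on 0 S f \<longleftrightarrow> continuous_on S f"
| "Ck_on (Suc k) S f \<longleftrightarrow>
     (\<forall>x\<in>S. f differentiable (at x)) \<and> (\<forall>v. Ck_on k S (\<lambda>x. frechet_derivative f (at x) v))"

definition smooth_on :: "'b set \<Rightarrow> ('b::real_normed_vector \<Rightarrow> 'c::real_normed_vector) \<Rightarrow> bool" where
  "smooth_on S f \<longleftrightarrow> (\<forall>k. Ck_on k S f)"


subsection \<open>Smooth surfaces\<close>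

text \<open>The manifold is the whole type \<open>'a\<close>; a chart is a pair of its domain and its coordinate map
  (whose values outside the domain are irrelevant).\<close>

type_synonym 'a chart = "'a set \<times> ('a \<Rightarrow> real^2)"

abbreviation chart_inv :: "'a chart \<Rightarrow> real^2 \<Rightarrow> 'a" where
  "chart_inv c \<equiv> inv_into (fst c) (snd c)"

abbreviation chart_image :: "'a chart \<Rightarrow> (real^2) set" where
  "chart_image c \<equiv> snd c ` fst c"

definition is_chart :: "'a::topological_space chart \<Rightarrow> bool" where
  "is_chart c \<longleftrightarrow> open (fst c) \<and> open (chart_image c) \<and>
     homeomorphism (fst c) (chart_image c) (snd c) (chart_inv c)"

definition smooth_atlas :: "'a::topological_space chart set \<Rightarrow> bool" where
  "smooth_atlas A \<longleftrightarrow> (\<forall>c\<in>A. is_chart c) \<and> (\<Union>c\<in>A. fst c) = UNIV \<and>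
     (\<forall>c\<in>A. \<forall>c'\<in>A. smooth_on (snd c ` (fst c \<inter> fst c')) (snd c' \<circ> chart_inv c))"

text \<open>Tangent spaces. With every point \<open>p\<close> we associate once and for all a chart \<open>chart_at A p\<close>
  around it, and identify the tangent space at \<open>p\<close> with \<open>\<real>\<^sup>2\<close> by taking components with respect to
  that chart. Hence a vector field is a function \<open>'a \<Rightarrow> real^2\<close>, and a 1-form is a function
  \<open>'a \<Rightarrow> real^2 \<Rightarrow> real\<close>. As the selected chart may jump from point to point, smoothness and
  derivatives always refer to the components in one fixed chart.\<close>

definition chart_at :: "'a chart set \<Rightarrow> 'a \<Rightarrow> 'a chart" where
  "chart_at A p = (SOME c. c \<in> A \<and> p \<in> fst c)"

text \<open>\<open>change c c' p\<close> turns the components in \<open>c\<close> of a tangent vector at \<open>p\<close> into those in \<open>c'\<close>.\<close>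

definition change :: "'a chart \<Rightarrow> 'a chart \<Rightarrow> 'a \<Rightarrow> real^2 \<Rightarrow> real^2" where
  "change c c' p = frechet_derivative (snd c' \<circ> chart_inv c) (at (snd c p))"

definition comps_of :: "'a chart set \<Rightarrow> 'a chart \<Rightarrow> 'a \<Rightarrow> real^2 \<Rightarrow> real^2" where
  "comps_of A c p v = change (chart_at A p) c p v"

definition coord_vec :: "'a chart set \<Rightarrow> 'a chart \<Rightarrow> 'a \<Rightarrow> 2 \<Rightarrow> real^2" where
  "coord_vec A c p i = change c (chart_at A p) p (axis i 1)"

definition smooth_vector_field :: "'a chart set \<Rightarrow> ('a \<Rightarrow> real^2) \<Rightarrow> bool" where
  "smooth_vector_field A K \<longleftrightarrow>
     (\<forall>c\<in>A. smooth_on (chart_image c) (\<lambda>x. let p = chart_inv c x in comps_of A c p (K p)))"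

definition smooth_between ::
    "'a::topological_space chart set \<Rightarrow> 'a set \<Rightarrow> ('a \<Rightarrow> 'a) \<Rightarrow> bool" where
  "smooth_between A U f \<longleftrightarrow> continuous_on U f \<and>
     (\<forall>c\<in>A. \<forall>c'\<in>A. smooth_on (snd c ` {p \<in> U \<inter> fst c. f p \<in> fst c'}) (snd c' \<circ> f \<circ> chart_inv c))"

definition diffeomorphism_on ::
    "'a::topological_space chart set \<Rightarrow> 'a set \<Rightarrow> 'a set \<Rightarrow> ('a \<Rightarrow> 'a) \<Rightarrow> bool" where
  "diffeomorphism_on A U V f \<longleftrightarrow> open U \<and> open V \<and> bij_betw f U V \<and>
     smooth_between A U f \<and> smooth_between A V (inv_into U f)"


subsection \<open>Riemannian metrics and Gauss curvature\<close>

definition metric_coord ::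
    "'a chart set \<Rightarrow> ('a \<Rightarrow> real^2 \<Rightarrow> real^2 \<Rightarrow> real) \<Rightarrow> 'a chart \<Rightarrow> real^2 \<Rightarrow> real^2^2" where
  "metric_coord A g c x =
     (let p = chart_inv c x in \<chi> i j. g p (coord_vec A c p i) (coord_vec A c p j))"

definition riemannian_metric ::
    "'a chart set \<Rightarrow> ('a \<Rightarrow> real^2 \<Rightarrow> real^2 \<Rightarrow> real) \<Rightarrow> bool" where
  "riemannian_metric A g \<longleftrightarrow>
     (\<forall>p. bilinear (g p) \<and> (\<forall>v w. g p v w = g p w v) \<and> (\<forall>v. v \<noteq> 0 \<longrightarrow> g p v v > 0)) \<and>
     (\<forall>c\<in>A. smooth_on (chart_image c) (metric_coord A g c))"

definition partial :: "2 \<Rightarrow> (real^2 \<Rightarrow> real) \<Rightarrow> real^2 \<Rightarrow> real" where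
  "partial i f x = frechet_derivative f (at x) (axis i 1)"

text \<open>\<open>christoffel G k i j\<close> is the Christoffel symbol with upper index \<open>k\<close>.\<close>

definition christoffel :: "(real^2 \<Rightarrow> real^2^2) \<Rightarrow> 2 \<Rightarrow> 2 \<Rightarrow> 2 \<Rightarrow> real^2 \<Rightarrow> real" where
  "christoffel G k i j x = 1 / 2 * (\<Sum>l\<in>UNIV. matrix_inv (G x) $ k $ l *
     (partial i (\<lambda>y. G y $ j $ l) x + partial j (\<lambda>y. G y $ i $ l) x - partial l (\<lambda>y. G y $ i $ j) x))"

text \<open>\<open>riemann G l i j k\<close> is the \<open>l\<close>-th component of \<open>R(\<partial>\<^sub>i, \<partial>\<^sub>j) \<partial>\<^sub>k\<close>, where
  \<open>R(X, Y) Z = \<nabla>\<^sub>X \<nabla>\<^sub>Y Z - \<nabla>\<^sub>Y \<nabla>\<^sub>X Z - \<nabla>\<^bsub>[X,Y]\<^esub> Z\<close>.\<close>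

definition riemann :: "(real^2 \<Rightarrow> real^2^2) \<Rightarrow> 2 \<Rightarrow> 2 \<Rightarrow> 2 \<Rightarrow> 2 \<Rightarrow> real^2 \<Rightarrow> real" where
  "riemann G l i j k x =
     partial i (christoffel G l j k) x - partial j (christoffel G l i k) x +
     (\<Sum>m\<in>UNIV. christoffel G m j k x * christoffel G l i m x
               - christoffel G m i k x * christoffel G l j m x)"

text \<open>The sectional curvature \<open>g(R(\<partial>\<^sub>1, \<partial>\<^sub>2) \<partial>\<^sub>2, \<partial>\<^sub>1) / det g\<close> of the tangent plane.\<close>

definition gauss_curvature ::
    "'a chart set \<Rightarrow> ('a \<Rightarrow> real^2 \<Rightarrow> real^2 \<Rightarrow> real) \<Rightarrow> 'a \<Rightarrow> real" where
  "gauss_curvature A g p =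
     (let c = chart_at A p; x = snd c p; G = metric_coord A g c
      in (\<Sum>l\<in>UNIV. G x $ 1 $ l * riemann G l 1 2 2 x) / det (G x))"

definition constant_curvature ::
    "'a chart set \<Rightarrow> ('a \<Rightarrow> real^2 \<Rightarrow> real^2 \<Rightarrow> real) \<Rightarrow> bool" where
  "constant_curvature A g \<longleftrightarrow> (\<exists>k. \<forall>p. gauss_curvature A g p = k)"


subsection \<open>Differential forms\<close>

definition form_coord ::
    "'a chart set \<Rightarrow> ('a \<Rightarrow> real^2 \<Rightarrow> real) \<Rightarrow> 'a chart \<Rightarrow> real^2 \<Rightarrow> real^2" where
  "form_coord A \<tau> c x = (let p = chart_inv c x in \<chi> i. \<tau> p (coord_vec A c p i))"

definition smooth_one_form :: "'a chart set \<Rightarrow> ('a \<Rightarrow> real^2 \<Rightarrow> real) \<Rightarrow> bool" where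
  "smooth_one_form A \<tau> \<longleftrightarrow>
     (\<forall>p. linear (\<tau> p)) \<and> (\<forall>c\<in>A. smooth_on (chart_image c) (form_coord A \<tau> c))"

text \<open>In the chart \<open>chart_at A p\<close> (in which \<open>v\<close> and \<open>w\<close> are their own components) this is
  \<open>(\<partial>\<^sub>1\<tau>\<^sub>2 - \<partial>\<^sub>2\<tau>\<^sub>1) (v\<^sub>1w\<^sub>2 - v\<^sub>2w\<^sub>1)\<close>.\<close>

definition ext_deriv ::
    "'a chart set \<Rightarrow> ('a \<Rightarrow> real^2 \<Rightarrow> real) \<Rightarrow> 'a \<Rightarrow> real^2 \<Rightarrow> real^2 \<Rightarrow> real" where
  "ext_deriv A \<tau> p v w =
     (let c = chart_at A p; D = frechet_derivative (form_coord A \<tau> c) (at (snd c p))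
      in D v \<bullet> w - D w \<bullet> v)"

definition closed_form :: "'a chart set \<Rightarrow> ('a \<Rightarrow> real^2 \<Rightarrow> real) \<Rightarrow> bool" where
  "closed_form A \<tau> \<longleftrightarrow> (\<forall>p v w. ext_deriv A \<tau> p v w = 0)"

definition form_norm ::
    "('a \<Rightarrow> real^2 \<Rightarrow> real^2 \<Rightarrow> real) \<Rightarrow> ('a \<Rightarrow> real^2 \<Rightarrow> real) \<Rightarrow> 'a \<Rightarrow> real" where
  "form_norm g \<tau> p = (SUP v\<in>{v. g p v v \<le> 1}. \<bar>\<tau> p v\<bar>)"

text \<open>An orientation of the surface with atlas \<open>A\<close> is given by an oriented atlas \<open>B\<close> of the same
  smooth structure.\<close>

definition oriented_atlas :: "'a::topological_space chart set \<Rightarrow> 'a chart set \<Rightarrow> bool" where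
  "oriented_atlas A B \<longleftrightarrow> smooth_atlas B \<and> smooth_atlas (A \<union> B) \<and>
     (\<forall>c\<in>B. \<forall>c'\<in>B. \<forall>p \<in> fst c \<inter> fst c'. det (matrix (change c c' p)) > 0)"

text \<open>\<open>sqrt (det g) dx \<and> dy\<close> in the charts of \<open>B\<close>; the choice of the chart of \<open>B\<close> around \<open>p\<close> does
  not matter.\<close>

definition volume_form :: "'a chart set \<Rightarrow> 'a chart set \<Rightarrow>
    ('a \<Rightarrow> real^2 \<Rightarrow> real^2 \<Rightarrow> real) \<Rightarrow> 'a \<Rightarrow> real^2 \<Rightarrow> real^2 \<Rightarrow> real" where
  "volume_form A B g p v w =
     (let c = chart_at B p; v' = comps_of A c p v; w' = comps_of A c p w
      in sqrt (det (metric_coord A g c (snd c p))) * (v' $ 1 * w' $ 2 - v' $ 2 * w' $ 1))"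


subsection \<open>Finsler distance, almost isometries and almost Killing fields\<close>

definition randers ::
    "('a \<Rightarrow> real^2 \<Rightarrow> real^2 \<Rightarrow> real) \<Rightarrow> ('a \<Rightarrow> real^2 \<Rightarrow> real) \<Rightarrow> 'a \<Rightarrow> real^2 \<Rightarrow> real" where
  "randers g \<tau> p v = sqrt (g p v v) + \<tau> p v"

definition C1_curve :: "'a::topological_space chart set \<Rightarrow> (real \<Rightarrow> 'a) \<Rightarrow> bool" where
  "C1_curve A \<gamma> \<longleftrightarrow> continuous_on {0..1} \<gamma> \<and>
     (\<forall>c\<in>A. let S = {t \<in> {0..1}. \<gamma> t \<in> fst c} in
        \<exists>D. continuous_on S D \<and>
          (\<forall>t\<in>S. ((snd c \<circ> \<gamma>) has_vector_derivative D t) (at t within {0..1})))"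

definition velocity :: "'a chart set \<Rightarrow> (real \<Rightarrow> 'a) \<Rightarrow> real \<Rightarrow> real^2" where
  "velocity A \<gamma> t = vector_derivative (snd (chart_at A (\<gamma> t)) \<circ> \<gamma>) (at t within {0..1})"

definition finsler_dist ::
    "'a::topological_space chart set \<Rightarrow> ('a \<Rightarrow> real^2 \<Rightarrow> real) \<Rightarrow> 'a \<Rightarrow> 'a \<Rightarrow> real" where
  "finsler_dist A F p q =
     Inf {integral {0..1} (\<lambda>t. F (\<gamma> t) (velocity A \<gamma> t)) | \<gamma>. C1_curve A \<gamma> \<and> \<gamma> 0 = p \<and> \<gamma> 1 = q}"

definition triangle_excess ::
    "'a::topological_space chart set \<Rightarrow> ('a \<Rightarrow> real^2 \<Rightarrow> real) \<Rightarrow> 'a \<Rightarrow> 'a \<Rightarrow> 'a \<Rightarrow> real" where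
  "triangle_excess A F p q r =
     finsler_dist A F p q + finsler_dist A F q r - finsler_dist A F p r"

definition almost_isometry :: "'a::topological_space chart set \<Rightarrow> ('a \<Rightarrow> real^2 \<Rightarrow> real) \<Rightarrow>
    'a set \<Rightarrow> 'a set \<Rightarrow> ('a \<Rightarrow> 'a) \<Rightarrow> bool" where
  "almost_isometry A F U V f \<longleftrightarrow> diffeomorphism_on A U V f \<and>
     (\<forall>p\<in>U. \<forall>q\<in>U. \<forall>r\<in>U. triangle_excess A F p q r = triangle_excess A F (f p) (f q) (f r))"

definition integral_curve ::
    "'a::topological_space chart set \<Rightarrow> ('a \<Rightarrow> real^2) \<Rightarrow> real set \<Rightarrow> (real \<Rightarrow> 'a) \<Rightarrow> bool" where
  "integral_curve A K I \<gamma> \<longleftrightarrow> continuous_on I \<gamma> \<and>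
     (\<forall>t\<in>I. ((snd (chart_at A (\<gamma> t)) \<circ> \<gamma>) has_vector_derivative K (\<gamma> t)) (at t))"

text \<open>\<open>\<theta> t\<close> is the time-\<open>t\<close> flow of \<open>K\<close> on \<open>U\<close>, defined for \<open>\<bar>t\<bar> < \<epsilon>\<close>.\<close>

definition local_flow :: "'a::topological_space chart set \<Rightarrow> ('a \<Rightarrow> real^2) \<Rightarrow>
    'a set \<Rightarrow> real \<Rightarrow> (real \<Rightarrow> 'a \<Rightarrow> 'a) \<Rightarrow> bool" where
  "local_flow A K U \<epsilon> \<theta> \<longleftrightarrow>
     (\<forall>q\<in>U. \<theta> 0 q = q \<and> integral_curve A K {-\<epsilon><..<\<epsilon>} (\<lambda>t. \<theta> t q))"

definition almost_killing :: "'a::topological_space chart set \<Rightarrow> ('a \<Rightarrow> real^2 \<Rightarrow> real) \<Rightarrow>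
    ('a \<Rightarrow> real^2) \<Rightarrow> bool" where
  "almost_killing A F K \<longleftrightarrow> smooth_vector_field A K \<and>
     (\<forall>p. \<exists>U \<epsilon> \<theta>. open U \<and> p \<in> U \<and> \<epsilon> > 0 \<and> local_flow A K U \<epsilon> \<theta> \<and>
        (\<forall>t. \<bar>t\<bar> < \<epsilon> \<longrightarrow> almost_isometry A F U (\<theta> t ` U) (\<theta> t)))"

end

theory Submission
  imports Defs
begin

text \<open>An almost isometry \<open>\<phi>\<close> preserves the symmetrised distance, which is \<open>2 sqrt g\<close> to first
  order, and therefore \<open>g\<close>. What remains of the change of the distance from \<open>p\<close> to \<open>q\<close> is the
  difference of the values of a function with differential \<open>\<phi>\<^sup>*\<tau> - \<tau>\<close>, so \<open>d\<tau>\<close> is preserved as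
  well. Hence an almost Killing field \<open>K\<close> is a Killing field of \<open>g\<close>, and the Lie derivative of
  \<open>d\<tau>\<close> along \<open>K\<close> vanishes. On a connected surface a Killing field is determined by its 1-jet at
  one point, which has three components: \<open>K\<close> itself and the skew covariant derivative. So three
  independent fields realise all 1-jets at all points. In particular they span the tangent spaces,
  and since the curvature and \<open>|d\<tau>|\<^sup>2\<close> are constant along each of them, both are constant. The
  constant \<open>|d\<tau>|\<^sup>2\<close> is not 0, as otherwise \<open>\<tau>\<close> would be closed and the curvature constant; so \<open>d\<tau>\<close>
  orients the surface.\<close>


section \<open>Smooth functions on open sets\<close>

text \<open>Two gaps in regularity shape the proof. The flow comes without differentiability in its
  initial point, and distances are only controlled to first order. The first gap is filled by the
  almost isometries: every time-t map is a diffeomorphism and so has a differential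
  \<open>D t\<close>, while the differential equation for the difference of two trajectories yields
  the derivative of \<open>D t\<close> at \<open>t = 0\<close>. The second gap calls for Schwarz's
  theorem in a weak form, since the function whose differential is the pullback of \<tau> minus
  \<tau> is a difference of distances. Almost Killing fields are not visibly closed under sums. They
  are replaced by the solutions of the linear equations that they satisfy; taking jets at a point is
  then a linear map between spaces of dimension 3, injective by unique continuation and hence onto.
  Independence of the curvature from the chart is not taken from tensor calculus but read off from a
  scalar attached to a Killing field. The coefficient of d\<tau> has a sign that depends on an
  orientation, so its square is shown to be constant before an orientation is chosen.\<close>

lemma has_derivative_cong_open:
  assumes "open S" "x \<in> S" "\<And>y. y \<in> S \<Longrightarrow> f y = g y"
  shows "(f has_derivative D) (at x) \<longleftrightarrow> (g has_derivative D) (at x)"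
  using assms has_derivative_transform_within_open by (metis (no_types, lifting))

lemma frechet_derivative_cong_open:
  assumes "open S" "x \<in> S" "\<And>y. y \<in> S \<Longrightarrow> f y = g y"
  shows "frechet_derivative f (at x) = frechet_derivative g (at x)"
  unfolding frechet_derivative_def by (simp only: has_derivative_cong_open[OF assms])

lemma differentiable_cong_open:
  assumes "open S" "x \<in> S" "\<And>y. y \<in> S \<Longrightarrow> f y = g y"
  shows "f differentiable (at x) \<longleftrightarrow> g differentiable (at x)"
  unfolding differentiable_def by (simp only: has_derivative_cong_open[OF assms])

lemma Ck_on_cong:
  assumes "open S" "\<And>y. y \<in> S \<Longrightarrow> f y = g y"
  shows "Ck_on k S f \<longleftrightarrow> Ck_on k S g"
  using assms(2)
proof (induction k arbitrary: f g)
  case 0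
  then show ?case by (simp cong: continuous_on_cong)
next
  case (Suc k)
  have "frechet_derivative f (at x) = frechet_derivative g (at x)" if "x \<in> S" for x
    using frechet_derivative_cong_open assms(1) that Suc.prems by blast
  then have "Ck_on k S (\<lambda>x. frechet_derivative f (at x) v)
      \<longleftrightarrow> Ck_on k S (\<lambda>x. frechet_derivative g (at x) v)" for v
    by (intro Suc.IH) auto
  moreover have "f differentiable (at x) \<longleftrightarrow> g differentiable (at x)" if "x \<in> S" for x
    using differentiable_cong_open assms(1) that Suc.prems by blast
  ultimately show ?case by simp
qed

text \<open>\<open>frechet_derivative\<close> is a choice that exhibits no formula. By uniqueness of
  the derivative an explicit \<open>D\<close> may stand in for it, and the closure properties below
  supply such a \<open>D\<close>.\<close>

lemma Ck_on_SucI: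
  assumes "open S" "\<And>x. x \<in> S \<Longrightarrow> (f has_derivative D x) (at x)"
    "\<And>v. Ck_on k S (\<lambda>x. D x v)"
  shows "Ck_on (Suc k) S f"
proof -
  have "frechet_derivative f (at x) = D x" if "x \<in> S" for x
    using frechet_derivative_at[OF assms(2)[OF that]] by simp
  then have "Ck_on k S (\<lambda>x. frechet_derivative f (at x) v)" for v
    using assms(3)[of v] Ck_on_cong[OF assms(1), of "\<lambda>x. frechet_derivative f (at x) v"] by force
  then show ?thesis
    using assms(2) by (auto simp: differentiable_def)
qed

lemma Ck_on_SucD:
  assumes "Ck_on (Suc k) S f"
  shows "x \<in> S \<Longrightarrow> (f has_derivative frechet_derivative f (at x)) (at x)"
    and "Ck_on k S (\<lambda>x. frechet_derivative f (at x) v)"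
  using assms by (auto simp: frechet_derivative_works)

text \<open>The recursion for the higher order speaks of derivatives only, so lower orders must be
  recovered; the base case is continuity of differentiable functions.\<close>

lemma Ck_on_Suc_imp: "Ck_on (Suc k) S f \<Longrightarrow> Ck_on k S f"
proof (induction k arbitrary: f)
  case 0
  then show ?case
    by (auto intro!: continuous_at_imp_continuous_on differentiable_imp_continuous_within)
next
  case (Suc k)
  then show ?case by (metis Ck_on.simps(2))
qed

lemma Ck_on_const: "open S \<Longrightarrow> Ck_on k S (\<lambda>x. c)"
proof (induction k arbitrary: c)
  case (Suc k)
  show ?case by (rule Ck_on_SucI[OF Suc.prems has_derivative_const]) (rule Suc)+
qed simp

lemma Ck_on_add:
  assumes "open S" shows "Ck_on k S f \<Longrightarrow> Ck_on k S g \<Longrightarrow> Ck_on k S (\<lambda>x. f x + g x)"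
proof (induction k arbitrary: f g)
  case (Suc k)
  show ?case
    by (rule Ck_on_SucI[OF assms has_derivative_add])
      (auto intro!: Suc.IH Ck_on_SucD(1)[OF Suc.prems(1)] Ck_on_SucD(2)[OF Suc.prems(1)]
        Ck_on_SucD(1)[OF Suc.prems(2)] Ck_on_SucD(2)[OF Suc.prems(2)] simp del: Ck_on.simps)
qed (auto intro: continuous_intros)

lemma Ck_on_bounded_linear:
  assumes "open S" "bounded_linear L"
  shows "Ck_on k S f \<Longrightarrow> Ck_on k S (\<lambda>x. L (f x))"
proof (induction k arbitrary: f)
  case 0
  then show ?case by (simp add: bounded_linear.continuous_on[OF assms(2)])
next
  case (Suc k)
  show ?case
    by (rule Ck_on_SucI[OF assms(1) bounded_linear.has_derivative[OF assms(2)]])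
      (auto intro!: Suc.IH Ck_on_SucD(1)[OF Suc.prems] Ck_on_SucD(2)[OF Suc.prems]
        simp del: Ck_on.simps)
qed

text \<open>The derivative of the composition along \<open>v\<close> is the derivative of
  \<open>f\<close> along \<open>L v\<close>, again composed with \<open>L\<close>. So the induction
  closes for linear inner maps without a chain rule of higher order.\<close>

lemma Ck_on_compose_bounded_linear:
  assumes "open S" "bounded_linear L" "L ` S \<subseteq> T"
  shows "Ck_on k T f \<Longrightarrow> Ck_on k S (\<lambda>x. f (L x))"
proof (induction k arbitrary: f)
  case 0
  then show ?case
    using continuous_on_compose2[OF _ linear_continuous_on[OF assms(2)] assms(3)] by simp
next
  case (Suc k)
  have "((\<lambda>x. f (L x)) has_derivative (\<lambda>v. frechet_derivative f (at (L x)) (L v))) (at x)"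
    if "x \<in> S" for x
  proof -
    have "(L has_derivative L) (at x)" using assms(2) by (rule bounded_linear_imp_has_derivative)
    moreover have "(f has_derivative frechet_derivative f (at (L x))) (at (L x))"
      using Ck_on_SucD(1)[OF Suc.prems, of "L x"] that assms(3) by auto
    ultimately show ?thesis by (rule has_derivative_compose)
  qed
  then show ?case
    by (rule Ck_on_SucI[OF assms(1)])
      (auto intro!: Suc.IH Ck_on_SucD(2)[OF Suc.prems] simp del: Ck_on.simps)
qed

text \<open>The product rule contains the factors undifferentiated, so the induction hypothesis is
  applied to them after lowering their order.\<close>

lemma Ck_on_mult:
  fixes f g :: "_ \<Rightarrow> real"
  assumes "open S" shows "Ck_on k S f \<Longrightarrow> Ck_on k S g \<Longrightarrow> Ck_on k S (\<lambda>x. f x * g x)"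
proof (induction k arbitrary: f g)
  case (Suc k)
  show ?case
    by (rule Ck_on_SucI[OF assms has_derivative_mult])
      (auto intro!: Suc.IH Ck_on_add Ck_on_SucD(1)[OF Suc.prems(1)] Ck_on_SucD(2)[OF Suc.prems(1)]
        Ck_on_SucD(1)[OF Suc.prems(2)] Ck_on_SucD(2)[OF Suc.prems(2)]
        Ck_on_Suc_imp[OF Suc.prems(1)] Ck_on_Suc_imp[OF Suc.prems(2)] assms simp del: Ck_on.simps)
qed (auto intro: continuous_intros)

text \<open>The derivative is built from the same reciprocal, one order lower; hence the induction
  keeps \<open>f\<close> fixed.\<close>

lemma Ck_on_inverse:
  fixes f :: "_ \<Rightarrow> real"
  assumes "open S" "\<And>x. x \<in> S \<Longrightarrow> f x \<noteq> 0"
  shows "Ck_on k S f \<Longrightarrow> Ck_on k S (\<lambda>x. inverse (f x))"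
proof (induction k)
  case (Suc k)
  show ?case
  proof (rule Ck_on_SucI[OF assms(1)], rule Deriv.has_derivative_inverse)
    have i: "Ck_on k S (\<lambda>x. inverse (f x))"
      using Suc Ck_on_Suc_imp by blast
    \<comment> \<open>The factor \<open>- 1\<close> turns the negative into a product, so that
      closure under products covers it.\<close>
    have "Ck_on k S (\<lambda>x. - 1 * (inverse (f x) * frechet_derivative f (at x) v * inverse (f x)))"
        for v
      using i Ck_on_SucD(2)[OF Suc.prems] by (intro Ck_on_mult Ck_on_const assms(1))
    then show "Ck_on k S (\<lambda>x. - (inverse (f x) * frechet_derivative f (at x) v * inverse (f x)))"
        for v
      by simp
  qed (use assms(2) Ck_on_SucD(1)[OF Suc.prems] in auto)
qed (use assms(2) in \<open>auto intro!: continuous_intros\<close>)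

lemma smooth_on_cong:
  assumes "open S" "\<And>y. y \<in> S \<Longrightarrow> f y = g y"
  shows "smooth_on S f \<longleftrightarrow> smooth_on S g"
  unfolding smooth_on_def using Ck_on_cong[OF assms] by simp

lemma smooth_on_const: "open S \<Longrightarrow> smooth_on S (\<lambda>x. c)"
  by (simp add: smooth_on_def Ck_on_const)

lemma smooth_on_add:
  "open S \<Longrightarrow> smooth_on S f \<Longrightarrow> smooth_on S g \<Longrightarrow> smooth_on S (\<lambda>x. f x + g x)"
  by (simp add: smooth_on_def Ck_on_add)

lemma smooth_on_bounded_linear:
  "open S \<Longrightarrow> bounded_linear L \<Longrightarrow> smooth_on S f \<Longrightarrow> smooth_on S (\<lambda>x. L (f x))"
  by (simp add: smooth_on_def Ck_on_bounded_linear)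

lemma smooth_on_compose_bounded_linear:
  "open S \<Longrightarrow> bounded_linear L \<Longrightarrow> L ` S \<subseteq> T \<Longrightarrow> smooth_on T f \<Longrightarrow> smooth_on S (\<lambda>x. f (L x))"
  unfolding smooth_on_def using Ck_on_compose_bounded_linear by blast

lemma smooth_on_mult:
  fixes f g :: "_ \<Rightarrow> real"
  shows "open S \<Longrightarrow> smooth_on S f \<Longrightarrow> smooth_on S g \<Longrightarrow> smooth_on S (\<lambda>x. f x * g x)"
  by (simp add: smooth_on_def Ck_on_mult)

lemma smooth_on_minus:
  "open S \<Longrightarrow> smooth_on S f \<Longrightarrow> smooth_on S (\<lambda>x. - f x)"
  by (rule smooth_on_bounded_linear[OF _ bounded_linear_minus[OF bounded_linear_ident]])

lemma smooth_on_diff: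
  "open S \<Longrightarrow> smooth_on S f \<Longrightarrow> smooth_on S g \<Longrightarrow> smooth_on S (\<lambda>x. f x - g x)"
  using smooth_on_add[of S f "\<lambda>x. - g x"] smooth_on_minus[of S g] by simp

lemma smooth_on_divide:
  fixes f g :: "_ \<Rightarrow> real"
  shows "open S \<Longrightarrow> smooth_on S f \<Longrightarrow> smooth_on S g \<Longrightarrow> (\<And>x. x \<in> S \<Longrightarrow> g x \<noteq> 0)
    \<Longrightarrow> smooth_on S (\<lambda>x. f x / g x)"
  unfolding divide_inverse
  by (rule smooth_on_mult) (simp_all add: smooth_on_def Ck_on_inverse)

lemma smooth_on_vec_nth:
  "open S \<Longrightarrow> smooth_on S f \<Longrightarrow> smooth_on S (\<lambda>x. f x $ i)"
  by (rule smooth_on_bounded_linear[OF _ bounded_linear_vec_nth])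

lemma smooth_on_imp_differentiable:
  "smooth_on S f \<Longrightarrow> x \<in> S \<Longrightarrow> f differentiable (at x)"
  unfolding smooth_on_def by (metis Ck_on.simps(2))

lemma smooth_on_imp_continuous_on: "smooth_on S f \<Longrightarrow> continuous_on S f"
  unfolding smooth_on_def by (metis Ck_on.simps(1))

lemma smooth_on_frechet_derivative:
  "smooth_on S f \<Longrightarrow> smooth_on S (\<lambda>x. frechet_derivative f (at x) v)"
  unfolding smooth_on_def by (metis Ck_on.simps(2))

lemma smooth_on_partial: "smooth_on S f \<Longrightarrow> smooth_on S (partial i f)"
  unfolding partial_def by (rule smooth_on_frechet_derivative)

lemmas smooth_on_intros = smooth_on_const smooth_on_add smooth_on_mult smooth_on_diff
  smooth_on_minus smooth_on_divide smooth_on_vec_nth smooth_on_partial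


section \<open>Partial derivatives in the plane\<close>

lemma vec2_expand: "v = v $ 1 *\<^sub>R axis 1 1 + v $ 2 *\<^sub>R axis (2::2) (1::real)"
  by (simp add: vec_eq_iff forall_2 axis_def)

lemma linear_vec2:
  fixes L :: "real^2 \<Rightarrow> 'b::real_vector"
  assumes "linear L"
  shows "L v = v $ 1 *\<^sub>R L (axis 1 1) + v $ 2 *\<^sub>R L (axis 2 1)"
  by (subst vec2_expand) (simp only: linear_add[OF assms] linear_scale[OF assms])

lemma has_derivative_partial:
  assumes "f differentiable (at x)"
  shows "(f has_derivative (\<lambda>v. v $ 1 * partial 1 f x + v $ 2 * partial 2 f x)) (at x)"
proof -
  have d: "(f has_derivative frechet_derivative f (at x)) (at x)"
    using assms frechet_derivative_works by blast
  have "frechet_derivative f (at x) v = v $ 1 * partial 1 f x + v $ 2 * partial 2 f x" for v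
    using linear_vec2[OF has_derivative_linear[OF d], of v] by (simp add: partial_def)
  then show ?thesis using d by (metis (no_types, lifting) ext)
qed

lemma partial_eqI: "(f has_derivative D) (at x) \<Longrightarrow> partial i f x = D (axis i 1)"
  unfolding partial_def using frechet_derivative_at by metis

lemma partial_cong_open:
  "open S \<Longrightarrow> x \<in> S \<Longrightarrow> (\<And>y. y \<in> S \<Longrightarrow> f y = g y) \<Longrightarrow> partial i f x = partial i g x"
  unfolding partial_def using frechet_derivative_cong_open by metis

lemma partial_const: "partial i (\<lambda>x. c) x = 0"
  unfolding partial_def by simp

lemma has_frechet_derivative: "f differentiable (at x) \<Longrightarrow> (f has_derivative frechet_derivative f (at
    x)) (at x)"
  using frechet_derivative_works by blast

lemma partial_add:
  "f differentiable (at x) \<Longrightarrow> g differentiable (at x) \<Longrightarrow>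
    partial i (\<lambda>x. f x + g x) x = partial i f x + partial i g x"
  by (subst partial_eqI[OF has_derivative_add]) (auto intro!: has_frechet_derivative
      simp: partial_def)

lemma partial_diff:
  "f differentiable (at x) \<Longrightarrow> g differentiable (at x) \<Longrightarrow>
    partial i (\<lambda>x. f x - g x) x = partial i f x - partial i g x"
  by (subst partial_eqI[OF has_derivative_diff]) (auto intro!: has_frechet_derivative
      simp: partial_def)

lemma partial_mult:
  "f differentiable (at x) \<Longrightarrow> g differentiable (at x) \<Longrightarrow>
    partial i (\<lambda>x. f x * g x) x = f x * partial i g x + partial i f x * g x"
  by (subst partial_eqI[OF has_derivative_mult]) (auto intro!: has_frechet_derivative
      simp: partial_def)

lemma partial_divide:
  assumes "f differentiable (at x)" "g differentiable (at x)" "g x \<noteq> 0"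
  shows "partial i (\<lambda>x. f x / g x) x = (partial i f x * g x - f x * partial i g x) / (g x)\<^sup>2"
  by (subst partial_eqI[OF has_derivative_divide'])
    (use assms in \<open>auto intro!: has_frechet_derivative simp: partial_def power2_eq_square\<close>)

text \<open>Schwarz's theorem under Peano's hypothesis: only the first derivatives need to exist near
  the point, and only they need to be differentiable at it. The mixed second difference, divided
  by the square of the step, tends to either mixed derivative.\<close>

lemma second_difference_tendsto:
  fixes h :: "'v::real_normed_vector \<Rightarrow> real"
  assumes "open S" "x \<in> S" and h: "\<And>y. y \<in> S \<Longrightarrow> (h has_derivative D y) (at y)"
    and D: "((\<lambda>y. D y v) has_derivative L) (at x)"
  shows "((\<lambda>s. (h (x + s *\<^sub>R v + s *\<^sub>R w) - h (x + s *\<^sub>R v) - h (x + s *\<^sub>R w) + h x) / s\<^sup>2)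
    \<longlongrightarrow> L w) (at_right 0)"
proof (rule tendstoI)
  fix e :: real assume "e > 0"
  define c where "c = norm v + norm w + 1"
  have c: "c > 0" by (simp add: c_def add_nonneg_pos)
  \<comment> \<open>Two remainders of size \<open>e' * (s * c)\<close> will occur, and
    \<open>2 / 3 * e * s\<close> stays strictly below \<open>e * s\<close>.\<close>
  define e' where "e' = e / (3 * c)"
  have e': "e' > 0" using \<open>e > 0\<close> c by (simp add: e'_def)
  interpret L: bounded_linear L using D by (rule has_derivative_bounded_linear)
  obtain d where d: "d > 0" "\<And>y. norm (y - x) < d \<Longrightarrow> \<bar>D y v - D x v - L (y - x)\<bar> \<le> e' * norm (y - x)"
    using D[unfolded has_derivative_at_alt] e' by (metis real_norm_def)
  obtain r where r: "r > 0" "ball x r \<subseteq> S"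
    using assms(1,2) open_contains_ball by blast
  define m where "m = min d r / c"
  have m: "m > 0" using d r c by (simp add: m_def)
  have "dist ((h (x + s *\<^sub>R v + s *\<^sub>R w) - h (x + s *\<^sub>R v) - h (x + s *\<^sub>R w)
      + h x) / s\<^sup>2) (L w) < e"
    if s: "0 < s" "s < m" for s
  proof -
    have sc: "s * c < min d r" using s c by (simp add: m_def field_simps)
    have small: "norm (\<xi> *\<^sub>R v + b *\<^sub>R w) \<le> s * c" "norm (\<xi> *\<^sub>R v + b *\<^sub>R w) < d"
        "x + \<xi> *\<^sub>R v + b *\<^sub>R w \<in> S" if "0 \<le> \<xi>" "\<xi> \<le> s" "0 \<le> b" "b \<le> s" for \<xi> b
    proof -
      have "norm (\<xi> *\<^sub>R v + b *\<^sub>R w) \<le> \<xi> * norm v + b * norm w"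
        using norm_triangle_ineq[of "\<xi> *\<^sub>R v" "b *\<^sub>R w"] that by simp
      also have "\<dots> \<le> s * norm v + s * norm w"
        using that by (intro add_mono mult_right_mono) auto
      also have "\<dots> \<le> s * c" using s by (simp add: c_def algebra_simps)
      finally show n: "norm (\<xi> *\<^sub>R v + b *\<^sub>R w) \<le> s * c" .
      then show "norm (\<xi> *\<^sub>R v + b *\<^sub>R w) < d" using sc by simp
      have "dist x (x + (\<xi> *\<^sub>R v + b *\<^sub>R w)) < r"
        using n sc unfolding dist_norm by (subst norm_minus_commute) simp
      then show "x + \<xi> *\<^sub>R v + b *\<^sub>R w \<in> S" using r by (auto simp: add.assoc)
    qed
    \<comment> \<open>The second difference is the increment of \<open>u\<close> over
      \<open>[0, s]\<close>, so the mean value theorem reduces it to one difference of values of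
      \<open>D _ v\<close>.\<close>
    define u where "u = (\<lambda>r. h (x + r *\<^sub>R v + s *\<^sub>R w) - h (x + r *\<^sub>R v))"
    have hl: "((\<lambda>r. h (x + r *\<^sub>R v + b *\<^sub>R w)) has_real_derivative D (x + \<xi> *\<^sub>R v
        + b *\<^sub>R w) v) (at \<xi>)"
      if "0 \<le> \<xi>" "\<xi> \<le> s" "0 \<le> b" "b \<le> s" for \<xi> b
    proof -
      have g: "((\<lambda>r. x + r *\<^sub>R v + b *\<^sub>R w) has_derivative (\<lambda>t. t *\<^sub>R v)) (at \<xi>)"
        by (auto intro!: derivative_eq_intros)
      have "(h has_derivative D (x + \<xi> *\<^sub>R v + b *\<^sub>R w)) (at (x + \<xi> *\<^sub>R v + b *\<^sub>R w))"
        using h small(3) that by blast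
      from has_derivative_compose[OF g this]
      show ?thesis
        using linear_scale[OF has_derivative_linear[OF h[OF small(3)[OF that]]]]
        by (simp add: has_field_derivative_def mult.commute[of _ "D _ v"] o_def)
    qed
    have du: "(u has_real_derivative (D (x + \<xi> *\<^sub>R v + s *\<^sub>R w) v - D (x + \<xi> *\<^sub>R v) v)) (at \<xi>)"
      if "0 \<le> \<xi>" "\<xi> \<le> s" for \<xi>
      unfolding u_def using hl[OF that, of s] hl[OF that, of 0] s
      by (intro DERIV_diff) auto
    obtain \<xi> where \<xi>: "0 < \<xi>" "\<xi> < s" "u s - u 0 = (s - 0) * (D (x + \<xi> *\<^sub>R v + s *\<^sub>R w) v - D (x
        + \<xi> *\<^sub>R v) v)"
      using MVT2[OF s(1), of u "\<lambda>\<xi>. D (x + \<xi> *\<^sub>R v + s *\<^sub>R w) v - D (x + \<xi> *\<^sub>R v) v"] du by blast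
    \<comment> \<open>Both points are compared with \<open>x\<close>, the only point where
      \<open>D _ v\<close> is known to be differentiable; the contributions
      \<open>L (\<xi> *\<^sub>R v)\<close> then cancel.\<close>
    have 1: "\<bar>D (x + \<xi> *\<^sub>R v + s *\<^sub>R w) v - D x v - L (\<xi> *\<^sub>R v + s *\<^sub>R w)\<bar> \<le> e' * (s * c)"
      using d(2)[of "x + \<xi> *\<^sub>R v + s *\<^sub>R w"] small(1,2)[of \<xi> s] \<xi> s e'
      by (smt (verit, ccfv_SIG) add.assoc add_diff_cancel_left' mult_left_mono)
    have 2: "\<bar>D (x + \<xi> *\<^sub>R v) v - D x v - L (\<xi> *\<^sub>R v)\<bar> \<le> e' * (s * c)"
      using d(2)[of "x + \<xi> *\<^sub>R v"] small(1,2)[of \<xi> 0] \<xi> s e'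
      by (smt (verit, ccfv_SIG) add_0_right scale_zero_left add_diff_cancel_left' mult_left_mono)
    have L: "L (\<xi> *\<^sub>R v + s *\<^sub>R w) = L (\<xi> *\<^sub>R v) + s * L w"
      by (simp add: L.add L.scaleR)
    have "\<bar>D (x + \<xi> *\<^sub>R v + s *\<^sub>R w) v - D (x + \<xi> *\<^sub>R v) v - s * L w\<bar> \<le> 2 * (e' * (s * c))"
      using 1 2 unfolding L by linarith
    also have "2 * (e' * (s * c)) < e * s"
      using s c \<open>e > 0\<close> by (simp add: e'_def field_simps)
    finally have 3: "\<bar>(D (x + \<xi> *\<^sub>R v + s *\<^sub>R w) v - D (x + \<xi> *\<^sub>R v) v) / s - L w\<bar> < e"
      using s by (simp add: abs_less_iff field_simps)
    have "(h (x + s *\<^sub>R v + s *\<^sub>R w) - h (x + s *\<^sub>R v) - h (x + s *\<^sub>R w) + h x) / s\<^sup>2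
        = (u s - u 0) / s\<^sup>2"
      by (simp add: u_def)
    also have "\<dots> = (D (x + \<xi> *\<^sub>R v + s *\<^sub>R w) v - D (x + \<xi> *\<^sub>R v) v) / s"
      using s \<xi>(3) by (simp add: power2_eq_square)
    finally show ?thesis using 3 by (simp add: dist_real_def)
  qed
  then show "\<forall>\<^sub>F s in at_right 0. dist ((h (x + s *\<^sub>R v + s *\<^sub>R w) - h (x + s *\<^sub>R v)
      - h (x + s *\<^sub>R w) + h x) / s\<^sup>2) (L w) < e"
    using m eventually_at_right_real[OF m] by (auto elim!: eventually_mono)
qed

lemma second_derivative_symmetric:
  fixes h :: "'v::real_normed_vector \<Rightarrow> real"
  assumes "open S" "x \<in> S" "\<And>y. y \<in> S \<Longrightarrow> (h has_derivative D y) (at y)"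
    and "((\<lambda>y. D y v) has_derivative L) (at x)" "((\<lambda>y. D y w) has_derivative M) (at x)"
  shows "L w = M v"
proof -
  have "((\<lambda>s. (h (x + s *\<^sub>R v + s *\<^sub>R w) - h (x + s *\<^sub>R v) - h (x + s *\<^sub>R w) + h x) / s\<^sup>2)
    \<longlongrightarrow> L w) (at_right 0)"
    by (rule second_difference_tendsto[OF assms(1-4)])
  moreover have "((\<lambda>s. (h (x + s *\<^sub>R v + s *\<^sub>R w) - h (x + s *\<^sub>R v) - h (x + s *\<^sub>R w) + h x) / s\<^sup>2)
    \<longlongrightarrow> M v) (at_right 0)"
    using second_difference_tendsto[OF assms(1-3,5), of v] by (simp add: algebra_simps)
  ultimately show ?thesis
    using tendsto_unique trivial_limit_at_right_real by blast
qed

lemma partial_commute: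
  fixes f :: "real^2 \<Rightarrow> real"
  assumes "open S" "smooth_on S f" "x \<in> S"
  shows "partial i (partial j f) x = partial j (partial i f) x"
proof -
  have "(f has_derivative frechet_derivative f (at y)) (at y)" if "y \<in> S" for y
    using that assms has_frechet_derivative smooth_on_imp_differentiable by blast
  moreover have "(partial l f has_derivative frechet_derivative (partial l f) (at x)) (at x)" for l
    using assms has_frechet_derivative smooth_on_imp_differentiable smooth_on_partial by blast
  ultimately show ?thesis
    using second_derivative_symmetric[OF assms(1,3), of f "\<lambda>y. frechet_derivative f (at y)"
        "axis j 1" _ "axis i 1"]
    unfolding partial_def by fastforce
qed


section \<open>Killing fields in a coordinate patch\<close>

text \<open>The coefficient of dx \<and> dy in the exterior derivative of the 1-form with components
  \<sigma>. It is a density: coordinate changes multiply it by the Jacobian.\<close>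

definition rot :: "(real^2 \<Rightarrow> real^2) \<Rightarrow> real^2 \<Rightarrow> real" where
  "rot \<sigma> x = partial 1 (\<lambda>y. \<sigma> y $ 2) x - partial 2 (\<lambda>y. \<sigma> y $ 1) x"

definition lower :: "(real^2 \<Rightarrow> real^2^2) \<Rightarrow> (real^2 \<Rightarrow> real^2) \<Rightarrow> real^2 \<Rightarrow> real^2" where
  "lower G k x = G x *v k x"

text \<open>The formula of \<open>gauss_curvature\<close> for an arbitrary coordinate matrix, so
  that it can be differentiated in one chart while the point varies.\<close>

definition curv :: "(real^2 \<Rightarrow> real^2^2) \<Rightarrow> real^2 \<Rightarrow> real" where
  "curv G x = (\<Sum>l\<in>UNIV. G x $ 1 $ l * riemann G l 1 2 2 x) / det (G x)"

text \<open>The coordinate expression of the vanishing Lie derivative of the metric along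
  \<open>k\<close>.\<close>

definition killing_on :: "(real^2) set \<Rightarrow> (real^2 \<Rightarrow> real^2^2) \<Rightarrow> (real^2 \<Rightarrow> real^2) \<Rightarrow> bool" where
  "killing_on S G k \<longleftrightarrow> smooth_on S k \<and> (\<forall>x\<in>S. \<forall>i j. (\<Sum>l\<in>UNIV. k x $ l * partial l (\<lambda>y. G y $ i $ j) x
      +
     G x $ l $ j * partial i (\<lambda>y. k y $ l) x + G x $ i $ l * partial j (\<lambda>y. k y $ l) x) = 0)"

lemma matrix_inv_2:
  fixes M :: "real^2^2"
  assumes "det M \<noteq> 0"
  shows "matrix_inv M $ 1 $ 1 = M $ 2 $ 2 / det M" "matrix_inv M $ 1 $ 2 = - M $ 1 $ 2 / det M"
    "matrix_inv M $ 2 $ 1 = - M $ 2 $ 1 / det M" "matrix_inv M $ 2 $ 2 = M $ 1 $ 1 / det M"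
proof -
  define N :: "real^2^2" where "N = (\<chi> i j. if i = 1 then (if j = 1 then M $ 2 $ 2 / det M else
      - M $ 1 $ 2 / det M)
    else (if j = 1 then - M $ 2 $ 1 / det M else M $ 1 $ 1 / det M))"
  have MN: "M ** N = mat 1" and NM: "N ** M = mat 1"
    using assms by (simp_all add: N_def vec_eq_iff forall_2 matrix_matrix_mult_def sum_2 mat_def
        add_divide_distrib[symmetric] diff_divide_distrib[symmetric] mult.commute)
      (simp_all add: det_2 mult.commute)
  have "M ** matrix_inv M = mat 1"
    unfolding matrix_inv_def using someI[of "\<lambda>A'. M ** A' = mat 1 \<and> A' ** M = mat 1" N] MN NM
        by blast
  then have "matrix_inv M = N"
    by (metis NM matrix_mul_assoc matrix_mul_lid matrix_mul_rid)
  then show "matrix_inv M $ 1 $ 1 = M $ 2 $ 2 / det M" "matrix_inv M $ 1 $ 2 = - M $ 1 $ 2 / det M"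
    "matrix_inv M $ 2 $ 1 = - M $ 2 $ 1 / det M" "matrix_inv M $ 2 $ 2 = M $ 1 $ 1 / det M"
    by (simp_all add: N_def)
qed

section \<open>Curvature in coordinates\<close>

locale riemannian_patch =
  fixes S :: "(real^2) set" and G :: "real^2 \<Rightarrow> real^2^2"
  assumes open_S: "open S" and smooth_G: "smooth_on S G"
    and sym: "x \<in> S \<Longrightarrow> G x $ 2 $ 1 = G x $ 1 $ 2"
    and det_pos: "x \<in> S \<Longrightarrow> 0 < det (G x)"
begin

abbreviation a where "a \<equiv> \<lambda>x. G x $ 1 $ 1"
abbreviation b where "b \<equiv> \<lambda>x. G x $ 1 $ 2"
abbreviation c where "c \<equiv> \<lambda>x. G x $ 2 $ 2"
abbreviation W where "W \<equiv> \<lambda>x. a x * c x - b x * b x"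

lemma det_eq: "x \<in> S \<Longrightarrow> det (G x) = W x"
  by (simp add: det_2 sym)

lemma W_pos: "x \<in> S \<Longrightarrow> 0 < W x"
  using det_eq det_pos by metis

lemma smooth_G_nth: "smooth_on S (\<lambda>x. G x $ i $ j)"
  by (intro smooth_on_intros open_S smooth_G)

lemma partial_sym: "x \<in> S \<Longrightarrow> partial i (\<lambda>y. G y $ 2 $ 1) x = partial i b x"
  by (rule partial_cong_open[OF open_S]) (auto simp: sym)

text \<open>\<open>L l i j\<close> is the Christoffel symbol of the first kind; Cramer's rule for
  the inverse matrix raises its index.\<close>

lemma christoffel_eq:
  assumes "y \<in> S"
  defines "L \<equiv> \<lambda>l i j. (partial i (\<lambda>y. G y $ j $ l) y + partial j (\<lambda>y. G y $ i $ l) y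
    - partial l (\<lambda>y. G y $ i $ j) y) / 2"
  shows "christoffel G 1 i j y = (c y * L 1 i j - b y * L 2 i j) / W y"
    "christoffel G 2 i j y = (a y * L 2 i j - b y * L 1 i j) / W y"
proof -
  have nz: "det (G y) \<noteq> 0" using det_pos assms by force
  show "christoffel G 1 i j y = (c y * L 1 i j - b y * L 2 i j) / W y"
    "christoffel G 2 i j y = (a y * L 2 i j - b y * L 1 i j) / W y"
    unfolding christoffel_def sum_2 matrix_inv_2[OF nz]
    by (simp_all only: det_eq[OF assms(1)] sym[OF assms(1)] L_def divide_inverse)
      (simp_all add: algebra_simps)
qed

lemma smooth_christoffel: "smooth_on S (christoffel G k i j)"
proof -
  have "smooth_on S (\<lambda>y. (c y * ((partial i (\<lambda>y. G y $ j $ 1) y + partial j (\<lambda>y. G y $ i $ 1) y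
    - partial 1 (\<lambda>y. G y $ i $ j) y) / 2) - b y * ((partial i (\<lambda>y. G y $ j $ 2) y
        + partial j (\<lambda>y. G y $ i $ 2) y
    - partial 2 (\<lambda>y. G y $ i $ j) y) / 2)) / W y)"
    "smooth_on S (\<lambda>y. (a y * ((partial i (\<lambda>y. G y $ j $ 2) y + partial j (\<lambda>y. G y $ i $ 2) y
    - partial 2 (\<lambda>y. G y $ i $ j) y) / 2) - b y * ((partial i (\<lambda>y. G y $ j $ 1) y
        + partial j (\<lambda>y. G y $ i $ 1) y
    - partial 1 (\<lambda>y. G y $ i $ j) y) / 2)) / W y)"
    using W_pos by (intro smooth_on_intros open_S smooth_G; force)+
  then have "smooth_on S (christoffel G 1 i j)" "smooth_on S (christoffel G 2 i j)"
    by (simp_all add: smooth_on_cong[OF open_S christoffel_eq(1)] smooth_on_cong[OF open_S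
        christoffel_eq(2)])
  then show ?thesis using exhaust_2[of k] by auto
qed

lemma smooth_curv: "smooth_on S (curv G)"
  unfolding curv_def[abs_def] riemann_def sum_2 det_2
  by (intro smooth_on_intros open_S smooth_G smooth_christoffel)
    (use det_pos in \<open>force simp: det_2\<close>)

text \<open>Lowering the index undoes the inverse matrix. The first row of \<open>G\<close> is the
  one that matters, because the curvature pairs the Riemann tensor with the first coordinate
  vector.\<close>

lemma lower_christoffel:
  assumes "y \<in> S"
  shows "a y * christoffel G 1 i j y + b y * christoffel G 2 i j y =
    (partial i (\<lambda>y. G y $ j $ 1) y + partial j (\<lambda>y. G y $ i $ 1) y - partial 1 (\<lambda>y. G y $ i $ j)
        y) / 2"
proof -
  have "a y * ((c y * L1 - b y * L2) / W y) + b y * ((a y * L2 - b y * L1) / W y) = L1" for L1 L2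
  proof -
    have "a y * ((c y * L1 - b y * L2) / W y) + b y * ((a y * L2 - b y * L1) / W y)
        = L1 * W y / W y"
      unfolding times_divide_eq_right add_divide_distrib[symmetric] by (simp add: algebra_simps)
    then show ?thesis using W_pos[OF assms] by simp
  qed
  then show ?thesis unfolding christoffel_eq[OF assms] by blast
qed

text \<open>A form free of denominators, in the manner of Brioschi's formula: multiplied by
  \<open>(W x)\<^sup>2\<close>, the curvature is a polynomial in the metric and its first two
  derivatives, so that later identities are pure algebra.\<close>

lemma curv_eq:
  assumes x: "x \<in> S"
  shows "curv G x * (W x)\<^sup>2 = W x * (partial 1 (partial 2 b) x - partial 1 (partial 1 c) x / 2
      - partial 2 (partial 2 a) x / 2)
    - partial 1 a x / 2 * (c x * (partial 2 b x - partial 1 c x / 2) - b x * (partial 2 c x / 2))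
    + (partial 2 a x / 2 - partial 1 b x) * (a x * (partial 2 c x / 2) - b x * (partial 2 b x
        - partial 1 c x / 2))
    + partial 2 a x / 2 * (c x * (partial 2 a x / 2) - b x * (partial 1 c x / 2))
    + partial 1 c x / 2 * (a x * (partial 1 c x / 2) - b x * (partial 2 a x / 2))"
proof -
  define P where "P = christoffel G"
  note sm = smooth_on_imp_differentiable[OF _ x]
  have dG: "(\<lambda>y. G y $ i $ j) differentiable (at x)" for i j
    by (intro sm smooth_G_nth)
  have dG': "partial k (\<lambda>y. G y $ i $ j) differentiable (at x)" for i j k
    by (intro sm smooth_G_nth smooth_on_partial)
  have dP: "P k i j differentiable (at x)" for k i j
    unfolding P_def by (intro sm smooth_christoffel)
  have l22: "a y * P 1 2 2 y + b y * P 2 2 2 y = partial 2 b y - partial 1 c y / 2" if "y \<in> S" for y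
    unfolding P_def lower_christoffel[OF that] by (simp add: partial_sym[OF that])
  have l12: "a y * P 1 1 2 y + b y * P 2 1 2 y = partial 2 a y / 2" if "y \<in> S" for y
    unfolding P_def lower_christoffel[OF that] by (simp add: partial_sym[OF that])
  have l11: "a y * P 1 1 1 y + b y * P 2 1 1 y = partial 1 a y / 2" if "y \<in> S" for y
    unfolding P_def lower_christoffel[OF that] by (simp add: partial_sym[OF that])
  \<comment> \<open>Differentiating the lowered identities yields the required combinations of
    derivatives of Christoffel symbols without differentiating a quotient.\<close>
  have "partial 1 (\<lambda>y. a y * P 1 2 2 y + b y * P 2 2 2 y) x = partial 1 (\<lambda>y. partial 2 b y
      - partial 1 c y / 2) x"
    by (rule partial_cong_open[OF open_S x]) (rule l22)
  then have 1: "a x * partial 1 (P 1 2 2) x + partial 1 a x * P 1 2 2 x + b x * partial 1 (P 2 2 2)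
      x + partial 1 b x * P 2 2 2 x
     = partial 1 (partial 2 b) x - partial 1 (partial 1 c) x / 2"
    by (simp add: partial_add partial_mult partial_diff partial_divide partial_const dG dG' dP
        power2_eq_square)
  have "partial 2 (\<lambda>y. a y * P 1 1 2 y + b y * P 2 1 2 y) x = partial 2 (\<lambda>y. partial 2 a y / 2) x"
    by (rule partial_cong_open[OF open_S x]) (rule l12)
  then have 2: "a x * partial 2 (P 1 1 2) x + partial 2 a x * P 1 1 2 x + b x * partial 2 (P 2 1 2)
      x + partial 2 b x * P 2 1 2 x
     = partial 2 (partial 2 a) x / 2"
    by (simp add: partial_add partial_mult partial_divide partial_const dG dG' dP power2_eq_square)
  have W: "W x \<noteq> 0" using W_pos[OF x] by simp
  have P12: "P k 2 1 x = P k 1 2 x" for k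
    unfolding P_def christoffel_def sum_2 by (simp add: partial_sym[OF x])
  have "curv G x * W x = a x * riemann G 1 1 2 2 x + b x * riemann G 2 1 2 2 x"
    using W by (simp add: curv_def sum_2 det_eq[OF x])
  \<comment> \<open>The quadratic terms are grouped so that each contains a lowered symbol, which is
    a combination of first derivatives of the metric.\<close>
  also have "\<dots> = (a x * partial 1 (P 1 2 2) x + b x * partial 1 (P 2 2 2) x)
      - (a x * partial 2 (P 1 1 2) x + b x * partial 2 (P 2 1 2) x)
      + P 1 2 2 x * (a x * P 1 1 1 x + b x * P 2 1 1 x) + P 2 2 2 x * (a x * P 1 1 2 x
          + b x * P 2 1 2 x)
      - P 1 1 2 x * (a x * P 1 1 2 x + b x * P 2 1 2 x) - P 2 1 2 x * (a x * P 1 2 2 x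
          + b x * P 2 2 2 x)"
    by (simp add: riemann_def sum_2 P_def[symmetric] P12 algebra_simps)
  also have "\<dots> = partial 1 (partial 2 b) x - partial 1 (partial 1 c) x / 2 - partial 2 (partial 2 a)
      x / 2
      - partial 1 a x / 2 * P 1 2 2 x + (partial 2 a x / 2 - partial 1 b x) * P 2 2 2 x
      + partial 2 a x / 2 * P 1 1 2 x + partial 1 c x / 2 * P 2 1 2 x"
    unfolding l11[OF x] l12[OF x] l22[OF x] using 1 2 by (simp add: algebra_simps)
  finally have 3: "curv G x * W x = \<dots>" .
  have P: "W x * P 1 2 2 x = c x * (partial 2 b x - partial 1 c x / 2) - b x * (partial 2 c x / 2)"
    "W x * P 2 2 2 x = a x * (partial 2 c x / 2) - b x * (partial 2 b x - partial 1 c x / 2)"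
    "W x * P 1 1 2 x = c x * (partial 2 a x / 2) - b x * (partial 1 c x / 2)"
    "W x * P 2 1 2 x = a x * (partial 1 c x / 2) - b x * (partial 2 a x / 2)"
    using W unfolding P_def christoffel_eq[OF x] by (simp_all add: partial_sym[OF x])
  have "curv G x * (W x)\<^sup>2 = W x * (curv G x * W x)"
    by (simp add: power2_eq_square)
  then show ?thesis
    unfolding 3 P[symmetric] by (simp add: algebra_simps)
qed

section \<open>The Killing equations and their integrability conditions\<close>

lemma killing_onD:
  assumes "killing_on S G k" "x \<in> S"
  defines "X \<equiv> \<lambda>y. k y $ 1" and "Y \<equiv> \<lambda>y. k y $ 2"
  shows "X x * partial 1 a x + Y x * partial 2 a x + 2 * (a x * partial 1 X x + b x * partial 1 Y x)
      = 0"
    "X x * partial 1 b x + Y x * partial 2 b x + a x * partial 2 X x + b x * partial 2 Y x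
      + b x * partial 1 X x + c x * partial 1 Y x = 0"
    "X x * partial 1 c x + Y x * partial 2 c x + 2 * (b x * partial 2 X x + c x * partial 2 Y x)
        = 0"
proof -
  have "(\<Sum>l\<in>UNIV. k x $ l * partial l (\<lambda>y. G y $ i $ j) x +
     G x $ l $ j * partial i (\<lambda>y. k y $ l) x + G x $ i $ l * partial j (\<lambda>y. k y $ l) x) = 0" for i j
    using assms unfolding killing_on_def by blast
  from this[of 1 1] this[of 1 2] this[of 2 2]
  show "X x * partial 1 a x + Y x * partial 2 a x + 2 * (a x * partial 1 X x + b x * partial 1 Y x)
      = 0"
    "X x * partial 1 b x + Y x * partial 2 b x + a x * partial 2 X x + b x * partial 2 Y x
      + b x * partial 1 X x + c x * partial 1 Y x = 0"
    "X x * partial 1 c x + Y x * partial 2 c x + 2 * (b x * partial 2 X x + c x * partial 2 Y x)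
        = 0"
    unfolding sum_2 sym[OF assms(2)] X_def Y_def by (auto simp: algebra_simps)
qed

lemma smooth_killing: "killing_on S G k \<Longrightarrow> smooth_on S (\<lambda>x. k x $ i)"
  unfolding killing_on_def by (intro smooth_on_vec_nth open_S) simp

lemma partial_W:
  assumes "x \<in> S"
  shows "partial i W x = a x * partial i c x + partial i a x * c x - 2 * b x * partial i b x"
proof -
  have "(\<lambda>y. G y $ i $ j) differentiable (at x)" for i j
    by (intro smooth_on_imp_differentiable[OF _ assms] smooth_G_nth)
  then show ?thesis
    by (simp add: partial_mult partial_diff)
qed

text \<open>\<open>sqrt W\<close> is the area density, which a Killing field preserves; for its
  square the divergence gets the factor 2. The identity is \<open>c\<close> times the first Killing
  equation plus \<open>a\<close> times the third minus \<open>2 * b\<close> times the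
  second.\<close>

lemma killing_det:
  assumes "killing_on S G k" "x \<in> S"
  shows "k x $ 1 * partial 1 W x + k x $ 2 * partial 2 W x
    + 2 * W x * (partial 1 (\<lambda>y. k y $ 1) x + partial 2 (\<lambda>y. k y $ 2) x) = 0"
  unfolding partial_W[OF assms(2)] using killing_onD[OF assms] by algebra

lemma rot_lower:
  assumes "killing_on S G k" "x \<in> S"
  defines "X \<equiv> \<lambda>y. k y $ 1" and "Y \<equiv> \<lambda>y. k y $ 2"
  shows "rot (lower G k) x = partial 1 b x * X x + partial 1 c x * Y x - partial 2 a x * X x
      - partial 2 b x * Y x
    + b x * partial 1 X x + c x * partial 1 Y x - a x * partial 2 X x - b x * partial 2 Y x"
proof -
  have dG: "(\<lambda>y. G y $ i $ j) differentiable (at x)" for i j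
    by (intro smooth_on_imp_differentiable[OF _ assms(2)] smooth_G_nth)
  have dk: "(\<lambda>y. k y $ i) differentiable (at x)" for i
    by (intro smooth_on_imp_differentiable[OF _ assms(2)] smooth_killing assms(1))
  show ?thesis
    unfolding rot_def lower_def matrix_vector_mult_def X_def Y_def
    by (simp add: sum_2 partial_add partial_mult dG dk partial_sym[OF assms(2)] sym[OF assms(2)])
qed

lemma smooth_rot_lower:
  assumes "killing_on S G k" shows "smooth_on S (rot (lower G k))"
proof -
  have "smooth_on S (\<lambda>x. lower G k x $ i)" for i
    unfolding lower_def matrix_vector_mult_def
    by (simp add: sum_2) (intro smooth_on_intros open_S smooth_G smooth_killing[OF assms])
  then show ?thesis
    unfolding rot_def[abs_def] by (intro smooth_on_partial smooth_on_diff open_S)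
qed

text \<open>Writing \<open>\<nabla>\<^sub>iK\<^sub>j = \<lambda> \<epsilon>\<^sub>i\<^sub>j\<close> with the area form \<open>\<epsilon>\<close>, the classical identity \<open>\<nabla>\<nabla>K = -R K\<close> says
  that \<open>d\<lambda>\<close> is, up to sign, the curvature times the contraction of \<open>\<epsilon>\<close> with \<open>K\<close>; here \<open>rot (lower
  G k)\<close> is \<open>2 \<lambda> sqrt W\<close>. The factors in the last steps exhibit the difference of the two sides as
  a combination of the Killing equations and their first derivatives.\<close>

lemma rot_lower_derivative:
  assumes k: "killing_on S G k" and x: "x \<in> S"
  shows "2 * W x * partial 1 (rot (lower G k)) x - rot (lower G k) x * partial 1 W x
      = - 4 * curv G x * (W x)\<^sup>2 * k x $ 2"
    "2 * W x * partial 2 (rot (lower G k)) x - rot (lower G k) x * partial 2 W x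
      = 4 * curv G x * (W x)\<^sup>2 * k x $ 1"
proof -
  define X Y where XY: "X = (\<lambda>y. k y $ 1)" "Y = (\<lambda>y. k y $ 2)"
  have kx: "k y $ 1 = X y" "k y $ 2 = Y y" for y by (simp_all add: XY)
  define m where "m = rot (lower G k)"
  note killing = killing_onD[OF k, unfolded kx]
  have sm: "smooth_on S X" "smooth_on S Y" "smooth_on S a" "smooth_on S b" "smooth_on S c"
    unfolding XY using smooth_killing[OF k] smooth_G_nth by auto
  note d [simp] = sm[THEN smooth_on_imp_differentiable, OF x] sm[THEN smooth_on_partial, THEN
      smooth_on_imp_differentiable, OF x]
  note [simp] = sm[THEN partial_commute[OF open_S _ x], of 2 1]
  have m: "partial i m x = partial i (\<lambda>x. partial 1 b x * X x + partial 1 c x * Y x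
      - partial 2 a x * X x - partial 2 b x * Y x
    + b x * partial 1 X x + c x * partial 1 Y x - a x * partial 2 X x - b x * partial 2 Y x) x"
        for i
    unfolding m_def using rot_lower[OF k, unfolded kx] by (intro partial_cong_open[OF open_S x])
  \<comment> \<open>The Killing equations hold on an open set, so their derivatives vanish there
    too.\<close>
  have E: "partial i (\<lambda>x. X x * partial 1 a x + Y x * partial 2 a x + 2 * (a x * partial 1 X x
      + b x * partial 1 Y x)) x = 0"
    "partial i (\<lambda>x. X x * partial 1 b x + Y x * partial 2 b x + a x * partial 2 X x
        + b x * partial 2 Y x
      + b x * partial 1 X x + c x * partial 1 Y x) x = 0"
    "partial i (\<lambda>x. X x * partial 1 c x + Y x * partial 2 c x + 2 * (b x * partial 2 X x
        + c x * partial 2 Y x)) x = 0" for i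
    using killing partial_const[of i 0 x] by (subst partial_cong_open[OF open_S x, of _ "\<lambda>_. 0"];
        force)+
  note E' = E[simplified partial_add partial_mult partial_const differentiable_add
      differentiable_mult d differentiable_const]
  note M = m[simplified partial_add partial_mult partial_diff partial_const differentiable_add
      differentiable_diff differentiable_mult d differentiable_const]
  \<comment> \<open>The names give the indices of the Killing equation, followed by the direction in
    which it is differentiated.\<close>
  have e11_2: "2 * a x * partial 1 (partial 2 X) x + 2 * b x * partial 1 (partial 2 Y) x
      + partial 1 a x *
      partial 2 X x + 2 * partial 2 a x * partial 1 X x + partial 2 a x * partial 2 Y x + 2 *
      partial 2 b x * partial 1 Y x + partial 1 (partial 2 a) x * X x + partial 2 (partial 2 a)
      x * Y x = 0" (is "?e11_2 = 0")
    using E'(1)[of 2] by (simp add: algebra_simps)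
  have e12_1: "a x * partial 1 (partial 2 X) x + b x * partial 1 (partial 1 X) x
      + b x * partial 1 (partial 2
      Y) x + c x * partial 1 (partial 1 Y) x + partial 1 a x * partial 2 X x + 2 * partial 1 b x
      * partial 1 X x + partial 1 b x * partial 2 Y x + partial 2 b x * partial 1 Y x + partial
      1 c x * partial 1 Y x + partial 1 (partial 1 b) x * X x + partial 1 (partial 2 b) x * Y x
          = 0" (is "?e12_1 = 0")
    using E'(2)[of 1] by (simp add: algebra_simps)
  have e12_2: "a x * partial 2 (partial 2 X) x + b x * partial 1 (partial 2 X) x
      + b x * partial 2 (partial 2
      Y) x + c x * partial 1 (partial 2 Y) x + partial 2 a x * partial 2 X x + partial 1 b x *
      partial 2 X x + partial 2 b x * partial 1 X x + 2 * partial 2 b x * partial 2 Y x +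
      partial 2 c x * partial 1 Y x + partial 1 (partial 2 b) x * X x + partial 2 (partial 2 b)
      x * Y x = 0" (is "?e12_2 = 0")
    using E'(2)[of 2] by (simp add: algebra_simps)
  have e22_1: "2 * b x * partial 1 (partial 2 X) x + 2 * c x * partial 1 (partial 2 Y) x
      + 2 * partial 1 b x *
      partial 2 X x + partial 1 c x * partial 1 X x + 2 * partial 1 c x * partial 2 Y x +
      partial 2 c x * partial 1 Y x + partial 1 (partial 1 c) x * X x + partial 1 (partial 2 c)
      x * Y x = 0" (is "?e22_1 = 0")
    using E'(3)[of 1] by (simp add: algebra_simps)
  have m1: "partial 1 m x = (- 1) * a x * partial 1 (partial 2 X) x + b x * partial 1 (partial 1 X)
      x + (- 1) * b x *
      partial 1 (partial 2 Y) x + c x * partial 1 (partial 1 Y) x + (- 1) * partial 1 a x *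
      partial 2 X x + (- 1) * partial 2 a x * partial 1 X x + 2 * partial 1 b x * partial 1 X x
      + (- 1) * partial 1 b x * partial 2 Y x + (- 1) * partial 2 b x * partial 1 Y x + 2 *
      partial 1 c x * partial 1 Y x + (- 1) * partial 1 (partial 2 a) x * X x + partial 1
      (partial 1 b) x * X x + (- 1) * partial 1 (partial 2 b) x * Y x + partial 1 (partial 1 c)
      x * Y x"
    using M[of 1] by (simp add: algebra_simps)
  have m2: "partial 2 m x = (- 1) * a x * partial 2 (partial 2 X) x + b x * partial 1 (partial 2 X)
      x + (- 1) * b x *
      partial 2 (partial 2 Y) x + c x * partial 1 (partial 2 Y) x + (- 2) * partial 2 a x *
      partial 2 X x + partial 1 b x * partial 2 X x + partial 2 b x * partial 1 X x + (- 2) *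
      partial 2 b x * partial 2 Y x + partial 1 c x * partial 2 Y x + partial 2 c x * partial 1
      Y x + (- 1) * partial 2 (partial 2 a) x * X x + partial 1 (partial 2 b) x * X x + (- 1) *
      partial 2 (partial 2 b) x * Y x + partial 1 (partial 2 c) x * Y x"
    using M[of 2] by (simp add: algebra_simps)
  have mx: "m x = partial 1 b x * X x + partial 1 c x * Y x - partial 2 a x * X x
      - partial 2 b x * Y x
    + b x * partial 1 X x + c x * partial 1 Y x - a x * partial 2 X x - b x * partial 2 Y x"
    unfolding m_def by (rule rot_lower[OF k x, unfolded kx])
  \<comment> \<open>\<open>e12_1 - e11_2\<close> has the same second derivatives of \<open>X\<close>
    and \<open>Y\<close> as \<open>partial 1 m x\<close>. The second derivatives of the metric that
    are left over form the leading part of the curvature; the rest is a combination of the three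
    Killing equations. In the other direction \<open>e22_1 - e12_2\<close> plays this part.\<close>
  have "2 * W x * partial 1 m x - m x * partial 1 W x - (- 4) * (curv G x * (W x)\<^sup>2) * Y x
    = 2 * W x * (?e12_1 - ?e11_2)
      + ((- 1) * b x * partial 1 c x + c x * partial 2 a x)
      * (X x * partial 1 a x + Y x * partial 2 a x + 2 * (a x * partial 1 X x
          + b x * partial 1 Y x))
      + (a x * partial 1 c x + (- 2) * b x * partial 2 a x + 2 * b x * partial 1 b x + (- 1) * c x *
      partial 1 a x)
      * (X x * partial 1 b x + Y x * partial 2 b x + a x * partial 2 X x + b x * partial 2 Y x
          + b x * partial 1 X x + c x * partial 1 Y x)
      + (a x * partial 2 a x + (- 2) * a x * partial 1 b x + b x * partial 1 a x)
      * (X x * partial 1 c x + Y x * partial 2 c x + 2 * (b x * partial 2 X x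
          + c x * partial 2 Y x))"
    unfolding mx m1 curv_eq[OF x] partial_W[OF x] by (simp add: field_simps power2_eq_square)
  then show "2 * W x * partial 1 (rot (lower G k)) x - rot (lower G k) x * partial 1 W x
      = - 4 * curv G x * (W x)\<^sup>2 * k x $ 2"
    unfolding e11_2 e12_1 killing[OF x] by (simp add: m_def XY)
  have "2 * W x * partial 2 m x - m x * partial 2 W x - 4 * (curv G x * (W x)\<^sup>2) * X x
    = 2 * W x * (?e22_1 - ?e12_2)
      + ((- 1) * b x * partial 2 c x + 2 * c x * partial 2 b x + (- 1) * c x * partial 1 c x)
      * (X x * partial 1 a x + Y x * partial 2 a x + 2 * (a x * partial 1 X x
          + b x * partial 1 Y x))
      + (a x * partial 2 c x + (- 2) * b x * partial 2 b x + 2 * b x * partial 1 c x + (- 1) * c x *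
      partial 2 a x)
      * (X x * partial 1 b x + Y x * partial 2 b x + a x * partial 2 X x + b x * partial 2 Y x
          + b x * partial 1 X x + c x * partial 1 Y x)
      + ((- 1) * a x * partial 1 c x + b x * partial 2 a x)
      * (X x * partial 1 c x + Y x * partial 2 c x + 2 * (b x * partial 2 X x
          + c x * partial 2 Y x))"
    unfolding mx m2 curv_eq[OF x] partial_W[OF x] by (simp add: field_simps power2_eq_square)
  then show "2 * W x * partial 2 (rot (lower G k)) x - rot (lower G k) x * partial 2 W x
      = 4 * curv G x * (W x)\<^sup>2 * k x $ 1"
    unfolding e22_1 e12_2 killing[OF x] by (simp add: m_def XY)
qed

end

text \<open>Halving takes the place of Gronwall's inequality: on a ball with
  \<open>C * \<rho> \<le> 1 / 2\<close> the mean value inequality, started at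
  \<open>U q = 0\<close>, turns every bound \<open>b\<close> of \<open>norm (U x)\<close> into
  \<open>b / 2\<close>.\<close>

lemma linear_system_unique:
  fixes U :: "'v::euclidean_space \<Rightarrow> 'w::real_normed_vector"
  assumes "r > 0" "C \<ge> 0" and q: "U q = 0"
    and U: "\<And>x. x \<in> cball q r \<Longrightarrow> (U has_derivative D x) (at x)"
    and D: "\<And>x v. x \<in> cball q r \<Longrightarrow> norm (D x v) \<le> C * norm (U x) * norm v"
  shows "\<exists>\<rho>>0. \<forall>x\<in>ball q \<rho>. U x = 0"
proof -
  \<comment> \<open>The summand 1 keeps the denominator positive for \<open>C = 0\<close>.\<close>
  define \<rho> where "\<rho> = min r (1 / (2 * (C + 1)))"
  have \<rho>: "\<rho> > 0" "\<rho> \<le> r" using assms by (auto simp: \<rho>_def)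
  have "C * \<rho> \<le> C * (1 / (2 * (C + 1)))" using assms(2) by (intro mult_left_mono) (auto simp: \<rho>_def)
  also have "\<dots> \<le> 1 / 2" using assms(2) by (simp add: field_simps)
  finally have C\<rho>: "C * \<rho> \<le> 1 / 2" .
  have half: "\<forall>x\<in>cball q \<rho>. norm (U x) \<le> b / 2" if b: "\<forall>x\<in>cball q \<rho>. norm (U x) \<le> b" for b
  proof
    fix x assume x: "x \<in> cball q \<rho>"
    have b0: "b \<ge> 0" using b q \<rho> by (metis centre_in_cball less_imp_le norm_zero)
    have "norm (U x - U q) \<le> (C * b) * norm (x - q)"
    proof (rule differentiable_bound[of "cball q \<rho>"])
      fix y assume y: "y \<in> cball q \<rho>"
      then have y': "y \<in> cball q r" using \<rho> by auto
      show "(U has_derivative D y) (at y within cball q \<rho>)"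
        using U[OF y'] has_derivative_at_withinI by blast
      show "onorm (D y) \<le> C * b"
        using D[OF y'] b y assms(2)
        by (intro onorm_le order_trans[OF D[OF y']] mult_right_mono mult_left_mono) auto
    qed (use x \<rho> in auto)
    also have "\<dots> \<le> (C * b) * \<rho>" using x assms(2) b0 by (intro mult_left_mono) (auto simp: dist_norm
        norm_minus_commute)
    also have "\<dots> = (C * \<rho>) * b" by simp
    also have "\<dots> \<le> 1 / 2 * b" by (intro mult_right_mono C\<rho> b0)
    finally show "norm (U x) \<le> b / 2" using q by simp
  qed
  have "\<forall>x\<in>cball q \<rho>. norm (U x) \<le> b / 2 ^ n" if "\<forall>x\<in>cball q \<rho>. norm (U x) \<le> b" for b n
    using that
  proof (induction n)
    case (Suc n)
    then show ?case using half[of "b / 2 ^ n"] by (simp add: field_simps)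
  qed simp
  moreover obtain b where "\<forall>x\<in>cball q \<rho>. norm (U x) \<le> b"
  proof -
    have "continuous_on (cball q \<rho>) U"
      using U \<rho> by (intro continuous_at_imp_continuous_on ballI has_derivative_continuous[OF U])
          auto
    then have "bounded (U ` cball q \<rho>)"
      by (intro compact_imp_bounded compact_continuous_image compact_cball)
    then show ?thesis using that unfolding bounded_iff by auto
  qed
  ultimately have b: "norm (U x) \<le> b / 2 ^ n" if "x \<in> cball q \<rho>" for x n
    using that by blast
  have "U x = 0" if "x \<in> cball q \<rho>" for x
  proof -
    have "(\<lambda>n. b / 2 ^ n) \<longlonglongrightarrow> 0"
      by (rule LIMSEQ_divide_realpow_zero) simp
    then have "norm (U x) \<le> 0"
      by (rule LIMSEQ_le_const) (use b[OF that] in blast)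
    then show ?thesis by simp
  qed
  then show ?thesis using \<rho> by (intro exI[of _ \<rho>]) auto
qed

context riemannian_patch
begin

text \<open>An integrability condition: \<open>rot_lower_derivative\<close> prescribes both first
  derivatives of \<open>m\<close>, and equality of the mixed second derivatives of \<open>m\<close>
  leaves a condition on the derivative of the curvature along \<open>k\<close>.\<close>

lemma killing_curv:
  assumes k: "killing_on S G k" and x: "x \<in> S"
  shows "k x $ 1 * partial 1 (curv G) x + k x $ 2 * partial 2 (curv G) x = 0"
proof -
  define X Y where XY: "X = (\<lambda>y. k y $ 1)" "Y = (\<lambda>y. k y $ 2)"
  have kx: "k y $ 1 = X y" "k y $ 2 = Y y" for y by (simp_all add: XY)
  define m where "m = rot (lower G k)"
  define w where "w = W"
  define \<kappa> where "\<kappa> = curv G"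
  have sm: "smooth_on S X" "smooth_on S Y" "smooth_on S m" "smooth_on S w" "smooth_on S \<kappa>"
    unfolding XY m_def w_def \<kappa>_def
    by (intro smooth_killing[OF k] smooth_rot_lower[OF k] smooth_curv smooth_on_intros open_S
        smooth_G)+
  note d [simp] = sm[THEN smooth_on_imp_differentiable, OF x]
    sm[THEN smooth_on_partial, THEN smooth_on_imp_differentiable, OF x]
  note [simp] = sm[THEN partial_commute[OF open_S _ x], of 2 1]
  have 1: "2 * w y * partial 1 m y - m y * partial 1 w y = - 4 * (\<kappa> y * (w y * w y) * Y y)"
    "2 * w y * partial 2 m y - m y * partial 2 w y = 4 * (\<kappa> y * (w y * w y) * X y)" if "y \<in> S" for y
    using rot_lower_derivative[OF k that, unfolded kx]
    by (simp_all add: m_def w_def \<kappa>_def power2_eq_square)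
  have 2: "partial 2 (\<lambda>y. 2 * w y * partial 1 m y - m y * partial 1 w y) x
      = partial 2 (\<lambda>y. - 4 * (\<kappa> y * (w y * w y) * Y y)) x"
    "partial 1 (\<lambda>y. 2 * w y * partial 2 m y - m y * partial 2 w y) x = partial 1 (\<lambda>y. 4 * (\<kappa> y * (w
        y * w y) * X y)) x"
    by (rule partial_cong_open[OF open_S x], erule 1)+
  note 2 = 2[simplified partial_add partial_mult partial_diff partial_const differentiable_add
      differentiable_diff differentiable_mult d differentiable_const]
  have 3: "X x * partial 1 w x + Y x * partial 2 w x + 2 * w x * (partial 1 X x + partial 2 Y x)
      = 0"
    using killing_det[OF k x, unfolded kx] by (simp add: w_def)
  define K where "K = X x * partial 1 \<kappa> x + Y x * partial 2 \<kappa> x"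
  define T where "T = X x * partial 1 w x + Y x * partial 2 w x"
  define \<delta> where "\<delta> = partial 1 X x + partial 2 Y x"
  \<comment> \<open>The difference of the two differentiated equations; the mixed derivatives of
    \<open>m\<close> and of \<open>w\<close> cancel in it.\<close>
  have 4: "4 * w x * w x * K + 8 * \<kappa> x * w x * T + 4 * \<kappa> x * w x * w x * \<delta>
      - 3 * (partial 1 w x * partial 2 m x - partial 2 w x * partial 1 m x) = 0"
    using 2 by (simp add: K_def T_def \<delta>_def algebra_simps)
  \<comment> \<open>The equations \<open>1\<close> eliminate the first derivatives of
    \<open>m\<close> from \<open>4\<close>; the terms that are then left beside \<open>K\<close>
    contain the factor \<open>T + 2 * w x * \<delta>\<close>, which vanishes by invariance of the
    area density.\<close>
  have "8 * w x * w x * w x * K = 2 * w x * (4 * w x * w x * K + 8 * \<kappa> x * w x * T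
      + 4 * \<kappa> x * w x * w x * \<delta>
      - 3 * (partial 1 w x * partial 2 m x - partial 2 w x * partial 1 m x))
    + 3 * (partial 1 w x * (2 * w x * partial 2 m x - m x * partial 2 w x
        - 4 * (\<kappa> x * (w x * w x) * X x))
      - partial 2 w x * (2 * w x * partial 1 m x - m x * partial 1 w x - (- 4 * (\<kappa> x * (w x * w
          x) * Y x))))
    - 4 * \<kappa> x * w x * w x * (T + 2 * w x * \<delta>)"
    by (simp add: T_def algebra_simps)
  also have "T + 2 * w x * \<delta> = 0"
    using 3 by (simp add: T_def \<delta>_def algebra_simps)
  finally have "8 * w x * w x * w x * K = 0"
    unfolding 4 1[OF x] by simp
  then show ?thesis
    using W_pos[OF x] by (simp add: w_def \<kappa>_def XY K_def)
qed

text \<open>The Killing equations and the definition of \<open>m\<close> determine the first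
  derivatives of \<open>X\<close> and \<open>Y\<close> linearly from \<open>X\<close>,
  \<open>Y\<close> and \<open>m\<close>, and \<open>rot_lower_derivative\<close> does the same for
  \<open>m\<close>. So \<open>(X, Y, m)\<close> solves a closed linear system of first order, to
  which \<open>linear_system_unique\<close> applies.\<close>

lemma killing_unique:
  assumes k: "killing_on S G k" and q: "q \<in> S" and "k q = 0" "rot (lower G k) q = 0"
  shows "\<exists>\<rho>>0. \<forall>x\<in>ball q \<rho>. k x = 0"
proof -
  define X Y where XY: "X = (\<lambda>y. k y $ 1)" "Y = (\<lambda>y. k y $ 2)"
  have kx: "k y $ 1 = X y" "k y $ 2 = Y y" for y by (simp_all add: XY)
  define m where "m = rot (lower G k)"
  have sm: "smooth_on S X" "smooth_on S Y" "smooth_on S m"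
    unfolding XY m_def by (intro smooth_killing[OF k] smooth_rot_lower[OF k])+
  obtain r where r: "r > 0" "cball q r \<subseteq> S"
    using open_S q open_contains_cball by blast
  \<comment> \<open>Each derivative is to be bounded by the unknowns of the system themselves,
    uniformly on a compact ball.\<close>
  define bd where "bd f \<longleftrightarrow> (\<exists>C\<ge>0. \<forall>x\<in>cball q r. \<bar>f x\<bar> \<le> C * norm (X x, Y x, m x))"
      for f :: "real^2 \<Rightarrow> real"
  have tri: "\<bar>p * u + q * v + r * t\<bar> \<le> \<bar>p\<bar> * \<bar>u\<bar> + \<bar>q\<bar> * \<bar>v\<bar> + \<bar>r\<bar> * \<bar>t\<bar>" for p q r u v t :: real
    unfolding abs_mult[symmetric] by linarith
  have bdI: "bd f" if f: "smooth_on S \<alpha>" "smooth_on S \<beta>" "smooth_on S \<gamma>"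
     "\<And>x. x \<in> S \<Longrightarrow> W x * f x = \<alpha> x * X x + \<beta> x * Y x + \<gamma> x * m x" for f \<alpha> \<beta> \<gamma>
  proof -
    have bounded: "\<exists>C. \<forall>x\<in>cball q r. \<bar>\<phi> x\<bar> \<le> C" if "smooth_on S \<phi>" for \<phi> :: "real^2 \<Rightarrow> real"
    proof -
      have "continuous_on (cball q r) \<phi>"
        using that r(2) smooth_on_imp_continuous_on continuous_on_subset by blast
      then have "bounded (\<phi> ` cball q r)"
        by (intro compact_imp_bounded compact_continuous_image compact_cball)
      then show ?thesis unfolding bounded_iff by auto
    qed
    have "smooth_on S (\<lambda>x. \<alpha> x / W x)" "smooth_on S (\<lambda>x. \<beta> x / W x)" "smooth_on S (\<lambda>x. \<gamma> x / W x)"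
      using W_pos by (intro smooth_on_intros open_S smooth_G f; force)+
    from this[THEN bounded] obtain A B C where "\<forall>x\<in>cball q r. \<bar>\<alpha> x / W x\<bar> \<le> A"
       "\<forall>x\<in>cball q r. \<bar>\<beta> x / W x\<bar> \<le> B" "\<forall>x\<in>cball q r. \<bar>\<gamma> x / W x\<bar> \<le> C"
      by (elim exE) (rule that)
    then have ABC: "\<bar>\<alpha> x / W x\<bar> \<le> A" "\<bar>\<beta> x / W x\<bar> \<le> B" "\<bar>\<gamma> x / W x\<bar> \<le> C" if "x \<in> cball q r" for x
      using that by blast+
    have pos: "0 \<le> A" "0 \<le> B" "0 \<le> C"
      using ABC[of q, THEN order_trans[OF abs_ge_zero]] r(1) by auto
    have "\<bar>f x\<bar> \<le> (A + B + C) * norm (X x, Y x, m x)" if x: "x \<in> cball q r" for x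
    proof -
      have n: "\<bar>X x\<bar> \<le> norm (X x, Y x, m x)" "\<bar>Y x\<bar> \<le> norm (X x, Y x, m x)" "\<bar>m x\<bar>
          \<le> norm (X x, Y x, m x)"
        using norm_fst_le[of "X x" "(Y x, m x)"] norm_snd_le[of "(Y x, m x)" "X x"]
          norm_fst_le[of "Y x" "m x"] norm_snd_le[of "m x" "Y x"] by simp_all
      have xS: "x \<in> S" using x r by blast
      have "f x = (\<alpha> x * X x + \<beta> x * Y x + \<gamma> x * m x) / W x"
        unfolding f(4)[OF xS, symmetric] using W_pos[OF xS] by simp
      then have fx: "f x = \<alpha> x / W x * X x + \<beta> x / W x * Y x + \<gamma> x / W x * m x"
        by (simp add: add_divide_distrib)
      have "\<bar>f x\<bar> \<le> \<bar>\<alpha> x / W x\<bar> * \<bar>X x\<bar> + \<bar>\<beta> x / W x\<bar> * \<bar>Y x\<bar> + \<bar>\<gamma> x / W x\<bar> * \<bar>m x\<bar>"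
        unfolding fx by (rule tri)
      also have "\<dots> \<le> A * norm (X x, Y x, m x) + B * norm (X x, Y x, m x) + C * norm (X x, Y x, m x)"
        by (intro add_mono mult_mono ABC[OF x] n pos abs_ge_zero)
      finally show ?thesis by (simp only: distrib_right)
    qed
    then show ?thesis unfolding bd_def using pos by (intro exI[of _ "A + B + C"]) simp
  qed
  note s = smooth_on_intros open_S smooth_G smooth_curv
  define E1 where "E1 x = X x * partial 1 a x + Y x * partial 2 a x + 2 * (a x * partial 1 X x
      + b x * partial 1 Y x)" for x
  define E2 where "E2 x = X x * partial 1 b x + Y x * partial 2 b x + a x * partial 2 X x
      + b x * partial 2 Y x
      + b x * partial 1 X x + c x * partial 1 Y x" for x
  define E3 where "E3 x = X x * partial 1 c x + Y x * partial 2 c x + 2 * (b x * partial 2 X x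
      + c x * partial 2 Y x)" for x
  define R where "R x = partial 1 b x * X x + partial 1 c x * Y x - partial 2 a x * X x
      - partial 2 b x * Y x
    + b x * partial 1 X x + c x * partial 1 Y x - a x * partial 2 X x - b x * partial 2 Y x" for x
  have eqs: "E1 x = 0" "E2 x = 0" "E3 x = 0" "R x = m x" if "x \<in> S" for x
    using killing_onD[OF k that, unfolded kx] rot_lower[OF k that, unfolded kx, folded m_def]
    by (simp_all add: E1_def E2_def E3_def R_def)
  note E_defs = E1_def E2_def E3_def R_def
  have halve: "w * p = t / 2 + q / 2 * n" if "2 * w * p - n * q = t" for w p n q t :: real
    using that by (simp add: field_simps)
  have bds: "bd (partial 1 X)" "bd (partial 2 X)" "bd (partial 1 Y)" "bd (partial 2 Y)"
      "bd (partial 1 m)" "bd (partial 2 m)"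
  proof -
    \<comment> \<open>The equations \<open>E1\<close>, \<open>E2\<close>, \<open>E3\<close> and
      \<open>R = m\<close> are linear in the four first derivatives of \<open>X\<close> and
      \<open>Y\<close>. Solving them costs a factor \<open>W\<close>, and the solution is verified
      by exhibiting the difference of both sides as a combination of these equations.\<close>
    have w: "W x * partial 1 X x = (b x * (2 * partial 1 b x - partial 2 a x)
        - c x * partial 1 a x) / 2 * X x
        + (b x * partial 1 c x - c x * partial 2 a x) / 2 * Y x + (- b x / 2) * m x" if "x \<in> S"
            for x
    proof -
      have "W x * partial 1 X x - ((b x * (2 * partial 1 b x - partial 2 a x)
          - c x * partial 1 a x) / 2 * X x
        + (b x * partial 1 c x - c x * partial 2 a x) / 2 * Y x + (- b x / 2) * m x)
          = c x / 2 * E1 x - b x / 2 * (E2 x + (R x - m x))"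
        unfolding E_defs by (simp add: field_simps)
      then show ?thesis unfolding eqs[OF that] by simp
    qed
    show "bd (partial 1 X)" by (rule bdI[rotated 3], erule w) (intro s; simp)+
    have w: "W x * partial 1 Y x = (b x * partial 1 a x - a x * (2 * partial 1 b x
        - partial 2 a x)) / 2 * X x
        + (b x * partial 2 a x - a x * partial 1 c x) / 2 * Y x + a x / 2 * m x" if "x \<in> S" for x
    proof -
      have "W x * partial 1 Y x - ((b x * partial 1 a x - a x * (2 * partial 1 b x
          - partial 2 a x)) / 2 * X x
        + (b x * partial 2 a x - a x * partial 1 c x) / 2 * Y x + a x / 2 * m x)
          = a x / 2 * (E2 x + (R x - m x)) - b x / 2 * E1 x"
        unfolding E_defs by (simp add: field_simps)
      then show ?thesis unfolding eqs[OF that] by simp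
    qed
    show "bd (partial 1 Y)" by (rule bdI[rotated 3], erule w) (intro s; simp)+
    have w: "W x * partial 2 X x = (b x * partial 1 c x - c x * partial 2 a x) / 2 * X x
        + (b x * partial 2 c x + c x * (partial 1 c x - 2 * partial 2 b x)) / 2 * Y x
            + (- c x / 2) * m x" if "x \<in> S" for x
    proof -
      have "W x * partial 2 X x - ((b x * partial 1 c x - c x * partial 2 a x) / 2 * X x
        + (b x * partial 2 c x + c x * (partial 1 c x - 2 * partial 2 b x)) / 2 * Y x
            + (- c x / 2) * m x)
          = c x / 2 * (E2 x - (R x - m x)) - b x / 2 * E3 x"
        unfolding E_defs by (simp add: field_simps)
      then show ?thesis unfolding eqs[OF that] by simp
    qed
    show "bd (partial 2 X)" by (rule bdI[rotated 3], erule w) (intro s; simp)+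
    have w: "W x * partial 2 Y x = (b x * partial 2 a x - a x * partial 1 c x) / 2 * X x
        + (- a x * partial 2 c x - b x * (partial 1 c x - 2 * partial 2 b x)) / 2 * Y x
            + b x / 2 * m x" if "x \<in> S" for x
    proof -
      have "W x * partial 2 Y x - ((b x * partial 2 a x - a x * partial 1 c x) / 2 * X x
        + (- a x * partial 2 c x - b x * (partial 1 c x - 2 * partial 2 b x)) / 2 * Y x
            + b x / 2 * m x)
          = a x / 2 * E3 x - b x / 2 * (E2 x - (R x - m x))"
        unfolding E_defs by (simp add: field_simps)
      then show ?thesis unfolding eqs[OF that] by simp
    qed
    show "bd (partial 2 Y)" by (rule bdI[rotated 3], erule w) (intro s; simp)+
    have w: "W x * partial 1 m x = 0 * X x + (- 2 * curv G x * W x * W x) * Y x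
        + partial 1 W x / 2 * m x" if "x \<in> S" for x
      using halve[OF rot_lower_derivative(1)[OF k that]] by (simp add: m_def kx power2_eq_square)
    show "bd (partial 1 m)" by (rule bdI[rotated 3], erule w) (intro s; simp)+
    have w: "W x * partial 2 m x = (2 * curv G x * W x * W x) * X x + 0 * Y x
        + partial 2 W x / 2 * m x" if "x \<in> S" for x
      using halve[OF rot_lower_derivative(2)[OF k that]] by (simp add: m_def kx power2_eq_square)
    show "bd (partial 2 m)" by (rule bdI[rotated 3], erule w) (intro s; simp)+
  qed
  define U where "U = (\<lambda>x. (X x, Y x, m x))"
  obtain C where C: "C \<ge> 0" "\<And>x. x \<in> cball q r \<Longrightarrow> \<bar>partial 1 X x\<bar> + \<bar>partial 2 X x\<bar> + \<bar>partial 1 Y x\<bar>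
      + \<bar>partial 2 Y x\<bar>
     + \<bar>partial 1 m x\<bar> + \<bar>partial 2 m x\<bar> \<le> C * norm (U x)"
  proof -
    have bd: "\<exists>C\<ge>0. \<forall>x\<in>cball q r. \<bar>f x\<bar> \<le> C * norm (U x)" if "bd f" for f
      using that by (simp only: bd_def U_def)
    obtain C1 where C1: "C1 \<ge> 0" "\<forall>x\<in>cball q r. \<bar>partial 1 X x\<bar> \<le> C1 * norm (U x)"
      using bd[OF bds(1)] by blast
    obtain C2 where C2: "C2 \<ge> 0" "\<forall>x\<in>cball q r. \<bar>partial 2 X x\<bar> \<le> C2 * norm (U x)"
      using bd[OF bds(2)] by blast
    obtain C3 where C3: "C3 \<ge> 0" "\<forall>x\<in>cball q r. \<bar>partial 1 Y x\<bar> \<le> C3 * norm (U x)"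
      using bd[OF bds(3)] by blast
    obtain C4 where C4: "C4 \<ge> 0" "\<forall>x\<in>cball q r. \<bar>partial 2 Y x\<bar> \<le> C4 * norm (U x)"
      using bd[OF bds(4)] by blast
    obtain C5 where C5: "C5 \<ge> 0" "\<forall>x\<in>cball q r. \<bar>partial 1 m x\<bar> \<le> C5 * norm (U x)"
      using bd[OF bds(5)] by blast
    obtain C6 where C6: "C6 \<ge> 0" "\<forall>x\<in>cball q r. \<bar>partial 2 m x\<bar> \<le> C6 * norm (U x)"
      using bd[OF bds(6)] by blast
    note C = C1(1) C2(1) C3(1) C4(1) C5(1) C6(1)
    show ?thesis
    proof (rule that[of "C1 + C2 + C3 + C4 + C5 + C6"])
      fix x assume x: "x \<in> cball q r"
      have "\<bar>partial 1 X x\<bar> + \<bar>partial 2 X x\<bar> + \<bar>partial 1 Y x\<bar> + \<bar>partial 2 Y x\<bar> + \<bar>partial 1 m x\<bar>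
          + \<bar>partial 2 m x\<bar>
        \<le> C1 * norm (U x) + C2 * norm (U x) + C3 * norm (U x) + C4 * norm (U x) + C5 * norm (U x)
            + C6 * norm (U x)"
        by (intro add_mono bspec[OF C1(2) x] bspec[OF C2(2) x] bspec[OF C3(2) x] bspec[OF C4(2) x]
            bspec[OF C5(2) x] bspec[OF C6(2) x])
      then show "\<bar>partial 1 X x\<bar> + \<bar>partial 2 X x\<bar> + \<bar>partial 1 Y x\<bar> + \<bar>partial 2 Y x\<bar>
          + \<bar>partial 1 m x\<bar> + \<bar>partial 2 m x\<bar> \<le> (C1 + C2 + C3 + C4 + C5 + C6) * norm (U x)"
        by (simp only: distrib_right)
    qed (use C in auto)
  qed
  define D where "D x v = (v $ 1 * partial 1 X x + v $ 2 * partial 2 X x,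
    v $ 1 * partial 1 Y x + v $ 2 * partial 2 Y x, v $ 1 * partial 1 m x + v $ 2 * partial 2 m x)"
        for x and v :: "real^2"
  have "(U has_derivative D x) (at x)" if "x \<in> cball q r" for x
  proof -
    have x: "x \<in> S" using that r by auto
    show ?thesis unfolding U_def D_def
      using sm[THEN smooth_on_imp_differentiable, OF x, THEN has_derivative_partial]
      by (intro has_derivative_Pair)
  qed
  moreover have "norm (D x v) \<le> C * norm (U x) * norm v" if "x \<in> cball q r" for x v
  proof -
    have n: "\<bar>v $ 1\<bar> \<le> norm v" "\<bar>v $ 2\<bar> \<le> norm v"
      by (auto intro: component_le_norm_cart)
    have e: "\<bar>v $ 1 * s + v $ 2 * t\<bar> \<le> (\<bar>s\<bar> + \<bar>t\<bar>) * norm v" for s t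
    proof -
      have "\<bar>v $ 1 * s + v $ 2 * t\<bar> \<le> \<bar>v $ 1\<bar> * \<bar>s\<bar> + \<bar>v $ 2\<bar> * \<bar>t\<bar>"
        unfolding abs_mult[symmetric] by linarith
      also have "\<dots> \<le> norm v * \<bar>s\<bar> + norm v * \<bar>t\<bar>" using n by (intro add_mono mult_right_mono) auto
      finally show ?thesis by (simp add: algebra_simps)
    qed
    have "norm (D x v) \<le> \<bar>v $ 1 * partial 1 X x + v $ 2 * partial 2 X x\<bar> + (\<bar>v $ 1 * partial 1 Y x
        + v $ 2 * partial 2 Y x\<bar>
        + \<bar>v $ 1 * partial 1 m x + v $ 2 * partial 2 m x\<bar>)"
      unfolding D_def by (intro order_trans[OF norm_Pair_le] add_mono) auto
    also have "\<dots> \<le> (\<bar>partial 1 X x\<bar> + \<bar>partial 2 X x\<bar> + \<bar>partial 1 Y x\<bar> + \<bar>partial 2 Y x\<bar>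
     + \<bar>partial 1 m x\<bar> + \<bar>partial 2 m x\<bar>) * norm v"
      using e[of "partial 1 X x" "partial 2 X x"] e[of "partial 1 Y x"
          "partial 2 Y x"] e[of "partial 1 m x" "partial 2 m x"]
      by (simp add: algebra_simps)
    also have "\<dots> \<le> C * norm (U x) * norm v" by (intro mult_right_mono C that) auto
    finally show ?thesis .
  qed
  moreover have "U q = 0"
    using assms(3,4) by (simp add: U_def XY m_def zero_prod_def)
  ultimately obtain \<rho> where "\<rho> > 0" "\<forall>x\<in>ball q \<rho>. U x = 0"
    using linear_system_unique[OF r(1) C(1), of U q D] by blast
  then have "\<rho> > 0 \<and> (\<forall>x\<in>ball q \<rho>. k x = 0)"
    by (auto simp: U_def XY zero_prod_def vec_eq_iff forall_2)
  then show ?thesis by blast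
qed

end


section \<open>Pullbacks of coordinate 1-forms\<close>

definition jac :: "(real^2 \<Rightarrow> real^2) \<Rightarrow> real^2 \<Rightarrow> real" where
  "jac \<phi> x = partial 1 (\<lambda>y. \<phi> y $ 1) x * partial 2 (\<lambda>y. \<phi> y $ 2) x
    - partial 2 (\<lambda>y. \<phi> y $ 1) x * partial 1 (\<lambda>y. \<phi> y $ 2) x"

lemma differentiable_vec_nth:
  "f differentiable (at x) \<Longrightarrow> (\<lambda>y. f y $ i) differentiable (at x)"
  unfolding differentiable_def using bounded_linear.has_derivative[OF bounded_linear_vec_nth]
      by blast

lemma partial_vec_nth:
  fixes f :: "real^2 \<Rightarrow> real^2"
  assumes "f differentiable (at x)"
  shows "partial i (\<lambda>y. f y $ j) x = frechet_derivative f (at x) (axis i 1) $ j"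
  by (rule partial_eqI) (rule bounded_linear.has_derivative[OF bounded_linear_vec_nth
      has_frechet_derivative[OF assms]])

lemma frechet_derivative_vec_nth:
  fixes f :: "real^2 \<Rightarrow> real^2"
  assumes "f differentiable (at x)"
  shows "frechet_derivative f (at x) v $ j = v $ 1 * partial 1 (\<lambda>y. f y $ j) x
      + v $ 2 * partial 2 (\<lambda>y. f y $ j) x"
  using linear_vec2[OF has_derivative_linear[OF has_frechet_derivative[OF assms]], of v]
  by (simp add: partial_vec_nth[OF assms])

lemma partial_compose:
  fixes \<phi> :: "real^2 \<Rightarrow> real^2" and f :: "real^2 \<Rightarrow> real"
  assumes "\<phi> differentiable (at x)" "f differentiable (at (\<phi> x))"
  shows "(\<lambda>y. f (\<phi> y)) differentiable (at x)"
    "partial i (\<lambda>y. f (\<phi> y)) x = partial 1 f (\<phi> x) * partial i (\<lambda>y. \<phi> y $ 1) x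
      + partial 2 f (\<phi> x) * partial i (\<lambda>y. \<phi> y $ 2) x"
proof -
  note d = has_derivative_compose[OF has_frechet_derivative[OF assms(1)]
      has_derivative_partial[OF assms(2)]]
  show "(\<lambda>y. f (\<phi> y)) differentiable (at x)" using d differentiable_def by blast
  show "partial i (\<lambda>y. f (\<phi> y)) x = partial 1 f (\<phi> x) * partial i (\<lambda>y. \<phi> y $ 1) x
      + partial 2 f (\<phi> x) * partial i (\<lambda>y. \<phi> y $ 2) x"
    unfolding partial_eqI[OF d] partial_vec_nth[OF assms(1)] by simp
qed

text \<open>Exterior differentiation commutes with pullbacks: the terms with second derivatives of
  \<phi> cancel by symmetry.\<close>

lemma rot_pullback:
  assumes "open S" "x \<in> S" "smooth_on S \<phi>"
    and \<tau>: "\<And>j. (\<lambda>y. \<tau> y $ j) differentiable (at (\<phi> x))"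
    and \<sigma>: "\<And>y i. y \<in> S \<Longrightarrow> \<sigma> y $ i = \<tau> (\<phi> y) $ 1 * partial i (\<lambda>z. \<phi> z $ 1) y
        + \<tau> (\<phi> y) $ 2 * partial i (\<lambda>z. \<phi> z $ 2) y"
  shows "(\<lambda>y. \<sigma> y $ i) differentiable (at x)" "rot \<sigma> x = rot \<tau> (\<phi> x) * jac \<phi> x"
proof -
  have d\<phi>: "\<phi> differentiable (at x)"
    using assms smooth_on_imp_differentiable by blast
  have s: "smooth_on S (\<lambda>y. \<phi> y $ j)" for j
    by (intro smooth_on_intros assms)
  note d1 = smooth_on_imp_differentiable[OF smooth_on_partial[OF s] assms(2)]
  note d2 = partial_compose[OF d\<phi> \<tau>]
  show "(\<lambda>y. \<sigma> y $ i) differentiable (at x)" for i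
    using differentiable_cong_open[OF assms(1,2) \<sigma>] d1 d2 by (simp add: differentiable_add
        differentiable_mult)
  have p: "partial k (\<lambda>y. \<sigma> y $ i) x = partial k (\<lambda>y. \<tau> (\<phi> y) $ 1 * partial i (\<lambda>z. \<phi> z $ 1) y
      + \<tau> (\<phi> y) $ 2 * partial i (\<lambda>z. \<phi> z $ 2) y) x"
    for k i by (rule partial_cong_open[OF assms(1,2) \<sigma>])
  show "rot \<sigma> x = rot \<tau> (\<phi> x) * jac \<phi> x"
    unfolding rot_def p jac_def using d1 d2 partial_commute[OF assms(1) s assms(2), of 2 1]
    by (simp add: partial_add partial_mult algebra_simps)
qed

text \<open>Here \<open>h\<close> will be a difference of distances. It is known to have a
  differential at every point, but not beforehand to be twice continuously differentiable; hence the
  weak form of Schwarz's theorem.\<close>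

lemma rot_gradient:
  fixes h :: "real^2 \<Rightarrow> real"
  assumes "open S" "x \<in> S" and h: "\<And>y. y \<in> S \<Longrightarrow> (h has_derivative (\<lambda>v. \<sigma> y \<bullet> v)) (at y)"
    and \<sigma>: "\<And>j. (\<lambda>y. \<sigma> y $ j) differentiable (at x)"
  shows "rot \<sigma> x = 0"
proof -
  have "((\<lambda>y. \<sigma> y \<bullet> axis j 1) has_derivative frechet_derivative (\<lambda>y. \<sigma> y $ j) (at x)) (at x)" for j
    using has_frechet_derivative[OF \<sigma>] by (simp add: inner_axis)
  from second_derivative_symmetric[OF assms(1,2) h this[of 2] this[of 1]]
  show ?thesis by (simp add: rot_def partial_def)
qed


section \<open>Charts\<close>

definition jac_change :: "'a chart \<Rightarrow> 'a chart \<Rightarrow> 'a \<Rightarrow> real" where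
  "jac_change c c' p = det (matrix (change c c' p))"

lemma jac_change_eq: "jac_change c c' p = change c c' p (axis 1 1) $ 1 * change c c' p (axis 2
    1) $ 2
    - change c c' p (axis 2 1) $ 1 * change c c' p (axis 1 1) $ 2"
  by (simp add: jac_change_def det_2 matrix_def)

locale smooth_surface =
  fixes A :: "'a::t2_space chart set"
  assumes atlas: "smooth_atlas A"
begin

lemma chart: "c \<in> A \<Longrightarrow> is_chart c"
  using atlas by (simp add: smooth_atlas_def)

lemma open_dom: "c \<in> A \<Longrightarrow> open (fst c)"
  and open_image: "c \<in> A \<Longrightarrow> open (chart_image c)"
  using chart by (auto simp: is_chart_def)

lemma chart_inv: "c \<in> A \<Longrightarrow> p \<in> fst c \<Longrightarrow> chart_inv c (snd c p) = p"
  using chart by (auto simp: is_chart_def homeomorphism_def)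

lemma chart_of_inv: "c \<in> A \<Longrightarrow> x \<in> chart_image c \<Longrightarrow> snd c (chart_inv c x) = x"
  using chart by (auto simp: is_chart_def homeomorphism_def)

lemma chart_inv_in: "c \<in> A \<Longrightarrow> x \<in> chart_image c \<Longrightarrow> chart_inv c x \<in> fst c"
  by (simp add: inv_into_into)

lemma continuous_on_chart: "c \<in> A \<Longrightarrow> continuous_on (fst c) (snd c)"
  using chart by (auto simp: is_chart_def homeomorphism_def)

lemma continuous_on_chart_inv: "c \<in> A \<Longrightarrow> continuous_on (chart_image c) (chart_inv c)"
  using chart by (auto simp: is_chart_def homeomorphism_def)

lemma open_chart_image:
  assumes "c \<in> A" "open U"
  shows "open (snd c ` (fst c \<inter> U))"
proof -
  have "openin (top_of_set (chart_image c)) (snd c ` (fst c \<inter> U))"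
    using chart[OF assms(1)] assms(2) unfolding is_chart_def
    by (intro homeomorphism_imp_open_map) auto
  then show ?thesis using open_image[OF assms(1)] openin_open_trans by blast
qed

lemma open_chart_preimage:
  assumes "c \<in> A" "open T"
  shows "open {p \<in> fst c. snd c p \<in> T}"
  using continuous_open_preimage[OF continuous_on_chart[OF assms(1)] open_dom[OF assms(1)] assms(2)]
  by (simp add: vimage_def Int_def conj_commute)

lemma chart_at: "chart_at A p \<in> A" "p \<in> fst (chart_at A p)"
proof -
  have "p \<in> (\<Union>c\<in>A. fst c)" using atlas by (simp add: smooth_atlas_def)
  then have "\<exists>c. c \<in> A \<and> p \<in> fst c" by blast
  from someI_ex[OF this] show "chart_at A p \<in> A" "p \<in> fst (chart_at A p)"
    by (auto simp: chart_at_def)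
qed

lemma smooth_transition:
  "c \<in> A \<Longrightarrow> c' \<in> A \<Longrightarrow> smooth_on (snd c ` (fst c \<inter> fst c')) (snd c' \<circ> chart_inv c)"
  using atlas by (auto simp: smooth_atlas_def)

lemma open_overlap: "c \<in> A \<Longrightarrow> c' \<in> A \<Longrightarrow> open (snd c ` (fst c \<inter> fst c'))"
  using open_chart_image open_dom by blast

lemma transition_has_derivative:
  assumes "c \<in> A" "c' \<in> A" "p \<in> fst c" "p \<in> fst c'"
  shows "((snd c' \<circ> chart_inv c) has_derivative change c c' p) (at (snd c p))"
  unfolding change_def using smooth_transition[OF assms(1,2)] assms(3,4)
  by (intro has_frechet_derivative smooth_on_imp_differentiable[of "snd c ` (fst c \<inter> fst c')"]) auto

lemma linear_change:
  "c \<in> A \<Longrightarrow> c' \<in> A \<Longrightarrow> p \<in> fst c \<Longrightarrow> p \<in> fst c' \<Longrightarrow> linear (change c c' p)"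
  using transition_has_derivative has_derivative_linear by blast

lemma change_self:
  assumes "c \<in> A" "p \<in> fst c"
  shows "change c c p v = v"
proof -
  have "((\<lambda>x. x) has_derivative (\<lambda>v. v)) (at (snd c p))" by (rule has_derivative_ident)
  then have "((snd c \<circ> chart_inv c) has_derivative (\<lambda>v. v)) (at (snd c p))"
    using has_derivative_cong_open[OF open_image[OF assms(1)], of "snd c p" "snd c \<circ> chart_inv c"
        "\<lambda>x. x"]
      assms chart_of_inv by auto
  from has_derivative_unique[OF this transition_has_derivative[OF assms(1,1,2,2)]]
  show ?thesis by (simp add: fun_eq_iff)
qed

lemma change_change:
  assumes "c \<in> A" "c' \<in> A" "c'' \<in> A" "p \<in> fst c" "p \<in> fst c'" "p \<in> fst c''"
  shows "change c' c'' p (change c c' p v) = change c c'' p v"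
proof -
  let ?T = "snd c ` (fst c \<inter> (fst c' \<inter> fst c''))"
  have "((snd c'' \<circ> chart_inv c') has_derivative change c' c'' p) (at ((snd c' \<circ> chart_inv c) (snd c
      p)))"
    using transition_has_derivative[OF assms(2,3,5,6)] assms by (simp add: chart_inv)
  from has_derivative_compose[OF transition_has_derivative[OF assms(1,2,4,5)] this]
  have d: "((\<lambda>x. (snd c'' \<circ> chart_inv c') ((snd c' \<circ> chart_inv c) x)) has_derivative
     (\<lambda>v. change c' c'' p (change c c' p v))) (at (snd c p))" .
  have "open ?T" "snd c p \<in> ?T"
    using assms by (auto intro!: open_chart_image open_dom)
  moreover have "(snd c'' \<circ> chart_inv c') ((snd c' \<circ> chart_inv c) x) = (snd c'' \<circ> chart_inv c) x"
      if "x \<in> ?T" for x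
    using that assms by (auto simp: chart_inv)
  ultimately have "((snd c'' \<circ> chart_inv c) has_derivative (\<lambda>v. change c' c'' p (change c c' p v)))
      (at (snd c p))"
    by (rule has_derivative_transform_within_open[OF d])
  from has_derivative_unique[OF this transition_has_derivative[OF assms(1,3,4,6)]]
  show ?thesis by (rule fun_cong)
qed

lemma change_inverse:
  assumes "c \<in> A" "c' \<in> A" "p \<in> fst c" "p \<in> fst c'"
  shows "change c' c p (change c c' p v) = v"
  using change_change[OF assms(1,2,1,3,4,3)] change_self[OF assms(1,3)] by simp

lemma jac_change_change:
  assumes "c \<in> A" "c' \<in> A" "c'' \<in> A" "p \<in> fst c" "p \<in> fst c'" "p \<in> fst c''"
  shows "jac_change c c'' p = jac_change c' c'' p * jac_change c c' p"
proof -
  have "change c c'' p = change c' c'' p \<circ> change c c' p"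
    using change_change[OF assms] by auto
  then show ?thesis
    unfolding jac_change_def using linear_change assms by (simp add: matrix_compose det_mul)
qed

lemma jac_change_self: "c \<in> A \<Longrightarrow> p \<in> fst c \<Longrightarrow> jac_change c c p = 1"
  by (simp add: jac_change_eq change_self axis_def)

lemma jac_change_inverse:
  assumes "c \<in> A" "c' \<in> A" "p \<in> fst c" "p \<in> fst c'"
  shows "jac_change c' c p * jac_change c c' p = 1"
  using jac_change_change[OF assms(1,2,1,3,4,3)] jac_change_self[OF assms(1,3)] by simp

lemma change_wedge:
  assumes "c \<in> A" "c' \<in> A" "p \<in> fst c" "p \<in> fst c'"
  shows "change c c' p v $ 1 * change c c' p w $ 2 - change c c' p v $ 2 * change c c' p w $ 1
    = jac_change c c' p * (v $ 1 * w $ 2 - v $ 2 * w $ 1)"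
  unfolding jac_change_eq linear_vec2[OF linear_change[OF assms], of v]
    linear_vec2[OF linear_change[OF assms], of w]
  by (simp add: algebra_simps)

end

lemma coord_apply:
  fixes B :: "real^2 \<Rightarrow> real^2 \<Rightarrow> real"
  assumes "bilinear B" "linear L"
  shows "v \<bullet> ((\<chi> i j. B (L (axis i 1)) (L (axis j 1))) *v w) = B (L v) (L (w::real^2))"
  unfolding linear_vec2[OF assms(2), of v] linear_vec2[OF assms(2), of w]
  using assms(1)
  by (simp add: inner_vec_def sum_2 matrix_vector_mult_def bilinear_ladd bilinear_radd bilinear_lmul
      bilinear_rmul algebra_simps)

locale riemannian_surface = smooth_surface A for A :: "'a::t2_space chart set" +
  fixes g :: "'a \<Rightarrow> real^2 \<Rightarrow> real^2 \<Rightarrow> real"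
  assumes metric: "riemannian_metric A g"
begin

lemma bilinear_g: "bilinear (g p)" and g_sym: "g p v w = g p w v" and g_pos: "v \<noteq> 0 \<Longrightarrow> g p v v > 0"
  using metric by (auto simp: riemannian_metric_def)

abbreviation G :: "'a chart \<Rightarrow> real^2 \<Rightarrow> real^2^2" where "G \<equiv> metric_coord A g"

lemma metric_coord_apply:
  assumes "c \<in> A" "p \<in> fst c"
  shows "v \<bullet> (G c (snd c p) *v w) = g p (change c (chart_at A p) p v) (change c (chart_at A p) p w)"
  unfolding metric_coord_def Let_def coord_vec_def chart_inv[OF assms]
  by (intro coord_apply bilinear_g linear_change assms chart_at)

lemma metric_coord_nth:
  "G c x $ i $ j = axis i 1 \<bullet> (G c x *v axis j 1)"
  by (simp add: inner_axis' matrix_vector_mult_basis column_def)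

lemma metric_coord_change:
  assumes "c \<in> A" "c' \<in> A" "p \<in> fst c" "p \<in> fst c'"
  shows "v \<bullet> (G c (snd c p) *v w) = change c c' p v \<bullet> (G c' (snd c' p) *v change c c' p w)"
  using assms by (simp add: metric_coord_apply change_change chart_at)

lemma det_metric_change:
  assumes "c \<in> A" "c' \<in> A" "p \<in> fst c" "p \<in> fst c'"
  shows "det (G c (snd c p)) = det (G c' (snd c' p)) * (jac_change c c' p)\<^sup>2"
proof -
  have "G c (snd c p) $ i $ j = change c c' p (axis i 1) \<bullet> (G c' (snd c' p) *v change c c' p (axis j
      1))" for i j
    using metric_coord_nth metric_coord_change[OF assms] by metis
  then show ?thesis
    unfolding det_2 jac_change_eq
    by (simp add: inner_vec_def sum_2 matrix_vector_mult_def power2_eq_square algebra_simps)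
qed

lemma metric_coord_pos:
  assumes "c \<in> A" "x \<in> chart_image c" "v \<noteq> 0"
  shows "v \<bullet> (G c x *v v) > 0"
proof -
  obtain p where p: "p \<in> fst c" "x = snd c p" using assms(2) by auto
  have "change c (chart_at A p) p v \<noteq> 0"
    using change_inverse[OF assms(1) chart_at(1) p(1) chart_at(2), of v] assms(3)
      linear_0[OF linear_change[OF chart_at(1) assms(1) chart_at(2) p(1)]] by auto
  then show ?thesis
    using metric_coord_apply[OF assms(1) p(1)] p(2) g_pos by simp
qed

lemma riemannian_patch:
  assumes "c \<in> A"
  shows "riemannian_patch (chart_image c) (G c)"
proof
  show "open (chart_image c)" by (rule open_image[OF assms])
  show "smooth_on (chart_image c) (G c)"
    using metric assms by (simp add: riemannian_metric_def)
  fix x assume x: "x \<in> chart_image c"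
  show sym: "G c x $ 2 $ 1 = G c x $ 1 $ 2"
    by (simp add: metric_coord_def Let_def g_sym)
  have q: "v \<bullet> (G c x *v v) = G c x $ 1 $ 1 * v $ 1 * v $ 1 + 2 * G c x $ 1 $ 2 * v $ 1 * v $ 2
      + G c x $ 2 $ 2 * v $ 2 * v $ 2" for v
    by (simp add: inner_vec_def sum_2 matrix_vector_mult_def sym algebra_simps)
  have a: "G c x $ 1 $ 1 > 0"
    using metric_coord_pos[OF assms x, of "axis 1 1"] by (simp add: q axis_def vec_eq_iff)
  \<comment> \<open>This vector is orthogonal to the first coordinate vector, and its squared length
    is the first diagonal entry times the determinant.\<close>
  define v :: "real^2" where "v = vector [- G c x $ 1 $ 2, G c x $ 1 $ 1]"
  have "0 < v \<bullet> (G c x *v v)"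
    using a by (intro metric_coord_pos assms x) (auto simp: v_def vec_eq_iff forall_2)
  also have "\<dots> = G c x $ 1 $ 1 * det (G c x)"
    unfolding q det_2 sym by (simp add: v_def algebra_simps)
  finally show "0 < det (G c x)" using a by (simp add: zero_less_mult_iff)
qed

end


section \<open>The Randers distance near a point\<close>

lemma curve_stays_near:
  fixes I :: "real set" and \<gamma> :: "real \<Rightarrow> 'a::topological_space"
  assumes "continuous_on I \<gamma>" "t \<in> I" "\<gamma> t \<in> U" "open U"
  obtains d where "d > 0" "\<And>s. s \<in> I \<Longrightarrow> dist s t < d \<Longrightarrow> \<gamma> s \<in> U"
proof -
  have "openin (top_of_set I) (I \<inter> \<gamma> -` U)"
    using continuous_openin_preimage_gen[OF assms(1,4)] .
  then obtain d where "d > 0" "ball t d \<inter> I \<subseteq> I \<inter> \<gamma> -` U"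
    unfolding openin_contains_ball using assms(2,3) by blast
  then show ?thesis by (intro that[of d]) (auto simp: dist_commute subset_iff)
qed

context smooth_surface
begin

lemma chart_curve_derivative:
  assumes "c \<in> A" "c' \<in> A" "\<gamma> t \<in> fst c" "\<gamma> t \<in> fst c'" "t \<in> I" "continuous_on I \<gamma>"
    and D: "((snd c \<circ> \<gamma>) has_vector_derivative D) (at t within I)"
  shows "((snd c' \<circ> \<gamma>) has_vector_derivative change c c' (\<gamma> t) D) (at t within I)"
proof -
  obtain d where d: "d > 0" "\<And>s. s \<in> I \<Longrightarrow> dist s t < d \<Longrightarrow> \<gamma> s \<in> fst c"
    using curve_stays_near[OF assms(6,5,3) open_dom[OF assms(1)]] by blast
  have "((snd c' \<circ> chart_inv c) has_derivative change c c' (\<gamma> t)) (at ((snd c \<circ> \<gamma>) t) within (snd c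
      \<circ> \<gamma>) ` I)"
    using has_derivative_at_withinI[OF transition_has_derivative[OF assms(1-4)]] by simp
  from vector_derivative_diff_chain_within[OF D this]
  have "(((snd c' \<circ> chart_inv c) \<circ> (snd c \<circ> \<gamma>)) has_vector_derivative change c c' (\<gamma> t) D) (at t
      within I)" .
  then show ?thesis
    by (rule has_vector_derivative_transform_within[OF _ d(1) assms(5)])
      (use d(2) chart_inv[OF assms(1)] in auto)
qed

text \<open>A closed coordinate ball is compact, hence closed in the Hausdorff surface. So a curve
  that starts inside can leave the chart only after meeting the boundary sphere.\<close>

lemma first_exit:
  fixes T :: real
  assumes c: "c \<in> A" and "0 \<le> T" "continuous_on {0..T} \<gamma>" and S: "cball x r \<subseteq> chart_image c"
    and 0: "\<gamma> 0 \<in> fst c" "snd c (\<gamma> 0) \<in> ball x r"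
  obtains s where "s \<in> {0..T}" "\<And>t. t \<in> {0..s} \<Longrightarrow> \<gamma> t \<in> fst c \<and> snd c (\<gamma> t) \<in> cball x r"
    "s = T \<or> dist x (snd c (\<gamma> s)) = r"
proof -
  define B where "B = {p \<in> fst c. snd c p \<in> ball x r}"
  define C where "C = chart_inv c ` cball x r"
  have "compact C"
    unfolding C_def
    by (rule compact_continuous_image[OF continuous_on_subset[OF continuous_on_chart_inv[OF c] S]
        compact_cball])
  then have C: "closed C" by (rule compact_imp_closed)
  have B: "open B" unfolding B_def by (rule open_chart_preimage[OF c]) auto
  have C_eq: "C = {p \<in> fst c. snd c p \<in> cball x r}"
  proof (intro subset_antisym subsetI)
    fix p assume "p \<in> C"
    then obtain y where "y \<in> cball x r" "p = chart_inv c y" by (auto simp: C_def)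
    then show "p \<in> {p \<in> fst c. snd c p \<in> cball x r}"
      using chart_inv_in[OF c subsetD[OF S]] chart_of_inv[OF c subsetD[OF S]] by simp
  next
    fix p assume "p \<in> {p \<in> fst c. snd c p \<in> cball x r}"
    then show "p \<in> C" unfolding C_def using chart_inv[OF c, of p] by (metis (mono_tags, lifting)
        imageI mem_Collect_eq)
  qed
  show ?thesis
  proof (cases "\<forall>t\<in>{0..T}. \<gamma> t \<in> B")
    case True
    then show ?thesis using assms(2) by (intro that[of T]) (auto simp: B_def less_imp_le)
  next
    case False
    \<comment> \<open>\<open>s\<close> will be the first time outside the open ball. Before it the
      curve lies in the compact set \<open>C\<close>, and by closedness this persists at time
      \<open>s\<close>.\<close>
    define N where "N = {0..T} \<inter> \<gamma> -` (- B)"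
    have "closed N" unfolding N_def
      by (rule continuous_closed_preimage[OF assms(3)]) (use B in auto)
    moreover have "bounded N" by (rule bounded_subset[of "{0..T}"]) (auto simp: N_def)
    ultimately have N: "compact N" by (simp add: compact_eq_bounded_closed)
    have "N \<noteq> {}" using False by (auto simp: N_def)
    then obtain s where s: "s \<in> N" "\<And>t. t \<in> N \<Longrightarrow> s \<le> t"
      using compact_attains_inf[OF N] by blast
    have sT: "0 \<le> s" "s \<le> T" "\<gamma> s \<notin> B" using s by (auto simp: N_def)
    have "\<gamma> 0 \<in> B" using 0 by (simp add: B_def)
    then have s0: "0 < s" using sT by (metis less_eq_real_def)
    have before: "\<gamma> t \<in> B" if "t \<in> {0..<s}" for t
      using s(2)[of t] that sT by (force simp: N_def)
    have "closed ({0..s} \<inter> \<gamma> -` C)"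
      using continuous_on_subset[OF assms(3)] sT C by (intro continuous_closed_preimage) auto
    moreover have "{0..<s} \<subseteq> {0..s} \<inter> \<gamma> -` C"
      using before by (force simp: B_def C_eq)
    ultimately have "closure {0..<s} \<subseteq> {0..s} \<inter> \<gamma> -` C"
      by (intro closure_minimal)
    then have all: "\<gamma> t \<in> C" if "t \<in> {0..s}" for t using that s0 by auto
    have "dist x (snd c (\<gamma> s)) = r"
      using all[of s] sT s0 by (auto simp: C_eq B_def)
    then show ?thesis using that[of s] sT all by (auto simp: C_eq)
  qed
qed

end

section \<open>The Randers norm, lengths and distances in coordinates\<close>

locale randers_surface = riemannian_surface A g for A :: "'a::t2_space chart set" and g +
  fixes \<tau> :: "'a \<Rightarrow> real^2 \<Rightarrow> real"
  assumes one_form: "smooth_one_form A \<tau>" and norm_less_1: "form_norm g \<tau> p < 1"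
begin

lemma linear_\<tau>: "linear (\<tau> p)"
  using one_form by (simp add: smooth_one_form_def)

text \<open>The supremum in \<open>form_norm\<close> dominates its members only once the set is
  known to be bounded; this comes from the positive minimum \<open>m\<close> of \<open>g p\<close>
  on the Euclidean unit sphere.\<close>

lemma \<tau>_less:
  assumes "v \<noteq> 0" shows "\<bar>\<tau> p v\<bar> < sqrt (g p v v)"
proof -
  interpret b: bounded_bilinear "g p" using bilinear_g bilinear_conv_bounded_bilinear by blast
  interpret l: bounded_linear "\<tau> p" using linear_\<tau> linear_conv_bounded_linear by blast
  have "continuous_on (sphere 0 1) (\<lambda>v. g p v v)" by (intro b.continuous_on continuous_on_id)
  moreover have "sphere (0::real^2) 1 \<noteq> {}" using norm_axis_1 by (metis empty_iff mem_sphere_0)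
  ultimately obtain w where w: "w \<in> sphere 0 1" "\<And>v. v \<in> sphere 0 1 \<Longrightarrow> g p w w \<le> g p v v"
    using continuous_attains_inf[OF compact_sphere] by blast
  define m where "m = g p w w"
  have m: "m > 0" using w(1) by (auto simp: m_def intro!: g_pos)
  have mv: "m * (norm v)\<^sup>2 \<le> g p v v" for v
  proof (cases "v = 0")
    case False
    then have "m \<le> g p (v /\<^sub>R norm v) (v /\<^sub>R norm v)" unfolding m_def by (intro w(2)) simp
    then show ?thesis using False by (simp add: b.scaleR_left b.scaleR_right field_simps
        power2_eq_square)
  qed (simp add: b.zero_left)
  obtain K where K: "K > 0" "\<And>v. norm (\<tau> p v) \<le> norm v * K" using l.pos_bounded by blast
  have "bdd_above ((\<lambda>v. \<bar>\<tau> p v\<bar>) ` {v. g p v v \<le> 1})"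
  proof (rule bdd_aboveI2)
    fix v assume "v \<in> {v. g p v v \<le> 1}"
    then have "(norm v)\<^sup>2 \<le> 1 / m" using mv[of v] m by (simp add: field_simps)
    then have "norm v \<le> sqrt (1 / m)" by (rule real_le_rsqrt)
    then show "\<bar>\<tau> p v\<bar> \<le> sqrt (1 / m) * K"
      using K(1) K(2)[of v] by (auto intro: order_trans mult_right_mono)
  qed
  moreover define s where "s = sqrt (g p v v)"
  have s: "s > 0" "s * s = g p v v" using g_pos[OF assms, of p] by (simp_all add: s_def)
  have "v /\<^sub>R s \<in> {v. g p v v \<le> 1}"
    using s by (simp add: b.scaleR_left b.scaleR_right field_simps)
  ultimately have "\<bar>\<tau> p (v /\<^sub>R s)\<bar> \<le> form_norm g \<tau> p"
    unfolding form_norm_def by (intro cSUP_upper)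
  also have "\<dots> < 1" by (rule norm_less_1)
  finally show ?thesis using s(1) by (simp add: l.scaleR abs_mult field_simps s_def[symmetric])
qed

abbreviation F where "F \<equiv> randers g \<tau>"
abbreviation f where "f \<equiv> form_coord A \<tau>"

lemma F_nonneg: "F p v \<ge> 0"
proof (cases "v = 0")
  case True
  then show ?thesis
    using bilinear_lzero[OF bilinear_g] linear_0[OF linear_\<tau>] by (simp add: randers_def)
next
  case False
  then show ?thesis using \<tau>_less[of v p] by (auto simp: randers_def)
qed

lemma form_coord_apply:
  assumes "c \<in> A" "p \<in> fst c"
  shows "f c (snd c p) \<bullet> v = \<tau> p (change c (chart_at A p) p v)"
proof -
  have "\<tau> p (change c (chart_at A p) p v) = v $ 1 * \<tau> p (change c (chart_at A p) p (axis 1 1))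
      + v $ 2 * \<tau> p (change c (chart_at A p) p (axis 2 1))"
    using linear_vec2[OF linear_compose[OF linear_change[OF assms(1) chart_at(1) assms(2)
        chart_at(2)] linear_\<tau>], where v = v]
    by simp
  then show ?thesis
    unfolding form_coord_def Let_def coord_vec_def chart_inv[OF assms]
    by (simp add: inner_vec_def sum_2)
qed

definition norm_coord :: "'a chart \<Rightarrow> real^2 \<Rightarrow> real^2 \<Rightarrow> real" where
  "norm_coord c x v = sqrt (v \<bullet> (G c x *v v)) + f c x \<bullet> v"

lemma F_coord:
  "c \<in> A \<Longrightarrow> p \<in> fst c \<Longrightarrow> F p (change c (chart_at A p) p v) = norm_coord c (snd c p) v"
  by (simp add: randers_def norm_coord_def metric_coord_apply form_coord_apply)

lemma norm_coord_pos:
  assumes "c \<in> A" "x \<in> chart_image c" "v \<noteq> 0"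
  shows "norm_coord c x v > 0"
proof -
  obtain p where p: "p \<in> fst c" "x = snd c p" using assms(2) by auto
  have "change c (chart_at A p) p v \<noteq> 0"
    using change_inverse[OF assms(1) chart_at(1) p(1) chart_at(2), of v] assms(3)
      linear_0[OF linear_change[OF chart_at(1) assms(1) chart_at(2) p(1)]] by auto
  then show ?thesis
    using \<tau>_less[of "change c (chart_at A p) p v" p] unfolding p(2) F_coord[OF assms(1) p(1),
        symmetric]
    by (auto simp: randers_def)
qed

lemma norm_coord_0 [simp]: "norm_coord c x 0 = 0"
  by (simp add: norm_coord_def)

lemma norm_coord_scaleR: "s \<ge> 0 \<Longrightarrow> norm_coord c x (s *\<^sub>R v) = s * norm_coord c x v"
  by (simp add: norm_coord_def matrix_vector_mult_scaleR real_sqrt_mult algebra_simps flip: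
      mult.assoc)

lemma continuous_on_norm_coord:
  assumes "c \<in> A"
  shows "continuous_on (chart_image c \<times> UNIV) (\<lambda>(x, v). norm_coord c x v)"
proof -
  interpret riemannian_patch "chart_image c" "G c" by (rule riemannian_patch[OF assms])
  have g: "continuous_on (chart_image c \<times> UNIV) (\<lambda>z. G c (fst z) $ i $ j)" for i j
    by (rule continuous_on_compose2[OF smooth_on_imp_continuous_on[OF smooth_G_nth]]) (auto intro:
        continuous_intros)
  have f: "continuous_on (chart_image c \<times> UNIV) (\<lambda>z. f c (fst z))"
    by (rule continuous_on_compose2[OF smooth_on_imp_continuous_on[of "chart_image c"]])
      (use one_form assms in \<open>auto intro: continuous_intros simp: smooth_one_form_def\<close>)
  show ?thesis
    unfolding norm_coord_def case_prod_beta
    by (simp add: inner_vec_def sum_2 matrix_vector_mult_def) (intro continuous_intros g f)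
qed

text \<open>The functional is \<open>v \<mapsto> g(e, v) / sqrt (g(e, e)) + \<tau>(v)\<close>, and the inequality is that of
  Cauchy and Schwarz.\<close>

lemma norm_coord_support:
  assumes "c \<in> A" "x \<in> chart_image c"
  obtains u where "\<And>v. u \<bullet> v \<le> norm_coord c x v" "u \<bullet> e = norm_coord c x e"
proof (cases "e = 0")
  case True
  have "0 \<le> v \<bullet> (G c x *v v)" for v
    using metric_coord_pos[OF assms, of v] by (cases "v = 0") auto
  then show ?thesis using True that[of "f c x"] by (simp add: norm_coord_def)
next
  case False
  interpret P: riemannian_patch "chart_image c" "G c" by (rule riemannian_patch[OF assms(1)])
  define q where "q v w = v \<bullet> (G c x *v w)" for v w
  have q: "q v w = G c x $ 1 $ 1 * v $ 1 * w $ 1 + G c x $ 1 $ 2 * v $ 1 * w $ 2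
      + G c x $ 1 $ 2 * v $ 2 * w $ 1 + G c x $ 2 $ 2 * v $ 2 * w $ 2" for v w
    by (simp add: q_def inner_vec_def sum_2 matrix_vector_mult_def P.sym[OF assms(2)] algebra_simps)
  have e: "q e e > 0" using metric_coord_pos[OF assms False] by (simp add: q_def)
  define u where "u = (1 / sqrt (q e e)) *\<^sub>R (G c x *v e) + f c x"
  have u: "u \<bullet> v = q v e / sqrt (q e e) + f c x \<bullet> v" for v
    unfolding u_def q_def inner_commute[of _ v] by (simp add: inner_add_right)
  have "q v e / sqrt (q e e) \<le> sqrt (q v v)" for v
  proof -
    have "q e e * q v v - (q v e)\<^sup>2 = (G c x $ 1 $ 1 * G c x $ 2 $ 2
        - G c x $ 1 $ 2 * G c x $ 1 $ 2) * (e $ 1 * v $ 2 - e $ 2 * v $ 1)\<^sup>2"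
      unfolding q by (simp add: power2_eq_square algebra_simps)
    also have "\<dots> \<ge> 0" using P.W_pos[OF assms(2)] by simp
    finally have "q v e \<le> sqrt (q e e * q v v)" by (intro real_le_rsqrt) simp
    then show ?thesis using e by (simp add: real_sqrt_mult field_simps)
  qed
  moreover have "q e e / sqrt (q e e) = sqrt (q e e)" using e real_div_sqrt by simp
  ultimately show ?thesis
    using that[of u] unfolding u by (simp add: norm_coord_def q_def)
qed

lemma norm_coord_bounds:
  assumes "c \<in> A" "x \<in> chart_image c"
  obtains m M where "m > 0" "M > 0" "\<And>v. m * norm v \<le> norm_coord c x v" "\<And>v. norm_coord c x v
      \<le> M * norm v"
proof -
  have cont: "continuous_on (sphere 0 1) (norm_coord c x)"
  proof -
    have "continuous_on (sphere 0 1) (\<lambda>v. (\<lambda>(x, v). norm_coord c x v) (x, v))"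
      by (rule continuous_on_compose2[OF continuous_on_norm_coord[OF assms(1)]])
        (use assms(2) in \<open>auto intro!: continuous_intros\<close>)
    then show ?thesis by simp
  qed
  have ne: "sphere (0::real^2) 1 \<noteq> {}" using norm_axis_1 by (metis empty_iff mem_sphere_0)
  obtain w where w: "w \<in> sphere 0 1" "\<And>v. v \<in> sphere 0 1 \<Longrightarrow> norm_coord c x w \<le> norm_coord c x v"
    using continuous_attains_inf[OF compact_sphere ne cont] by blast
  obtain w' where w': "w' \<in> sphere 0 1" "\<And>v. v \<in> sphere 0 1 \<Longrightarrow> norm_coord c x v \<le> norm_coord c x w'"
    using continuous_attains_sup[OF compact_sphere ne cont] by blast
  have s: "norm_coord c x v = norm v * norm_coord c x (v /\<^sub>R norm v)" for v
    using norm_coord_scaleR[of "norm v" c x "v /\<^sub>R norm v"] by (cases "v = 0") simp_all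
  show ?thesis
  proof (rule that)
    show "norm_coord c x w > 0" using w(1) by (intro norm_coord_pos assms) auto
    show "norm_coord c x w' > 0" using w'(1) by (intro norm_coord_pos assms) auto
    show "norm_coord c x w * norm v \<le> norm_coord c x v" for v
    proof (cases "v = 0")
      case False
      then show ?thesis using w(2)[of "v /\<^sub>R norm v"] by (subst s) (simp add: mult.commute
          mult_left_mono)
    qed simp
    show "norm_coord c x v \<le> norm_coord c x w' * norm v" for v
    proof (cases "v = 0")
      case False
      then show ?thesis using w'(2)[of "v /\<^sub>R norm v"] by (subst s) (simp add: mult.commute
          mult_left_mono)
    qed simp
  qed
qed

text \<open>The error is relative and uniform in \<open>v\<close>: by homogeneity it suffices to
  compare values at unit vectors, where uniform continuity on a compact set applies.\<close>

lemma norm_coord_near: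
  assumes "c \<in> A" "x \<in> chart_image c" "\<eta> > 0"
  obtains r where "r > 0" "cball x r \<subseteq> chart_image c"
    "\<And>u v. u \<in> cball x r \<Longrightarrow> \<bar>norm_coord c u v - norm_coord c x v\<bar> \<le> \<eta> * norm_coord c x v"
proof -
  obtain m M where m: "m > 0" "\<And>v. m * norm v \<le> norm_coord c x v"
    using norm_coord_bounds[OF assms(1,2)] by metis
  obtain r0 where r0: "r0 > 0" "cball x r0 \<subseteq> chart_image c"
    using open_image[OF assms(1)] assms(2) open_contains_cball by blast
  have "uniformly_continuous_on (cball x r0 \<times> sphere 0 1) (\<lambda>(x, v). norm_coord c x v)"
    using r0 by (intro compact_uniformly_continuous
        continuous_on_subset[OF continuous_on_norm_coord[OF assms(1)]]
        compact_Times) auto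
  then obtain d where d: "d > 0" "\<And>z z'. z \<in> cball x r0 \<times> sphere 0 1 \<Longrightarrow> z' \<in> cball x r0 \<times> sphere 0 1
      \<Longrightarrow>
      dist z' z < d \<Longrightarrow> dist ((\<lambda>(x, v). norm_coord c x v) z') ((\<lambda>(x, v). norm_coord c x v) z) < \<eta> * m"
    unfolding uniformly_continuous_on_def using assms(3) m(1) by (metis mult_pos_pos)
  have "\<bar>norm_coord c u v - norm_coord c x v\<bar> \<le> \<eta> * norm_coord c x v"
      if u: "u \<in> cball x (min r0 (d / 2))" for u v
  proof (cases "v = 0")
    case False
    define w where "w = v /\<^sub>R norm v"
    have w: "w \<in> sphere 0 1" "v = norm v *\<^sub>R w" using False by (auto simp: w_def)
    have "\<bar>norm_coord c u w - norm_coord c x w\<bar> < \<eta> * m"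
      using d(2)[of "(x, w)" "(u, w)"] u w(1) r0(1) d(1) by (auto simp: dist_Pair_Pair dist_real_def
          dist_commute)
    also have "\<eta> * m \<le> \<eta> * norm_coord c x w"
      using m(2)[of w] w(1) assms(3) by (intro mult_left_mono) auto
    finally have "\<bar>norm_coord c u w - norm_coord c x w\<bar> \<le> \<eta> * norm_coord c x w" by simp
    then have "norm v * \<bar>norm_coord c u w - norm_coord c x w\<bar> \<le> norm v * (\<eta> * norm_coord c x w)"
      by (intro mult_left_mono) auto
    moreover have "norm_coord c y v = norm v * norm_coord c y w" for y
      using norm_coord_scaleR[of "norm v" c y w] w(2) by simp
    ultimately show ?thesis
      by (simp add: abs_mult mult.left_commute flip: right_diff_distrib)
  qed simp
  moreover have "cball x (min r0 (d / 2)) \<subseteq> chart_image c" using r0(2) by auto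
  moreover have "min r0 (d / 2) > 0" using r0 d by simp
  ultimately show ?thesis by (intro that)
qed

text \<open>\<open>velocity\<close> refers to a chart that may jump along the curve; here the
  integrand is expressed in one chart as long as the curve stays in it.\<close>

lemma C1_curve_velocity:
  assumes "C1_curve A \<gamma>" "c \<in> A"
  obtains D where "continuous_on {t \<in> {0..1}. \<gamma> t \<in> fst c} D"
    "\<And>t. t \<in> {0..1} \<Longrightarrow> \<gamma> t \<in> fst c \<Longrightarrow> ((snd c \<circ> \<gamma>) has_vector_derivative D t) (at t within {0..1})"
    "\<And>t. t \<in> {0..1} \<Longrightarrow> \<gamma> t \<in> fst c \<Longrightarrow> F (\<gamma> t) (velocity A \<gamma> t) = norm_coord c (snd c (\<gamma> t)) (D t)"
proof -
  have \<gamma>: "continuous_on {0..1} \<gamma>" using assms by (simp add: C1_curve_def)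
  obtain D where D: "continuous_on {t \<in> {0..1}. \<gamma> t \<in> fst c} D"
    "\<forall>t \<in> {t \<in> {0..1}. \<gamma> t \<in> fst c}. ((snd c \<circ> \<gamma>) has_vector_derivative D t) (at t within {0..1})"
    using assms unfolding C1_curve_def Let_def by blast
  have "F (\<gamma> t) (velocity A \<gamma> t) = norm_coord c (snd c (\<gamma> t)) (D t)"
      if t: "t \<in> {0..1}" "\<gamma> t \<in> fst c" for t
  proof -
    have "((snd (chart_at A (\<gamma> t)) \<circ> \<gamma>) has_vector_derivative change c (chart_at A (\<gamma> t)) (\<gamma> t) (D
        t)) (at t within {0..1})"
      by (rule chart_curve_derivative) (use assms(2) t chart_at \<gamma> D(2) in auto)
    then have "velocity A \<gamma> t = change c (chart_at A (\<gamma> t)) (\<gamma> t) (D t)"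
      unfolding velocity_def using t(1) vector_derivative_within_cbox[of 0 1 t]
          by (simp add: cbox_interval)
    then show ?thesis using F_coord[OF assms(2) t(2)] by simp
  qed
  then show ?thesis using that[of D] D by blast
qed

lemma continuous_on_length_integrand:
  assumes "C1_curve A \<gamma>"
  shows "continuous_on {0..1} (\<lambda>t. F (\<gamma> t) (velocity A \<gamma> t))"
  unfolding continuous_on_eq_continuous_within
proof
  fix t :: real assume t: "t \<in> {0..1}"
  define c where "c = chart_at A (\<gamma> t)"
  have c: "c \<in> A" "\<gamma> t \<in> fst c" using chart_at by (auto simp: c_def)
  have \<gamma>: "continuous_on {0..1} \<gamma>" using assms by (simp add: C1_curve_def)
  obtain D where D: "continuous_on {t \<in> {0..1}. \<gamma> t \<in> fst c} D"
    "\<And>t. t \<in> {0..1} \<Longrightarrow> \<gamma> t \<in> fst c \<Longrightarrow> ((snd c \<circ> \<gamma>) has_vector_derivative D t) (at t within {0..1})"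
    "\<And>t. t \<in> {0..1} \<Longrightarrow> \<gamma> t \<in> fst c \<Longrightarrow> F (\<gamma> t) (velocity A \<gamma> t) = norm_coord c (snd c (\<gamma> t)) (D t)"
    by (rule C1_curve_velocity[OF assms c(1)]) (rule that)
  let ?T = "{t \<in> {0..1}. \<gamma> t \<in> fst c}"
  have "continuous_on ?T (\<lambda>t. snd c (\<gamma> t))"
    by (rule continuous_on_compose2[OF continuous_on_chart[OF c(1)] continuous_on_subset[OF \<gamma>]])
        auto
  then have "continuous_on ?T (\<lambda>t. (\<lambda>(x, v). norm_coord c x v) (snd c (\<gamma> t), D t))"
    by (intro continuous_on_compose2[OF continuous_on_norm_coord[OF c(1)]] continuous_on_Pair D(1))
        auto
  then have "continuous_on ?T (\<lambda>t. norm_coord c (snd c (\<gamma> t)) (D t))" by simp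
  then have "continuous_on ?T (\<lambda>t. F (\<gamma> t) (velocity A \<gamma> t))"
    by (rule continuous_on_eq) (use D(3) in auto)
  then have "continuous (at t within ?T) (\<lambda>t. F (\<gamma> t) (velocity A \<gamma> t))"
    using t c(2) by (auto simp: continuous_on_eq_continuous_within)
  \<comment> \<open>The curve stays in the chart near \<open>t\<close>, so restricting to
    \<open>?T\<close> does not change the neighbourhoods of \<open>t\<close>.\<close>
  moreover have "at t within ?T = at t within {0..1}"
  proof -
    obtain d where d: "d > 0" "\<And>s. s \<in> {0..1} \<Longrightarrow> dist s t < d \<Longrightarrow> \<gamma> s \<in> fst c"
      using curve_stays_near[OF \<gamma> t c(2) open_dom[OF c(1)]] by blast
    show ?thesis
      by (rule at_within_nhd[of t "ball t d"]) (use d in \<open>auto simp: dist_commute\<close>)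
  qed
  ultimately show "continuous (at t within {0..1}) (\<lambda>t. F (\<gamma> t) (velocity A \<gamma> t))" by simp
qed

lemma integrable_length:
  "C1_curve A \<gamma> \<Longrightarrow> (\<lambda>t. F (\<gamma> t) (velocity A \<gamma> t)) integrable_on {0..1}"
  by (intro integrable_continuous_interval continuous_on_length_integrand)

lemma length_lower_bound:
  assumes \<gamma>: "C1_curve A \<gamma>" and c: "c \<in> A" and x: "x \<in> chart_image c" and s: "s \<in> {0..1}"
    and K: "\<And>t. t \<in> {0..s} \<Longrightarrow> \<gamma> t \<in> fst c \<and> snd c (\<gamma> t) \<in> K"
    and near: "\<And>u v. u \<in> K \<Longrightarrow> \<bar>norm_coord c u v - norm_coord c x v\<bar> \<le> \<eta> * norm_coord c x v"
    and \<eta>: "\<eta> < 1"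
  shows "(1 - \<eta>) * norm_coord c x (snd c (\<gamma> s) - snd c (\<gamma> 0)) \<le> integral {0..1} (\<lambda>t. F (\<gamma> t)
      (velocity A \<gamma> t))"
proof -
  let ?w = "snd c (\<gamma> s) - snd c (\<gamma> 0)"
  obtain D where "continuous_on {t \<in> {0..1}. \<gamma> t \<in> fst c} D" and D:
    "\<And>t. t \<in> {0..1} \<Longrightarrow> \<gamma> t \<in> fst c \<Longrightarrow> ((snd c \<circ> \<gamma>) has_vector_derivative D t) (at t within {0..1})"
    "\<And>t. t \<in> {0..1} \<Longrightarrow> \<gamma> t \<in> fst c \<Longrightarrow> F (\<gamma> t) (velocity A \<gamma> t) = norm_coord c (snd c (\<gamma> t)) (D t)"
    by (rule C1_curve_velocity[OF \<gamma> c]) (rule that)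
  obtain u where u: "\<And>v. u \<bullet> v \<le> norm_coord c x v" "u \<bullet> ?w = norm_coord c x ?w"
    using norm_coord_support[OF c x] by metis
  have "(D has_integral ((snd c \<circ> \<gamma>) s - (snd c \<circ> \<gamma>) 0)) {0..s}"
  proof (rule fundamental_theorem_of_calculus)
    fix t assume t: "t \<in> {0..s}"
    then show "((snd c \<circ> \<gamma>) has_vector_derivative D t) (at t within {0..s})"
      using D(1)[of t] K[OF t] s by (auto intro: has_vector_derivative_within_subset)
  qed (use s in auto)
  from has_integral_linear[OF this bounded_linear_inner_right[of u]]
  have i: "((\<lambda>t. (1 - \<eta>) * (u \<bullet> D t)) has_integral (1 - \<eta>) * norm_coord c x ?w) {0..s}"
    using u(2) by (auto simp: o_def intro!: has_integral_mult_right)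
  have int: "(\<lambda>t. F (\<gamma> t) (velocity A \<gamma> t)) integrable_on {0..s}"
    by (rule integrable_on_subinterval[OF integrable_length[OF \<gamma>]]) (use s in auto)
  have "(1 - \<eta>) * norm_coord c x ?w \<le> integral {0..s} (\<lambda>t. F (\<gamma> t) (velocity A \<gamma> t))"
  proof (rule has_integral_le[OF i integrable_integral[OF int]])
    fix t assume t: "t \<in> {0..s}"
    have "(1 - \<eta>) * (u \<bullet> D t) \<le> (1 - \<eta>) * norm_coord c x (D t)"
      using \<eta> u(1) by (intro mult_left_mono) auto
    also have "\<dots> \<le> norm_coord c (snd c (\<gamma> t)) (D t)"
      using near[of "snd c (\<gamma> t)" "D t"] K[OF t] by (simp add: algebra_simps abs_le_iff)
    also have "\<dots> = F (\<gamma> t) (velocity A \<gamma> t)" using D(2)[of t] K[OF t] t s by auto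
    finally show "(1 - \<eta>) * (u \<bullet> D t) \<le> F (\<gamma> t) (velocity A \<gamma> t)" .
  qed
  also have "\<dots> \<le> integral {0..1} (\<lambda>t. F (\<gamma> t) (velocity A \<gamma> t))"
    by (rule integral_subset_le) (use s int integrable_length[OF \<gamma>] F_nonneg in auto)
  finally show ?thesis .
qed

abbreviation d where "d \<equiv> finsler_dist A F"

lemma dist_le_length:
  assumes "C1_curve A \<gamma>"
  shows "d (\<gamma> 0) (\<gamma> 1) \<le> integral {0..1} (\<lambda>t. F (\<gamma> t) (velocity A \<gamma> t))"
  unfolding finsler_dist_def
  by (rule cInf_lower)
    (use assms integral_nonneg integrable_length F_nonneg in \<open>auto intro!: bdd_belowI[of _ 0]
        integral_nonneg\<close>)

text \<open>A segment in one chart is an admissible curve only if it is continuously differentiable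
  in all charts of the atlas; the transition maps provide this.\<close>

lemma segment_curve:
  assumes c: "c \<in> A" and S: "closed_segment y z \<subseteq> chart_image c"
  defines "\<gamma> \<equiv> \<lambda>t. chart_inv c (y + t *\<^sub>R (z - y))"
  shows "C1_curve A \<gamma>"
    "t \<in> {0..1} \<Longrightarrow> F (\<gamma> t) (velocity A \<gamma> t) = norm_coord c (y + t *\<^sub>R (z - y)) (z - y)"
proof -
  have seg: "y + t *\<^sub>R (z - y) \<in> chart_image c" if "t \<in> {0..1}" for t
    using S that by (force simp: closed_segment_def algebra_simps)
  have cont: "continuous_on {0..1} \<gamma>"
    unfolding \<gamma>_def by (rule continuous_on_compose2[OF continuous_on_chart_inv[OF c]])
      (use seg in \<open>auto intro!: continuous_intros\<close>)
  have cg: "snd c (\<gamma> t) = y + t *\<^sub>R (z - y)" "\<gamma> t \<in> fst c" if "t \<in> {0..1}" for t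
    using chart_of_inv[OF c seg[OF that]] chart_inv_in[OF c seg[OF that]] by (simp_all add: \<gamma>_def)
  have D: "((snd c \<circ> \<gamma>) has_vector_derivative (z - y)) (at t within {0..1})" if "t \<in> {0..1}" for t
  proof (rule has_vector_derivative_transform[OF that])
    show "((\<lambda>t. y + t *\<^sub>R (z - y)) has_vector_derivative (z - y)) (at t within {0..1})"
      by (auto intro!: derivative_eq_intros)
  qed (use cg in auto)
  show C1: "C1_curve A \<gamma>"
    unfolding C1_curve_def Let_def
  proof (intro conjI ballI cont)
    fix c' assume c': "c' \<in> A"
    let ?T = "{t \<in> {0..1}. \<gamma> t \<in> fst c'}"
    let ?O = "snd c ` (fst c \<inter> fst c')"
    have "continuous_on ?O (\<lambda>x. frechet_derivative (snd c' \<circ> chart_inv c) (at x) (z - y))"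
      by (intro smooth_on_imp_continuous_on smooth_on_frechet_derivative smooth_transition c c')
    then have "continuous_on ?T (\<lambda>t. frechet_derivative (snd c' \<circ> chart_inv c) (at (snd c (\<gamma> t))) (z
        - y))"
    proof (rule continuous_on_compose2)
      show "continuous_on ?T (\<lambda>t. snd c (\<gamma> t))"
        by (rule continuous_on_compose2[OF continuous_on_chart[OF c] continuous_on_subset[OF cont]])
            (use cg in auto)
      show "(\<lambda>t. snd c (\<gamma> t)) ` ?T \<subseteq> ?O" using cg(2) by (intro image_subsetI imageI) simp
    qed
    then have "continuous_on ?T (\<lambda>t. change c c' (\<gamma> t) (z - y))"
      by (simp add: change_def)
    moreover have "((snd c' \<circ> \<gamma>) has_vector_derivative change c c' (\<gamma> t) (z
        - y)) (at t within {0..1})"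
      if "t \<in> ?T" for t
      using that cg D by (intro chart_curve_derivative c c' cont) auto
    ultimately show "\<exists>D. continuous_on ?T D \<and> (\<forall>t\<in>?T. ((snd c' \<circ> \<gamma>) has_vector_derivative D t) (at t
        within {0..1}))"
      by (intro exI[of _ "\<lambda>t. change c c' (\<gamma> t) (z - y)"]) auto
  qed
  obtain E where "continuous_on {t \<in> {0..1}. \<gamma> t \<in> fst c} E" and E: "\<And>t. t \<in> {0..1} \<Longrightarrow> \<gamma> t \<in> fst c
      \<Longrightarrow> ((snd c \<circ> \<gamma>) has_vector_derivative E t) (at t within {0..1})"
    "\<And>t. t \<in> {0..1} \<Longrightarrow> \<gamma> t \<in> fst c \<Longrightarrow> F (\<gamma> t) (velocity A \<gamma> t) = norm_coord c (snd c (\<gamma> t)) (E t)"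
    by (rule C1_curve_velocity[OF C1 c]) (rule that)
  show "F (\<gamma> t) (velocity A \<gamma> t) = norm_coord c (y + t *\<^sub>R (z - y)) (z - y)" if t: "t \<in> {0..1}"
  proof -
    have "E t = z - y"
      using vector_derivative_unique_within_closed_interval[of 0 1 t "snd c \<circ> \<gamma>" "E t" "z - y"]
        E(1)[OF t cg(2)[OF t]] D[OF t] t by (simp add: cbox_interval)
    then show ?thesis using E(2)[OF t cg(2)[OF t]] cg(1)[OF t] by simp
  qed
qed

text \<open>Coordinate segments give the upper estimate. For the lower one, a competing curve either
  stays in the ball, where \<open>length_lower_bound\<close> applies up to its end, or reaches the
  sphere, and then its initial part is already long enough.\<close>

lemma dist_near:
  assumes c: "c \<in> A" and x: "x \<in> chart_image c" and \<eta>: "0 < \<eta>" "\<eta> < 1"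
  obtains \<delta> where "\<delta> > 0" "ball x \<delta> \<subseteq> chart_image c"
    "\<And>y z. y \<in> ball x \<delta> \<Longrightarrow> z \<in> ball x \<delta> \<Longrightarrow>
      \<bar>d (chart_inv c y) (chart_inv c z) - norm_coord c x (z - y)\<bar> \<le> \<eta> * norm_coord c x (z - y)"
proof -
  obtain m M where mM: "m > 0" "M > 0" "\<And>v. m * norm v \<le> norm_coord c x v" "\<And>v. norm_coord c x v
      \<le> M * norm v"
    using norm_coord_bounds[OF c x] by metis
  obtain r where r: "r > 0" "cball x r \<subseteq> chart_image c"
    and near: "\<And>u v. u \<in> cball x r \<Longrightarrow> \<bar>norm_coord c u v - norm_coord c x v\<bar> \<le> \<eta> * norm_coord c x v"
    using norm_coord_near[OF c x \<eta>(1)] by metis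
  \<comment> \<open>The choice makes \<open>2 * M * \<delta>\<close> equal to
    \<open>m * (r - \<delta>)\<close>. The former bounds the norm of \<open>z - y\<close> from
    above, the latter bounds the norm of a displacement from \<open>y\<close> to the sphere of
    radius \<open>r\<close> from below.\<close>
  define \<delta> where "\<delta> = m * r / (2 * M + m)"
  have \<delta>: "\<delta> > 0" "\<delta> \<le> r" "2 * M * \<delta> = m * (r - \<delta>)"
    using mM r by (auto simp: \<delta>_def field_simps add_pos_pos)
  have ball: "ball x \<delta> \<subseteq> cball x r" using \<delta> by auto
  have pos: "0 \<le> norm_coord c x v" for v
    using norm_coord_pos[OF c x, of v] by (cases "v = 0") auto
  have "\<bar>d (chart_inv c y) (chart_inv c z) - norm_coord c x (z - y)\<bar> \<le> \<eta> * norm_coord c x (z - y)"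
    if y: "y \<in> ball x \<delta>" and z: "z \<in> ball x \<delta>" for y z
  proof -
    let ?p = "chart_inv c y" and ?q = "chart_inv c z"
    have yz: "y \<in> chart_image c" "z \<in> chart_image c" using y z ball r by blast+
    have inv: "?p \<in> fst c" "?q \<in> fst c" "snd c ?p = y" "snd c ?q = z"
      using chart_inv_in[OF c] chart_of_inv[OF c] yz by auto
    define \<gamma> where "\<gamma> = (\<lambda>t. chart_inv c (y + t *\<^sub>R (z - y)))"
    have seg: "closed_segment y z \<subseteq> cball x r"
      using closed_segment_subset[OF y z convex_ball] ball by blast
    have C1: "C1_curve A \<gamma>" and len: "\<And>t. t \<in> {0..1} \<Longrightarrow> F (\<gamma> t) (velocity A \<gamma> t) = norm_coord c (y
        + t *\<^sub>R (z - y)) (z - y)"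
      unfolding \<gamma>_def using segment_curve[OF c order_trans[OF seg r(2)]] by auto
    have ends: "\<gamma> 0 = ?p" "\<gamma> 1 = ?q" by (simp_all add: \<gamma>_def)
    have "d ?p ?q \<le> integral {0..1} (\<lambda>t. F (\<gamma> t) (velocity A \<gamma> t))"
      using dist_le_length[OF C1] ends by simp
    also have "\<dots> \<le> integral {0..1} (\<lambda>t::real. (1 + \<eta>) * norm_coord c x (z - y))"
    proof (rule integral_le[OF integrable_length[OF C1]])
      fix t :: real assume t: "t \<in> {0..1}"
      have "y + t *\<^sub>R (z - y) \<in> closed_segment y z"
        using t by (force simp: closed_segment_def algebra_simps)
      then have "\<bar>norm_coord c (y + t *\<^sub>R (z - y)) (z - y) - norm_coord c x (z - y)\<bar>
          \<le> \<eta> * norm_coord c x (z - y)"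
        using seg by (intro near) auto
      then show "F (\<gamma> t) (velocity A \<gamma> t) \<le> (1 + \<eta>) * norm_coord c x (z - y)"
        unfolding len[OF t] by (simp add: algebra_simps)
    qed (rule integrable_const_ivl)
    finally have upper: "d ?p ?q \<le> (1 + \<eta>) * norm_coord c x (z - y)" by simp
    have lower: "(1 - \<eta>) * norm_coord c x (z - y) \<le> d ?p ?q"
      unfolding finsler_dist_def
    proof (rule cInf_greatest)
      show "{integral {0..1} (\<lambda>t. F (\<gamma> t) (velocity A \<gamma> t)) |\<gamma>. C1_curve A \<gamma> \<and> \<gamma> 0 = ?p \<and> \<gamma> 1
          = ?q} \<noteq> {}"
        using C1 ends by blast
    next
      fix l assume "l \<in> {integral {0..1} (\<lambda>t. F (\<gamma> t) (velocity A \<gamma> t)) |\<gamma>. C1_curve A \<gamma> \<and> \<gamma> 0 = ?p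
          \<and> \<gamma> 1 = ?q}"
      then obtain \<beta> where \<beta>: "C1_curve A \<beta>" "\<beta> 0 = ?p" "\<beta> 1 = ?q"
        and l: "l = integral {0..1} (\<lambda>t. F (\<beta> t) (velocity A \<beta> t))" by blast
      have "continuous_on {0..1} \<beta>" using \<beta>(1) by (simp add: C1_curve_def)
      moreover have "\<beta> 0 \<in> fst c" "snd c (\<beta> 0) \<in> ball x r" using \<beta>(2) inv y \<delta> by auto
      ultimately obtain s where s: "s \<in> {0..1}" "\<And>t. t \<in> {0..s} \<Longrightarrow> \<beta> t \<in> fst c
          \<and> snd c (\<beta> t) \<in> cball x r"
        "s = 1 \<or> dist x (snd c (\<beta> s)) = r"
        using first_exit[OF c zero_le_one _ r(2)] by metis
      have "(1 - \<eta>) * norm_coord c x (snd c (\<beta> s) - snd c (\<beta> 0)) \<le> l"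
        unfolding l by (rule length_lower_bound[OF \<beta>(1) c x s(1,2) near \<eta>(2)])
      moreover have "norm_coord c x (z - y) \<le> norm_coord c x (snd c (\<beta> s) - snd c (\<beta> 0))"
      proof (cases "s = 1")
        case True
        then show ?thesis using \<beta> inv by simp
      next
        case False
        then have "r = dist x (snd c (\<beta> s))" using s(3) by simp
        also have "\<dots> \<le> dist x y + norm (snd c (\<beta> s) - y)"
          by (metis dist_norm dist_triangle dist_commute)
        finally have "r - \<delta> \<le> norm (snd c (\<beta> s) - y)" using y by simp
        then have "m * (r - \<delta>) \<le> m * norm (snd c (\<beta> s) - y)" using mM by simp
        also have "\<dots> \<le> norm_coord c x (snd c (\<beta> s) - y)" by (rule mM)
        finally have 1: "2 * M * \<delta> \<le> norm_coord c x (snd c (\<beta> s) - y)" using \<delta> by simp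
        have "norm (z - y) \<le> dist x z + dist x y" by (metis dist_norm dist_triangle3 dist_commute)
        then have "norm (z - y) \<le> 2 * \<delta>" using y z by simp
        then have "M * norm (z - y) \<le> M * (2 * \<delta>)" using mM by simp
        then show ?thesis using 1 mM(4)[of "z - y"] \<beta> inv by simp
      qed
      ultimately show "(1 - \<eta>) * norm_coord c x (z - y) \<le> l"
        using \<eta> by (meson diff_ge_0_iff_ge less_imp_le mult_left_mono order_trans)
    qed
    show ?thesis using upper lower by (simp add: algebra_simps abs_le_iff)
  qed
  then show ?thesis using that[of \<delta>] \<delta>(1) ball r by blast
qed

end


section \<open>First order expansion of the flow\<close>

lemma vector_derivative_bound:
  fixes z :: "real \<Rightarrow> 'v::real_normed_vector"
  assumes "0 \<le> t" and z: "\<And>s. s \<in> {0..t} \<Longrightarrow> (z has_vector_derivative z' s) (at s within {0..t})"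
    and C: "\<And>s. s \<in> {0..t} \<Longrightarrow> norm (z' s) \<le> C"
  shows "norm (z t - z 0) \<le> C * t"
proof -
  have "norm (z t - z 0) \<le> C * norm (t - 0)"
  proof (rule differentiable_bound)
    show "(z has_derivative (\<lambda>h. h *\<^sub>R z' s)) (at s within {0..t})" if "s \<in> {0..t}" for s
      using z[OF that] by (simp add: has_vector_derivative_def)
    show "onorm (\<lambda>h. h *\<^sub>R z' s) \<le> C" if "s \<in> {0..t}" for s
      using mult_right_mono[OF C[OF that] abs_ge_zero] by (intro onorm_le) (simp add: mult.commute)
  qed (use assms(1) in auto)
  then show ?thesis using assms(1) by simp
qed

text \<open>The difference \<open>z\<close> of two trajectories satisfies \<open>z' = L z\<close> up
  to an error \<open>\<eta> * norm z\<close>. A crude bound of \<open>z\<close> by its initial value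
  is fed back into this equation and gives the expansion to first order in time.\<close>

lemma flow_difference:
  fixes x y :: "real \<Rightarrow> 'v::real_normed_vector"
  assumes T: "0 \<le> T" "(B + \<eta>) * T \<le> 1 / 2" and B: "B \<ge> 0" "\<eta> \<ge> 0"
    and x: "\<And>t. t \<in> {0..T} \<Longrightarrow> (x has_vector_derivative k (x t)) (at t within {0..T})" "\<And>t. t \<in> {0..T}
        \<Longrightarrow> x t \<in> N"
    and y: "\<And>t. t \<in> {0..T} \<Longrightarrow> (y has_vector_derivative k (y t)) (at t within {0..T})" "\<And>t. t \<in> {0..T}
        \<Longrightarrow> y t \<in> N"
    and L: "linear L" "\<And>v. norm (L v) \<le> B * norm v"
    and k: "\<And>u v. u \<in> N \<Longrightarrow> v \<in> N \<Longrightarrow> norm (k v - k u - L (v - u)) \<le> \<eta> * norm (v - u)"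
    and t: "t \<in> {0..T}"
  shows "norm (y t - x t - (y 0 - x 0) - t *\<^sub>R L (y 0 - x 0)) \<le> (2 * \<eta> + 2 * B * (B
      + \<eta>) * t) * norm (y 0 - x 0) * t"
proof -
  define z where "z = (\<lambda>t. y t - x t)"
  define z' where "z' t = k (y t) - k (x t)" for t
  define \<Lambda> where "\<Lambda> = B + \<eta>"
  have \<Lambda>: "\<Lambda> \<ge> 0" using B by (simp add: \<Lambda>_def)
  have dz: "(z has_vector_derivative z' t) (at t within {0..T})" if "t \<in> {0..T}" for t
    unfolding z_def z'_def by (intro has_vector_derivative_diff x y that)
  have zL: "norm (z' t - L (z t)) \<le> \<eta> * norm (z t)" if "t \<in> {0..T}" for t
    unfolding z_def z'_def by (intro k x y that)
  have z': "norm (z' t) \<le> \<Lambda> * norm (z t)" if "t \<in> {0..T}" for t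
    using zL[OF that] L(2)[of "z t"] norm_triangle_sub[of "z' t" "L (z t)"]
        by (simp add: \<Lambda>_def algebra_simps)
  have "continuous_on {0..T} z"
    by (rule continuous_on_vector_derivative[OF dz])
  then have "continuous_on {0..T} (\<lambda>s. norm (z s - z 0))" by (intro continuous_intros)
  then obtain s where s: "s \<in> {0..T}" "\<And>t. t \<in> {0..T} \<Longrightarrow> norm (z t - z 0) \<le> norm (z s - z 0)"
    using continuous_attains_sup[of "{0..T}"] T(1) by (metis atLeastAtMost_iff compact_Icc empty_iff
        order_refl)
  \<comment> \<open>At the maximum of \<open>norm (z t - z 0)\<close> the estimate
    \<open>m \<le> 1 / 2 * (norm (z 0) + m)\<close> will hold, and absorbing \<open>m\<close> on the
    left gives \<open>m \<le> norm (z 0)\<close>.\<close>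
  define m where "m = norm (z s - z 0)"
  have zm: "norm (z t) \<le> norm (z 0) + m" if "t \<in> {0..T}" for t
    using s(2)[OF that] norm_triangle_sub[of "z t" "z 0"] by (simp add: m_def)
  have "m \<le> (\<Lambda> * (norm (z 0) + m)) * s"
    unfolding m_def
  proof (rule vector_derivative_bound)
    fix u assume "u \<in> {0..s}"
    then have u: "u \<in> {0..T}" using s(1) by auto
    show "(z has_vector_derivative z' u) (at u within {0..s})"
      by (rule has_vector_derivative_within_subset[OF dz[OF u]]) (use s(1) in auto)
    show "norm (z' u) \<le> \<Lambda> * (norm (z 0) + norm (z s - z 0))"
      using order_trans[OF z'[OF u] mult_left_mono[OF zm[OF u] \<Lambda>]] by (simp add: m_def)
  qed (use s(1) in auto)
  also have "\<dots> = (\<Lambda> * s) * (norm (z 0) + m)" by simp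
  also have "\<dots> \<le> (\<Lambda> * T) * (norm (z 0) + m)"
    using s(1) \<Lambda> by (intro mult_right_mono mult_left_mono) (auto simp: m_def)
  also have "\<dots> \<le> 1 / 2 * (norm (z 0) + m)"
    using T(2) by (intro mult_right_mono) (auto simp: m_def \<Lambda>_def)
  finally have m: "m \<le> norm (z 0)" by simp
  have z2: "norm (z t) \<le> 2 * norm (z 0)" if "t \<in> {0..T}" for t
    using zm[OF that] m by simp
  have zz: "norm (z u - z 0) \<le> (\<Lambda> * (2 * norm (z 0))) * u" if u: "u \<in> {0..T}" for u
  proof (rule vector_derivative_bound)
    fix v assume "v \<in> {0..u}"
    then have v: "v \<in> {0..T}" using u by auto
    show "(z has_vector_derivative z' v) (at v within {0..u})"
      by (rule has_vector_derivative_within_subset[OF dz[OF v]]) (use u in auto)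
    show "norm (z' v) \<le> \<Lambda> * (2 * norm (z 0))"
      by (rule order_trans[OF z'[OF v] mult_left_mono[OF z2[OF v] \<Lambda>]])
  qed (use u in auto)
  define e where "e = (\<lambda>t. z t - t *\<^sub>R L (z 0))"
  have "norm (e t - e 0) \<le> ((2 * \<eta> + 2 * B * \<Lambda> * t) * norm (z 0)) * t"
  proof (rule vector_derivative_bound)
    fix u assume u': "u \<in> {0..t}"
    then have u: "u \<in> {0..T}" using t by auto
    have "(e has_vector_derivative z' u - L (z 0)) (at u within {0..T})"
      unfolding e_def by (rule has_vector_derivative_diff[OF dz[OF u]]) (auto intro!:
          derivative_eq_intros)
    then show "(e has_vector_derivative z' u - L (z 0)) (at u within {0..t})"
      by (rule has_vector_derivative_within_subset) (use t in auto)
    have "norm (z' u - L (z 0)) \<le> norm (z' u - L (z u)) + norm (L (z u - z 0))"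
      using norm_triangle_ineq[of "z' u - L (z u)" "L (z u - z 0)"]
          by (simp add: linear_diff[OF L(1)])
    also have "\<dots> \<le> \<eta> * norm (z u) + B * norm (z u - z 0)"
      by (intro add_mono zL u L)
    also have "\<dots> \<le> \<eta> * (2 * norm (z 0)) + B * ((\<Lambda> * (2 * norm (z 0))) * t)"
      using u' B \<Lambda> by (intro add_mono mult_left_mono z2 u order_trans[OF zz[OF u]]) auto
    finally show "norm (z' u - L (z 0)) \<le> (2 * \<eta> + 2 * B * \<Lambda> * t) * norm (z 0)"
      by (simp add: algebra_simps)
  qed (use t in auto)
  then show ?thesis by (simp add: e_def z_def \<Lambda>_def algebra_simps)
qed

text \<open>This carries the estimate of increments in \<open>flow_expansion\<close> over to the
  differential of a time-t map: for short steps along \<open>v\<close> the increment is nearly a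
  multiple of \<open>D v\<close>.\<close>

lemma has_derivative_bound:
  fixes \<phi> :: "'v::real_normed_vector \<Rightarrow> 'w::real_normed_vector"
  assumes D: "(\<phi> has_derivative D) (at x)" and M: "linear M" and "\<rho> > 0"
    and bound: "\<And>y. y \<in> ball x \<rho> \<Longrightarrow> norm (\<phi> y - \<phi> x - M (y - x)) \<le> C * norm (y - x)"
  shows "norm (D v - M v) \<le> C * norm v"
proof (cases "v = 0")
  case True
  then show ?thesis using linear_0[OF M] linear_0[OF has_derivative_linear[OF D]] by simp
next
  case False
  show ?thesis
  proof (rule field_le_epsilon)
    fix e :: real assume "e > 0"
    define e' where "e' = e / norm v"
    have e': "e' > 0" using \<open>e > 0\<close> False by (simp add: e'_def)
    obtain d where d: "d > 0" "\<And>y. norm (y - x) < d \<Longrightarrow> norm (\<phi> y - \<phi> x - D (y - x)) \<le> e' * norm (y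
        - x)"
      using D e' unfolding has_derivative_at_alt by blast
    define s where "s = min d \<rho> / (2 * norm v)"
    have s: "s > 0" "s * norm v < d" "s * norm v < \<rho>" using d assms(3) False by (auto simp: s_def)
    have "norm (s *\<^sub>R (D v - M v)) = norm ((\<phi> (x + s *\<^sub>R v) - \<phi> x - M (s *\<^sub>R v)) - (\<phi> (x + s *\<^sub>R v)
        - \<phi> x - D (s *\<^sub>R v)))"
      using linear_scale[OF M, of s v] linear_scale[OF has_derivative_linear[OF D], of s v]
      by (simp add: algebra_simps)
    also have "\<dots> \<le> C * norm (s *\<^sub>R v) + e' * norm (s *\<^sub>R v)"
      using d(2)[of "x + s *\<^sub>R v"] bound[of "x + s *\<^sub>R v"] s
      by (intro order_trans[OF norm_triangle_ineq4 add_mono]) (auto simp: dist_norm)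
    also have "\<dots> = s * (C * norm v + e)"
      using s(1) False by (simp add: e'_def algebra_simps)
    finally have "s * norm (D v - M v) \<le> s * (C * norm v + e)"
      using s(1) by (simp only: norm_scaleR abs_of_pos)
    then show "norm (D v - M v) \<le> C * norm v + e" using s(1) by simp
  qed
qed

text \<open>Continuity of the derivative makes \<open>D y - D x\<close> small near \<open>x\<close>;
  the mean value inequality for \<open>k - D x\<close> on a convex ball does the rest.\<close>

lemma smooth_strictly_differentiable:
  fixes k :: "real^2 \<Rightarrow> real^2"
  assumes "open S" "smooth_on S k" "x \<in> S" "\<eta> > 0"
  obtains r where "r > 0" "cball x r \<subseteq> S"
    "\<And>u v. u \<in> cball x r \<Longrightarrow> v \<in> cball x r \<Longrightarrow>
      norm (k v - k u - frechet_derivative k (at x) (v - u)) \<le> \<eta> * norm (v - u)"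
proof -
  define D where "D = (\<lambda>y. frechet_derivative k (at y))"
  have kD: "(k has_derivative D y) (at y)" if "y \<in> S" for y
    unfolding D_def using assms(2) that smooth_on_imp_differentiable has_frechet_derivative by blast
  have cont: "\<exists>d>0. \<forall>y\<in>S. dist y x < d \<longrightarrow> norm (D y (axis i 1) - D x (axis i 1)) < \<eta> / 2" for i
    using smooth_on_imp_continuous_on[OF smooth_on_frechet_derivative[OF assms(2)], of "axis i 1"]
        assms(3,4)
    unfolding continuous_on_iff D_def dist_norm by (metis half_gt_zero)
  obtain d1 where d1: "d1 > 0" "\<And>y. y \<in> S \<Longrightarrow> dist y x < d1 \<Longrightarrow> norm (D y (axis 1 1)
      - D x (axis 1 1)) < \<eta> / 2"
    using cont[of 1] by blast
  obtain d2 where d2: "d2 > 0" "\<And>y. y \<in> S \<Longrightarrow> dist y x < d2 \<Longrightarrow> norm (D y (axis 2 1)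
      - D x (axis 2 1)) < \<eta> / 2"
    using cont[of 2] by blast
  obtain r0 where r0: "r0 > 0" "cball x r0 \<subseteq> S"
    using assms(1,3) open_contains_cball by blast
  define r where "r = min r0 (min d1 d2 / 2)"
  have r: "r > 0" "cball x r \<subseteq> S" using r0 d1(1) d2(1) by (auto simp: r_def)
  have on: "onorm (\<lambda>h. D y h - D x h) \<le> \<eta>" if y: "y \<in> cball x r" for y
  proof (rule onorm_le)
    fix h
    have yS: "y \<in> S" using y r by blast
    have "dist y x < d1" "dist y x < d2" using y d1(1) d2(1) r0(1)
        by (auto simp: r_def dist_commute)
    then have 1: "norm (D y (axis 1 1) - D x (axis 1 1)) \<le> \<eta> / 2" "norm (D y (axis 2 1)
        - D x (axis 2 1)) \<le> \<eta> / 2"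
      using d1(2) d2(2) yS by (auto intro: less_imp_le)
    have "D y h - D x h = h $ 1 *\<^sub>R (D y (axis 1 1) - D x (axis 1 1)) + h $ 2 *\<^sub>R (D y (axis 2 1)
        - D x (axis 2 1))"
      using linear_vec2[OF has_derivative_linear[OF kD[OF yS]], of h]
        linear_vec2[OF has_derivative_linear[OF kD[OF assms(3)]], of h]
      by (simp add: algebra_simps)
    also have "norm \<dots> \<le> \<bar>h $ 1\<bar> * norm (D y (axis 1 1) - D x (axis 1 1)) + \<bar>h $ 2\<bar> * norm (D y (axis
        2 1) - D x (axis 2 1))"
      by (rule order_trans[OF norm_triangle_ineq]) simp
    also have "\<dots> \<le> norm h * (\<eta> / 2) + norm h * (\<eta> / 2)"
      by (intro add_mono mult_mono 1 component_le_norm_cart) auto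
    finally show "norm (D y h - D x h) \<le> \<eta> * norm h" by simp
  qed
  have "norm (k v - k u - D x (v - u)) \<le> \<eta> * norm (v - u)" if "u \<in> cball x r" "v \<in> cball x r"
      for u v
  proof -
    have "norm ((\<lambda>y. k y - D x y) v - (\<lambda>y. k y - D x y) u) \<le> \<eta> * norm (v - u)"
    proof (rule differentiable_bound[OF convex_cball])
      fix y assume y: "y \<in> cball x r"
      have "(D x has_derivative D x) (at y within cball x r)"
        using kD[OF assms(3)] by (intro bounded_linear_imp_has_derivative
            has_derivative_bounded_linear)
      then show "((\<lambda>y. k y - D x y) has_derivative (\<lambda>h. D y h - D x h)) (at y within cball x r)"
        using y r by (intro has_derivative_diff has_derivative_at_withinI[OF kD]) auto
    qed (use that on in auto)
    then show ?thesis
      by (simp add: linear_diff[OF has_derivative_linear[OF kD[OF assms(3)]]] algebra_simps)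
  qed
  then show ?thesis using that[of r] r unfolding D_def by blast
qed

definition field_coord :: "'a chart set \<Rightarrow> 'a chart \<Rightarrow> ('a \<Rightarrow> real^2) \<Rightarrow> real^2 \<Rightarrow> real^2" where
  "field_coord A c K x = comps_of A c (chart_inv c x) (K (chart_inv c x))"

context smooth_surface
begin

lemma smooth_field_coord: "smooth_vector_field A K \<Longrightarrow> c \<in> A \<Longrightarrow> smooth_on (chart_image c) (field_coord
    A c K)"
  by (simp add: smooth_vector_field_def field_coord_def[abs_def] Let_def)

lemma flow_coord_derivative:
  assumes "local_flow A K U \<epsilon> \<theta>" "q \<in> U" "\<bar>t\<bar> < \<epsilon>" "c \<in> A" "\<theta> t q \<in> fst c"
  shows "((\<lambda>t. snd c (\<theta> t q)) has_vector_derivative field_coord A c K (snd c (\<theta> t q))) (at t)"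
proof -
  let ?I = "{-\<epsilon><..<\<epsilon>}" and ?c = "chart_at A (\<theta> t q)"
  have t: "t \<in> ?I" using assms(3) by auto
  have i: "continuous_on ?I (\<lambda>t. \<theta> t q)"
    "((snd ?c \<circ> (\<lambda>t. \<theta> t q)) has_vector_derivative K (\<theta> t q)) (at t)"
    using assms(1,2) t by (auto simp: local_flow_def integral_curve_def)
  then have "((snd c \<circ> (\<lambda>t. \<theta> t q)) has_vector_derivative change ?c c (\<theta> t q) (K (\<theta> t q))) (at t
      within ?I)"
    by (intro chart_curve_derivative chart_at assms t) (auto intro: has_vector_derivative_at_within)
  then show ?thesis
    using t at_within_open[OF t] by (simp add: field_coord_def comps_of_def chart_inv assms(4,5)
        o_def)
qed

text \<open>No regularity of the flow in the initial point is available here, only its time derivative;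
  the expansion comes from the differential equation of the difference of two trajectories.\<close>

lemma flow_expansion:
  assumes K: "smooth_vector_field A K" and flow: "local_flow A K U \<epsilon> \<theta>" and U: "open U" "\<epsilon> > 0"
    and c: "c \<in> A" and p: "p \<in> U" "p \<in> fst c" and \<eta>: "\<eta> > 0"
  obtains \<rho> T where "\<rho> > 0" "0 < T" "T < \<epsilon>" "ball (snd c p) \<rho> \<subseteq> snd c ` (fst c \<inter> U)"
    "\<And>x t. x \<in> ball (snd c p) \<rho> \<Longrightarrow> t \<in> {0..T} \<Longrightarrow> \<theta> t (chart_inv c x) \<in> fst c"
    "\<And>x t. x \<in> ball (snd c p) \<rho> \<Longrightarrow> t \<in> {0..T} \<Longrightarrow>
      norm (snd c (\<theta> t (chart_inv c x)) - snd c (\<theta> t p) - (x - snd c p)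
        - t *\<^sub>R frechet_derivative (field_coord A c K) (at (snd c p)) (x - snd c p)) \<le> \<eta> * norm (x
            - snd c p) * t"
proof -
  define k where "k = field_coord A c K"
  define x0 where "x0 = snd c p"
  define L where "L = frechet_derivative k (at x0)"
  have x0: "x0 \<in> chart_image c" using p by (simp add: x0_def)
  have smk: "smooth_on (chart_image c) k" unfolding k_def by (rule smooth_field_coord[OF K c])
  have "bounded_linear L"
    unfolding L_def using smk x0 by (intro has_derivative_bounded_linear[OF has_frechet_derivative]
        smooth_on_imp_differentiable)
  then obtain B where B: "B > 0" "\<And>v. norm (L v) \<le> norm v * B" and linL: "linear L"
    using bounded_linear.pos_bounded bounded_linear.linear by blast
  obtain r where r: "r > 0" "cball x0 r \<subseteq> chart_image c"
    and strict: "\<And>u v. u \<in> cball x0 r \<Longrightarrow> v \<in> cball x0 r \<Longrightarrow> norm (k v - k u - L (v - u))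
        \<le> \<eta> / 4 * norm (v - u)"
    using smooth_strictly_differentiable[OF open_image[OF c] smk x0, of "\<eta> / 4"] \<eta> unfolding L_def
        by auto
  have "bounded (k ` cball x0 r)"
    using smooth_on_imp_continuous_on[OF smk] r(2)
    by (intro compact_imp_bounded compact_continuous_image compact_cball)
        (rule continuous_on_subset)
  then obtain M where M: "M > 0" "\<And>x. x \<in> cball x0 r \<Longrightarrow> norm (k x) \<le> M"
    unfolding bounded_pos by auto
  \<comment> \<open>In order, the bounds ensure that the flow exists, that trajectories move by less
    than \<open>r / 2\<close>, that the absorption in \<open>flow_difference\<close> works, and that
    the coefficient of the error quadratic in time contributes at most
    \<open>\<eta> / 2\<close>.\<close>
  define T where "T = Min {\<epsilon> / 2, r / (4 * M), 1 / (2 * (B + \<eta> / 4)), \<eta> / (4 * B * (B + \<eta> / 4))}"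
  have T: "0 < T" "T < \<epsilon>" "M * T < r / 2" "(B + \<eta> / 4) * T \<le> 1 / 2" "2 * B * (B + \<eta> / 4) * T
      \<le> \<eta> / 2"
  proof -
    have bp: "B + \<eta> / 4 > 0" using B \<eta> by simp
    show "0 < T" unfolding T_def using U r M B \<eta> bp by auto
    have le: "T \<le> \<epsilon> / 2" "T \<le> r / (4 * M)" "T \<le> 1 / (2 * (B + \<eta> / 4))" "T \<le> \<eta> / (4 * B * (B
        + \<eta> / 4))"
      unfolding T_def by (rule Min_le; simp)+
    show "T < \<epsilon>" using le(1) U by simp
    have "M * T \<le> M * (r / (4 * M))" using M le by (intro mult_left_mono) auto
    then show "M * T < r / 2" using M r by simp
    have "(B + \<eta> / 4) * T \<le> (B + \<eta> / 4) * (1 / (2 * (B + \<eta> / 4)))"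
        using le bp by (intro mult_left_mono) auto
    also have "\<dots> = 1 / 2" using bp by simp
    finally show "(B + \<eta> / 4) * T \<le> 1 / 2" .
    have "2 * B * (B + \<eta> / 4) * T \<le> 2 * B * (B + \<eta> / 4) * (\<eta> / (4 * B * (B + \<eta> / 4)))"
      using le bp B by (intro mult_left_mono) auto
    also have "\<dots> = \<eta> / 2"
    proof -
      have "2 * B * Q * (\<eta> / (4 * B * Q)) = \<eta> / 2" if "Q > 0" for Q using that B by simp
      then show ?thesis using bp .
    qed
    finally show "2 * B * (B + \<eta> / 4) * T \<le> \<eta> / 2" .
  qed
  have "open (snd c ` (fst c \<inter> U))" by (rule open_chart_image[OF c U(1)])
  moreover have "x0 \<in> snd c ` (fst c \<inter> U)" using p by (auto simp: x0_def)
  ultimately obtain \<rho>0 where \<rho>0: "\<rho>0 > 0" "ball x0 \<rho>0 \<subseteq> snd c ` (fst c \<inter> U)"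
    using open_contains_ball by blast
  define \<rho> where "\<rho> = min \<rho>0 (r / 2)"
  have \<rho>: "\<rho> > 0" "ball x0 \<rho> \<subseteq> snd c ` (fst c \<inter> U)" "ball x0 \<rho> \<subseteq> ball x0 (r / 2)"
    using \<rho>0 r by (auto simp: \<rho>_def)
  have inv: "chart_inv c x \<in> fst c" "chart_inv c x \<in> U" "snd c (chart_inv c x) = x"
      if x: "x \<in> ball x0 \<rho>" for x
  proof -
    obtain q where "q \<in> fst c" "q \<in> U" "x = snd c q" using subsetD[OF \<rho>(2) x] by blast
    then show "chart_inv c x \<in> fst c" "chart_inv c x \<in> U" "snd c (chart_inv c x) = x"
      by (simp_all add: chart_inv[OF c])
  qed
  \<comment> \<open>With speed at most \<open>M\<close>, a trajectory that starts within
    \<open>r / 2\<close> of \<open>x0\<close> cannot have reached the sphere of radius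
    \<open>r\<close>, so the time given by \<open>first_exit\<close> is \<open>T\<close>.\<close>
  have stay: "\<theta> t (chart_inv c x) \<in> fst c \<and> snd c (\<theta> t (chart_inv c x)) \<in> cball x0 r"
    if x: "x \<in> ball x0 \<rho>" and t: "t \<in> {0..T}" for x t
  proof -
    let ?q = "chart_inv c x"
    have q: "?q \<in> U" "\<theta> 0 ?q = ?q" using inv[OF x] flow by (auto simp: local_flow_def)
    have cont: "continuous_on {0..T} (\<lambda>t. \<theta> t ?q)"
      using flow q(1) T U by (auto simp: local_flow_def integral_curve_def elim!:
          continuous_on_subset)
    have start: "\<theta> 0 ?q \<in> fst c" "snd c (\<theta> 0 ?q) \<in> ball x0 r"
      using q(2) inv[OF x] \<rho>(3) x r(1) by auto
    obtain s where s: "s \<in> {0..T}" "\<And>t. t \<in> {0..s} \<Longrightarrow> \<theta> t ?q \<in> fst c \<and> snd c (\<theta> t ?q) \<in> cball x0 r"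
      "s = T \<or> dist x0 (snd c (\<theta> s ?q)) = r"
      by (rule first_exit[OF c less_imp_le[OF T(1)] cont r(2) start]) (rule that)
    have "norm (snd c (\<theta> s ?q) - snd c (\<theta> 0 ?q)) \<le> M * s"
    proof (rule vector_derivative_bound)
      fix u assume u: "u \<in> {0..s}"
      have "\<bar>u\<bar> < \<epsilon>" using u s(1) T by auto
      then show "((\<lambda>t. snd c (\<theta> t ?q)) has_vector_derivative k (snd c (\<theta> u ?q))) (at u within
          {0..s})"
        unfolding k_def using s(2)[OF u]
        by (auto intro: has_vector_derivative_at_within[OF flow_coord_derivative[OF flow q(1) _ c]])
      show "norm (k (snd c (\<theta> u ?q))) \<le> M" by (rule M(2)) (use s(2)[OF u] in simp)
    qed (use s(1) in auto)
    also have "M * s \<le> M * T" using s(1) M by simp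
    finally have "norm (snd c (\<theta> s ?q) - x) < r / 2" using T(3) q(2) inv[OF x] by simp
    moreover have "dist x0 x < r / 2" using \<rho>(3) x by auto
    ultimately have "dist x0 (snd c (\<theta> s ?q)) < r"
      using dist_triangle[of x0 "snd c (\<theta> s ?q)" x] by (simp add: dist_norm norm_minus_commute)
    then have "s = T" using s(3) by simp
    then show ?thesis using s(2) t by simp
  qed
  have p_eq: "chart_inv c x0 = p" using p(2) chart_inv[OF c] by (simp add: x0_def)
  have "norm (snd c (\<theta> t (chart_inv c x)) - snd c (\<theta> t p) - (x - x0) - t *\<^sub>R L (x - x0))
      \<le> \<eta> * norm (x - x0) * t"
    if x: "x \<in> ball x0 \<rho>" and t: "t \<in> {0..T}" for x t
  proof -
    have x0': "x0 \<in> ball x0 \<rho>" using \<rho> by simp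
    have sol: "((\<lambda>t. snd c (\<theta> t (chart_inv c y))) has_vector_derivative k (snd c (\<theta> t (chart_inv c
        y)))) (at t within {0..T})"
      if "y \<in> ball x0 \<rho>" "t \<in> {0..T}" for y t
      unfolding k_def
      by (rule has_vector_derivative_at_within[OF flow_coord_derivative[OF flow _ _ c]])
        (use stay[OF that] inv[OF that(1)] that(2) T in auto)
    have init: "snd c (\<theta> 0 (chart_inv c y)) = y" if "y \<in> ball x0 \<rho>" for y
      using inv[OF that] flow by (auto simp: local_flow_def)
    have "norm (snd c (\<theta> t (chart_inv c x)) - snd c (\<theta> t (chart_inv c x0))
        - (snd c (\<theta> 0 (chart_inv c x)) - snd c (\<theta> 0 (chart_inv c x0)))
        - t *\<^sub>R L (snd c (\<theta> 0 (chart_inv c x)) - snd c (\<theta> 0 (chart_inv c x0))))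
      \<le> (2 * (\<eta> / 4) + 2 * B * (B + \<eta> / 4) * t) * norm (snd c (\<theta> 0 (chart_inv c x))
          - snd c (\<theta> 0 (chart_inv c x0))) * t"
      by (rule flow_difference[where T = T and k = k and N = "cball x0 r"])
        (use T B \<eta> sol[OF x] sol[OF x0'] stay[OF x] stay[OF x0'] linL strict t in \<open>auto
            simp: mult.commute\<close>)
    also have "\<dots> \<le> \<eta> * norm (snd c (\<theta> 0 (chart_inv c x)) - snd c (\<theta> 0 (chart_inv c x0))) * t"
    proof (intro mult_right_mono)
      have "2 * B * (B + \<eta> / 4) * t \<le> 2 * B * (B + \<eta> / 4) * T"
        using t B \<eta> by (intro mult_left_mono) auto
      then show "2 * (\<eta> / 4) + 2 * B * (B + \<eta> / 4) * t \<le> \<eta>" using T(5) by simp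
    qed (use t in auto)
    finally show ?thesis unfolding init[OF x] p_eq init[OF x0', unfolded p_eq] .
  qed
  then show ?thesis
    using that[of \<rho> T] \<rho> T(1,2) stay unfolding x0_def L_def k_def by blast
qed

end


section \<open>Almost isometries preserve \<open>g\<close> and \<open>d\<tau>\<close>\<close>

context randers_surface
begin

lemma norm_coord_triangle:
  assumes "c \<in> A" "x \<in> chart_image c"
  shows "norm_coord c x (v + w) \<le> norm_coord c x v + norm_coord c x w"
proof -
  obtain u where "\<And>v. u \<bullet> v \<le> norm_coord c x v" "u \<bullet> (v + w) = norm_coord c x (v + w)"
    using norm_coord_support[OF assms] by metis
  then show ?thesis by (metis add_mono inner_add_right)
qed

lemma norm_coord_lipschitz:
  assumes "c \<in> A" "x \<in> chart_image c" and M: "\<And>v. norm_coord c x v \<le> M * norm v"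
  shows "\<bar>norm_coord c x v - norm_coord c x w\<bar> \<le> M * norm (v - w)"
  using norm_coord_triangle[OF assms(1,2), of w "v - w"] norm_coord_triangle[OF assms(1,2), of v
      "w - v"]
    M[of "v - w"] M[of "w - v"] by (simp add: norm_minus_commute abs_le_iff)

text \<open>The case \<open>y = z\<close> of \<open>dist_near\<close>. It serves to evaluate the
  triangle excess of \<open>p, q, p\<close>, which contains \<open>d p p\<close>.\<close>

lemma dist_self:
  assumes "c \<in> A" "p \<in> fst c"
  shows "d p p = 0"
proof -
  have x: "snd c p \<in> chart_image c" using assms by simp
  obtain \<delta> where \<delta>: "\<delta> > 0" "\<And>y z. y \<in> ball (snd c p) \<delta> \<Longrightarrow> z \<in> ball (snd c p) \<delta> \<Longrightarrow>
      \<bar>d (chart_inv c y) (chart_inv c z) - norm_coord c (snd c p) (z - y)\<bar>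
          \<le> 1 / 2 * norm_coord c (snd c p) (z - y)"
    by (rule dist_near[OF assms(1) x, of "1 / 2"]) auto
  from \<delta>(2)[of "snd c p" "snd c p"] \<delta>(1) show ?thesis
    by (simp add: chart_inv[OF assms])
qed

text \<open>Both orders of the arguments are treated because the metric is not reversible. For
  \<Psi> the identity and the coordinate form of an almost isometry will be inserted.\<close>

lemma dist_expansion:
  assumes c: "c \<in> A" and D: "(\<Psi> has_derivative D) (at x)" and \<Psi>x: "\<Psi> x \<in> chart_image c" and "e > 0"
  obtains \<delta> where "\<delta> > 0" "\<And>y. y \<in> ball x \<delta> \<Longrightarrow>
      \<bar>d (chart_inv c (\<Psi> x)) (chart_inv c (\<Psi> y)) - norm_coord c (\<Psi> x) (D (y - x))\<bar> \<le> e * norm (y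
          - x)"
    "\<And>y. y \<in> ball x \<delta> \<Longrightarrow>
      \<bar>d (chart_inv c (\<Psi> y)) (chart_inv c (\<Psi> x)) - norm_coord c (\<Psi> x) (D (x - y))\<bar> \<le> e * norm (y
          - x)"
proof -
  let ?N = "norm_coord c (\<Psi> x)"
  obtain m M where "m > 0" and M: "M > 0" and "\<And>v. m * norm v \<le> ?N v"
      and NM: "\<And>v. ?N v \<le> M * norm v"
    by (rule norm_coord_bounds[OF c \<Psi>x]) (rule that)
  interpret D: bounded_linear D using D by (rule has_derivative_bounded_linear)
  obtain B where B: "B > 0" "\<And>v. norm (D v) \<le> norm v * B" using D.pos_bounded by blast
  \<comment> \<open>Per unit of \<open>norm (y - x)\<close> the error is at most
    \<open>\<eta> * (M * (B + 1))\<close> from \<open>dist_near\<close> plus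
    \<open>M * \<eta>\<close> from linearising \<Psi>.\<close>
  define \<eta> where "\<eta> = min (1 / 2) (e / (M * (B + 2)))"
  have \<eta>: "0 < \<eta>" "\<eta> < 1" using M B \<open>e > 0\<close> by (auto simp: \<eta>_def)
  have "\<eta> * (M * (B + 2)) \<le> e / (M * (B + 2)) * (M * (B + 2))"
    using M B by (intro mult_right_mono) (auto simp: \<eta>_def)
  then have \<eta>e: "\<eta> * (M * (B + 2)) \<le> e" using M B by simp
  obtain \<delta>1 where \<delta>1: "\<delta>1 > 0" and near: "\<And>y z. y \<in> ball (\<Psi> x) \<delta>1 \<Longrightarrow> z \<in> ball (\<Psi> x) \<delta>1 \<Longrightarrow>
      \<bar>d (chart_inv c y) (chart_inv c z) - ?N (z - y)\<bar> \<le> \<eta> * ?N (z - y)"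
    by (rule dist_near[OF c \<Psi>x \<eta>]) (rule that)
  obtain \<delta>2 where \<delta>2: "\<delta>2 > 0" "\<And>y. norm (y - x) < \<delta>2 \<Longrightarrow> norm (\<Psi> y - \<Psi> x - D (y - x)) \<le> \<eta> * norm (y
      - x)"
    using D \<eta>(1) unfolding has_derivative_at_alt by blast
  define \<delta> where "\<delta> = min \<delta>2 (\<delta>1 / (B + 1))"
  have \<delta>: "\<delta> > 0" using \<delta>1 \<delta>2 B by (simp add: \<delta>_def)
  have est: "\<Psi> y \<in> ball (\<Psi> x) \<delta>1"
    "\<And>u. u = \<Psi> y - \<Psi> x \<and> w = y - x \<or> u = \<Psi> x - \<Psi> y \<and> w = x - y \<Longrightarrow> \<eta> * ?N u + \<bar>?N u - ?N (D w)\<bar>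
        \<le> e * norm (y - x)"
    if y: "y \<in> ball x \<delta>" for y w
  proof -
    have n: "norm (y - x) < \<delta>2" "norm (y - x) * (B + 1) < \<delta>1"
      using y B by (auto simp: \<delta>_def dist_norm norm_minus_commute field_simps)
    note o = \<delta>2(2)[OF n(1)]
    have "norm (\<Psi> y - \<Psi> x) \<le> norm (\<Psi> y - \<Psi> x - D (y - x)) + norm (D (y - x))"
      using norm_triangle_sub[of "\<Psi> y - \<Psi> x" "D (y - x)"] by simp
    also have "\<dots> \<le> \<eta> * norm (y - x) + norm (y - x) * B"
      by (intro add_mono o B)
    also have "\<dots> \<le> norm (y - x) * (B + 1)"
      using mult_right_mono[OF less_imp_le[OF \<eta>(2)], of "norm (y - x)"] by (simp add: algebra_simps)
    finally have \<Psi>B: "norm (\<Psi> y - \<Psi> x) \<le> norm (y - x) * (B + 1)" .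
    then show "\<Psi> y \<in> ball (\<Psi> x) \<delta>1"
      using n(2) by (simp add: dist_norm norm_minus_commute)
    fix u assume u: "u = \<Psi> y - \<Psi> x \<and> w = y - x \<or> u = \<Psi> x - \<Psi> y \<and> w = x - y"
    have uB: "norm u \<le> norm (y - x) * (B + 1)"
      using u \<Psi>B by (auto simp: norm_minus_commute)
    have uo: "norm (u - D w) \<le> \<eta> * norm (y - x)"
    proof -
      have "u - D w = \<Psi> y - \<Psi> x - D (y - x) \<or> u - D w = - (\<Psi> y - \<Psi> x - D (y - x))"
        using u by (auto simp: D.diff)
      then have "norm (u - D w) = norm (\<Psi> y - \<Psi> x - D (y - x))"
        using norm_minus_cancel by metis
      then show ?thesis using o by simp
    qed
    have "\<eta> * ?N u + \<bar>?N u - ?N (D w)\<bar> \<le> \<eta> * (M * (norm (y - x) * (B + 1))) + M * (\<eta> * norm (y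
        - x))"
    proof (intro add_mono mult_left_mono)
      show "?N u \<le> M * (norm (y - x) * (B + 1))"
        using NM[of u] uB M by (meson less_imp_le mult_left_mono order_trans)
      show "\<bar>?N u - ?N (D w)\<bar> \<le> M * (\<eta> * norm (y - x))"
        using norm_coord_lipschitz[OF c \<Psi>x NM, of u "D w"] uo M by (meson less_imp_le mult_left_mono
            order_trans)
    qed (use \<eta> in auto)
    also have "\<dots> = \<eta> * (M * (B + 2)) * norm (y - x)" by (simp add: algebra_simps)
    also have "\<dots> \<le> e * norm (y - x)" by (intro mult_right_mono \<eta>e) simp
    finally show "\<eta> * ?N u + \<bar>?N u - ?N (D w)\<bar> \<le> e * norm (y - x)" .
  qed
  show ?thesis
  proof (rule that[OF \<delta>])
    fix y assume y: "y \<in> ball x \<delta>"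
    have x1: "\<Psi> x \<in> ball (\<Psi> x) \<delta>1" using \<delta>1 by simp
    show "\<bar>d (chart_inv c (\<Psi> x)) (chart_inv c (\<Psi> y)) - ?N (D (y - x))\<bar> \<le> e * norm (y - x)"
      using near[OF x1 est(1)[OF y]] est(2)[OF y disjI1[OF conjI[OF refl refl]]] by linarith
    show "\<bar>d (chart_inv c (\<Psi> y)) (chart_inv c (\<Psi> x)) - ?N (D (x - y))\<bar> \<le> e * norm (y - x)"
      using near[OF est(1)[OF y] x1] est(2)[OF y disjI2[OF conjI[OF refl refl]]] by linarith
  qed
qed

text \<open>Points and images are described in the same chart, which is enough for flow maps at
  small times; \<Omega> collects the points for which this is possible.\<close>

lemma almost_isometry_coord:
  assumes \<phi>: "almost_isometry A F U V \<phi>" and c: "c \<in> A"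
  defines "\<Omega> \<equiv> snd c ` {p \<in> U \<inter> fst c. \<phi> p \<in> fst c}" and "\<Phi> \<equiv> snd c \<circ> \<phi> \<circ> chart_inv c"
  shows "open \<Omega>" "smooth_on \<Omega> \<Phi>"
    "x \<in> \<Omega> \<Longrightarrow> frechet_derivative \<Phi> (at x) v \<bullet> (G c (\<Phi> x) *v frechet_derivative \<Phi> (at x) w)
        = v \<bullet> (G c x *v w)"
    "x \<in> \<Omega> \<Longrightarrow> rot (f c) (\<Phi> x) * jac \<Phi> x = rot (f c) x"
proof -
  have U: "open U" and cont: "continuous_on U \<phi>"
    and T: "\<And>p q r. p \<in> U \<Longrightarrow> q \<in> U \<Longrightarrow> r \<in> U \<Longrightarrow> triangle_excess A F p q r = triangle_excess A F (\<phi> p) (\<phi>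
        q) (\<phi> r)"
    using \<phi> by (auto simp: almost_isometry_def diffeomorphism_on_def smooth_between_def)
  have \<Omega>_eq: "\<Omega> = snd c ` (fst c \<inter> (U \<inter> \<phi> -` fst c))" by (auto simp: \<Omega>_def)
  show O: "open \<Omega>"
    unfolding \<Omega>_eq by (intro open_chart_image[OF c] continuous_open_preimage cont U open_dom[OF c])
  show sm: "smooth_on \<Omega> \<Phi>"
    using \<phi> c by (auto simp: almost_isometry_def diffeomorphism_on_def smooth_between_def \<Omega>_def
        \<Phi>_def)
  define D where "D x = frechet_derivative \<Phi> (at x)" for x
  have D: "(\<Phi> has_derivative D x) (at x)" if "x \<in> \<Omega>" for x
    unfolding D_def using sm that smooth_on_imp_differentiable has_frechet_derivative by blast
  have pt: "chart_inv c x \<in> U" "chart_inv c x \<in> fst c" "snd c (chart_inv c x)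
      = x" "\<phi> (chart_inv c x) \<in> fst c"
    "chart_inv c (\<Phi> x) = \<phi> (chart_inv c x)" "\<Phi> x \<in> chart_image c" "x \<in> chart_image c" if "x \<in> \<Omega>"
        for x
    using that by (auto simp: \<Omega>_def \<Phi>_def chart_inv[OF c])
  define Q where "Q x v = sqrt (v \<bullet> (G c x *v v))" for x v
  have NQ: "norm_coord c x v = Q x v + f c x \<bullet> v" for x v by (simp add: norm_coord_def Q_def)
  have Qm: "Q x (- v) = Q x v" for x v
    by (simp add: Q_def linear_neg[OF matrix_vector_mul_linear])
  have Qs: "Q x (s *\<^sub>R v) = s * Q x v" if "s \<ge> 0" for x v s
    using that by (simp add: Q_def matrix_vector_mult_scaleR real_sqrt_mult flip: mult.assoc)
  have exp: "\<exists>\<delta>>0. \<forall>y\<in>ball x \<delta>. y \<in> \<Omega> \<and>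
      \<bar>d (chart_inv c x) (chart_inv c y) - norm_coord c x (y - x)\<bar> \<le> e * norm (y - x) \<and>
      \<bar>d (chart_inv c y) (chart_inv c x) - norm_coord c x (x - y)\<bar> \<le> e * norm (y - x) \<and>
      \<bar>d (chart_inv c (\<Phi> x)) (chart_inv c (\<Phi> y)) - norm_coord c (\<Phi> x) (D x (y - x))\<bar> \<le> e * norm (y
          - x) \<and>
      \<bar>d (chart_inv c (\<Phi> y)) (chart_inv c (\<Phi> x)) - norm_coord c (\<Phi> x) (D x (x - y))\<bar> \<le> e * norm (y
          - x)"
    if x: "x \<in> \<Omega>" and e: "e > 0" for x e
  proof -
    obtain \<delta>1 where \<delta>1: "\<delta>1 > 0" "\<And>y. y \<in> ball x \<delta>1 \<Longrightarrow>
        \<bar>d (chart_inv c x) (chart_inv c y) - norm_coord c x (y - x)\<bar> \<le> e * norm (y - x)"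
      "\<And>y. y \<in> ball x \<delta>1 \<Longrightarrow>
        \<bar>d (chart_inv c y) (chart_inv c x) - norm_coord c x (x - y)\<bar> \<le> e * norm (y - x)"
      by (rule dist_expansion[OF c has_derivative_ident pt(7)[OF x] e]) (rule that)
    obtain \<delta>2 where \<delta>2: "\<delta>2 > 0" "\<And>y. y \<in> ball x \<delta>2 \<Longrightarrow>
        \<bar>d (chart_inv c (\<Phi> x)) (chart_inv c (\<Phi> y)) - norm_coord c (\<Phi> x) (D x (y - x))\<bar> \<le> e * norm (y
            - x)"
      "\<And>y. y \<in> ball x \<delta>2 \<Longrightarrow>
        \<bar>d (chart_inv c (\<Phi> y)) (chart_inv c (\<Phi> x)) - norm_coord c (\<Phi> x) (D x (x - y))\<bar> \<le> e * norm (y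
            - x)"
      by (rule dist_expansion[OF c D[OF x] pt(6)[OF x] e]) (rule that)
    obtain \<delta>3 where \<delta>3: "\<delta>3 > 0" "ball x \<delta>3 \<subseteq> \<Omega>" using O x open_contains_ball by blast
    show ?thesis
    proof (intro exI[of _ "min \<delta>1 (min \<delta>2 \<delta>3)"] conjI ballI)
      fix y assume "y \<in> ball x (min \<delta>1 (min \<delta>2 \<delta>3))"
      then have y: "y \<in> ball x \<delta>1" "y \<in> ball x \<delta>2" "y \<in> ball x \<delta>3" by auto
      show "y \<in> \<Omega>" using y \<delta>3 by blast
    qed (use \<delta>1 \<delta>2 \<delta>3 in auto)
  qed
  text \<open>The symmetrisation of the distance is preserved, since it is the triangle excess of \<open>p, q,
    p\<close>; to first order it is \<open>2 sqrt g\<close>.\<close>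
  have QD: "Q (\<Phi> x) (D x v) = Q x v" if x: "x \<in> \<Omega>" for x v
  proof -
    have lin: "linear (D x)" using D[OF x] by (rule has_derivative_linear)
    have "\<bar>Q (\<Phi> x) (D x v) - Q x v\<bar> \<le> 0"
    proof (rule field_le_epsilon)
      fix e' :: real assume e': "e' > 0"
      \<comment> \<open>The summand 1 admits \<open>v = 0\<close>.\<close>
      define n where "n = norm v + 1"
      have n: "n > 0" "norm v = n - 1" by (simp_all add: n_def add_nonneg_pos)
      define e where "e = e' / (2 * n)"
      have e: "e > 0" using e' n by (simp add: e_def)
      have "2 * e * n = e'" using n by (simp add: e_def)
      then have ee: "2 * e * norm v \<le> e'" using e by (simp add: n(2) right_diff_distrib)
      obtain \<delta> where \<delta>: "\<delta> > 0" and E: "\<forall>y\<in>ball x \<delta>. y \<in> \<Omega> \<and>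
        \<bar>d (chart_inv c x) (chart_inv c y) - norm_coord c x (y - x)\<bar> \<le> e * norm (y - x) \<and>
        \<bar>d (chart_inv c y) (chart_inv c x) - norm_coord c x (x - y)\<bar> \<le> e * norm (y - x) \<and>
        \<bar>d (chart_inv c (\<Phi> x)) (chart_inv c (\<Phi> y)) - norm_coord c (\<Phi> x) (D x (y - x))\<bar> \<le> e * norm (y
            - x) \<and>
        \<bar>d (chart_inv c (\<Phi> y)) (chart_inv c (\<Phi> x)) - norm_coord c (\<Phi> x) (D x (x - y))\<bar> \<le> e * norm (y
            - x)"
        using exp[OF x e] by blast
      define s where "s = \<delta> / (2 * n)"
      have s: "s > 0" using \<delta> n by (simp add: s_def)
      have "s * n = \<delta> / 2" using n by (simp add: s_def)
      then have sv: "s * norm v < \<delta>" using \<delta> s by (simp add: n(2) right_diff_distrib)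
      define y where "y = x + s *\<^sub>R v"
      have y: "y \<in> ball x \<delta>" using sv s by (simp add: y_def dist_norm)
      have y\<Omega>: "y \<in> \<Omega>" using E y by blast
      have yx: "y - x = s *\<^sub>R v" "x - y = - (s *\<^sub>R v)" "norm (y - x) = s * norm v"
        using s by (auto simp: y_def)
      \<comment> \<open>Going forth and back cancels the odd part \<tau>; the square root term
        survives, twice.\<close>
      have N1: "norm_coord c x (y - x) + norm_coord c x (x - y) = 2 * (s * Q x v)"
        unfolding NQ yx Qm using s by (simp add: Qs)
      have N2: "norm_coord c (\<Phi> x) (D x (y - x)) + norm_coord c (\<Phi> x) (D x (x - y))
          = 2 * (s * Q (\<Phi> x) (D x v))"
        unfolding NQ yx linear_neg[OF lin] Qm linear_scale[OF lin] using s by (simp add: Qs)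
      have "triangle_excess A F (chart_inv c x) (chart_inv c y) (chart_inv c x)
        = triangle_excess A F (\<phi> (chart_inv c x)) (\<phi> (chart_inv c y)) (\<phi> (chart_inv c x))"
        by (intro T pt x y\<Omega>)
      then have "d (chart_inv c x) (chart_inv c y) + d (chart_inv c y) (chart_inv c x)
        = d (chart_inv c (\<Phi> x)) (chart_inv c (\<Phi> y)) + d (chart_inv c (\<Phi> y)) (chart_inv c (\<Phi> x))"
        using dist_self[OF c pt(2)[OF x]] dist_self[OF c pt(4)[OF x]]
        by (simp add: triangle_excess_def pt(5)[OF x] pt(5)[OF y\<Omega>])
      then have "\<bar>2 * (s * Q (\<Phi> x) (D x v)) - 2 * (s * Q x v)\<bar> \<le> 4 * (e * norm (y - x))"
        using bspec[OF E y] N1 N2 by linarith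
      then have "s * \<bar>Q (\<Phi> x) (D x v) - Q x v\<bar> \<le> s * (2 * e * norm v)"
      proof -
        have "\<bar>2 * (s * a) - 2 * (s * b)\<bar> = 2 * (s * \<bar>a - b\<bar>)" for a b
          using s by (simp add: abs_mult flip: right_diff_distrib)
        moreover have "s * X \<le> s * (2 * e * m)" if "Y \<le> 4 * (e * (s * m))" "Y = 2 * (s * X)"
            for X Y m :: real
          using that by (simp add: mult_ac)
        ultimately show ?thesis using \<open>\<bar>_\<bar> \<le> 4 * _\<close> unfolding yx(3) by blast
      qed
      then have "\<bar>Q (\<Phi> x) (D x v) - Q x v\<bar> \<le> 2 * e * norm v" using s by simp
      then show "\<bar>Q (\<Phi> x) (D x v) - Q x v\<bar> \<le> 0 + e'" using ee by simp
    qed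
    then show ?thesis by simp
  qed
  have sym: "v \<bullet> (G c x *v w) = w \<bullet> (G c x *v v)" if "x \<in> chart_image c" for x v w
    using riemannian_patch.sym[OF riemannian_patch[OF c] that]
    by (simp add: inner_vec_def sum_2 matrix_vector_mult_def algebra_simps)
  show "frechet_derivative \<Phi> (at x) v \<bullet> (G c (\<Phi> x) *v frechet_derivative \<Phi> (at x) w)
      = v \<bullet> (G c x *v w)"
    if x: "x \<in> \<Omega>" for x v w
  proof -
    have lin: "linear (D x)" using D[OF x] by (rule has_derivative_linear)
    have q: "D x v \<bullet> (G c (\<Phi> x) *v D x v) = v \<bullet> (G c x *v v)" for v
      using QD[OF x, of v] by (simp add: Q_def)
    \<comment> \<open>Polarisation of the preserved quadratic form; symmetry of \<open>G\<close>
      then merges the two mixed terms.\<close>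
    have "D x v \<bullet> (G c (\<Phi> x) *v D x w) + D x w \<bullet> (G c (\<Phi> x) *v D x v) = v \<bullet> (G c x *v w)
        + w \<bullet> (G c x *v v)"
      using q[of "v + w"] q[of v] q[of w]
      by (simp add: linear_add[OF lin] matrix_vector_right_distrib inner_add_left inner_add_right)
    then show ?thesis
      using sym[OF pt(6)[OF x], of "D x v" "D x w"] sym[OF pt(7)[OF x], of v w] by (simp add: D_def)
  qed
  text \<open>By additivity of the change of \<open>d\<close> along triangles, that change is the difference of the
    values of a function \<open>h\<close>, whose differential is the pullback of \<open>\<tau>\<close> minus \<open>\<tau>\<close>.\<close>
  show "rot (f c) (\<Phi> x) * jac \<Phi> x = rot (f c) x" if x0: "x \<in> \<Omega>" for x
  proof -
    define h where "h y = d (\<phi> (chart_inv c x)) (\<phi> (chart_inv c y)) - d (chart_inv c x) (chart_inv c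
        y)" for y
    define pb where "pb y = (\<chi> i. f c (\<Phi> y) $ 1 * partial i (\<lambda>z. \<Phi> z $ 1) y
        + f c (\<Phi> y) $ 2 * partial i (\<lambda>z. \<Phi> z $ 2) y)" for y
    have pb: "pb y \<bullet> v = f c (\<Phi> y) \<bullet> D y v" if "y \<in> \<Omega>" for y v
      using frechet_derivative_vec_nth[OF smooth_on_imp_differentiable[OF sm that], of v]
      by (simp add: pb_def D_def inner_vec_def sum_2 algebra_simps)
    have h: "(h has_derivative (\<lambda>v. (pb y - f c y) \<bullet> v)) (at y)" if y: "y \<in> \<Omega>" for y
      unfolding has_derivative_at_alt
    proof (intro conjI allI impI bounded_linear_inner_right)
      fix e :: real assume "e > 0"
      then have "e / 2 > 0" by simp
      from exp[OF y this] obtain \<delta> where \<delta>: "\<delta> > 0" and E: "\<forall>z\<in>ball y \<delta>. z \<in> \<Omega> \<and>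
        \<bar>d (chart_inv c y) (chart_inv c z) - norm_coord c y (z - y)\<bar> \<le> e / 2 * norm (z - y) \<and>
        \<bar>d (chart_inv c z) (chart_inv c y) - norm_coord c y (y - z)\<bar> \<le> e / 2 * norm (z - y) \<and>
        \<bar>d (chart_inv c (\<Phi> y)) (chart_inv c (\<Phi> z)) - norm_coord c (\<Phi> y) (D y (z - y))\<bar>
            \<le> e / 2 * norm (z - y) \<and>
        \<bar>d (chart_inv c (\<Phi> z)) (chart_inv c (\<Phi> y)) - norm_coord c (\<Phi> y) (D y (y - z))\<bar>
            \<le> e / 2 * norm (z - y)"
        by blast
      show "\<exists>\<delta>>0. \<forall>z. norm (z - y) < \<delta> \<longrightarrow> norm (h z - h y - (pb y - f c y) \<bullet> (z - y)) \<le> e * norm (z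
          - y)"
      proof (intro exI[of _ \<delta>] conjI allI impI \<delta>)
        fix z assume "norm (z - y) < \<delta>"
        then have zb: "z \<in> ball y \<delta>" by (simp add: dist_norm norm_minus_commute)
        then have z: "z \<in> \<Omega>" using E by blast
        have "triangle_excess A F (chart_inv c x) (chart_inv c y) (chart_inv c z)
          = triangle_excess A F (\<phi> (chart_inv c x)) (\<phi> (chart_inv c y)) (\<phi> (chart_inv c z))"
          by (intro T pt x0 y z)
        then have hh: "h z - h y = d (chart_inv c (\<Phi> y)) (chart_inv c (\<Phi> z))
            - d (chart_inv c y) (chart_inv c z)"
          by (simp add: triangle_excess_def h_def pt(5)[OF y] pt(5)[OF z])
        \<comment> \<open>The square root terms agree since the metric is preserved, so what is left
          is linear in \<open>z - y\<close>.\<close>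
        have "norm_coord c (\<Phi> y) (D y (z - y)) - norm_coord c y (z - y) = (pb y - f c y) \<bullet> (z - y)"
          unfolding NQ QD[OF y] inner_diff_left pb[OF y] by simp
        then show "norm (h z - h y - (pb y - f c y) \<bullet> (z - y)) \<le> e * norm (z - y)"
          unfolding hh real_norm_def using bspec[OF E zb] by linarith
      qed
    qed
    have smf: "smooth_on (chart_image c) (f c)" using one_form c by (simp add: smooth_one_form_def)
    have df: "(\<lambda>y. f c y $ j) differentiable (at z)" if "z \<in> chart_image c" for j z
      by (intro differentiable_vec_nth smooth_on_imp_differentiable[OF smf] that)
    have pbn: "pb y $ i = f c (\<Phi> y) $ 1 * partial i (\<lambda>z. \<Phi> z $ 1) y + f c (\<Phi> y) $ 2 * partial i
        (\<lambda>z. \<Phi> z $ 2) y" for y i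
      by (simp add: pb_def)
    note P = rot_pullback[OF O x0 sm df[OF pt(6)[OF x0]] pbn]
    have "rot (\<lambda>y. pb y - f c y) x = 0"
      by (rule rot_gradient[OF O x0 h]) (auto intro!: differentiable_diff P(1) df pt(7)[OF x0])
    moreover have "rot (\<lambda>y. pb y - f c y) x = rot pb x - rot (f c) x"
      unfolding rot_def using P(1) df[OF pt(7)[OF x0]] by (simp add: partial_diff)
    ultimately show ?thesis using P(2) by simp
  qed
qed

end


section \<open>Infinitesimal almost isometries\<close>

lemma constant_has_derivative_0:
  fixes h :: "real \<Rightarrow> real"
  assumes "T > 0" "(h has_real_derivative h') (at 0 within {0..T})" "\<And>t. t \<in> {0..T} \<Longrightarrow> h t = C"
  shows "h' = 0"
proof -
  have "(h has_vector_derivative 0) (at 0 within {0..T})"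
    by (rule has_vector_derivative_transform[of _ _ _ "\<lambda>_. C"]) (use assms in auto)
  then show ?thesis
    using vector_derivative_unique_within_closed_interval[of 0 T 0 h h' 0] assms(1,2)
    by (simp add: has_real_derivative_iff_has_vector_derivative cbox_interval)
qed

context randers_surface
begin

text \<open>Joint regularity of the flow in time and point is not at hand. \<open>D t\<close> is the
  differential of the time-t map, which exists because almost isometries are smooth. Its right
  derivative at time 0 is obtained, and this suffices to differentiate the two conserved expressions
  there.\<close>

lemma almost_killing_flow:
  assumes K: "almost_killing A F K" and c: "c \<in> A" and x: "x \<in> chart_image c"
  defines "k \<equiv> field_coord A c K"
  obtains T \<Phi> D where "0 < T" "\<Phi> 0 = x" "((\<lambda>t. \<Phi> t) has_vector_derivative k x) (at 0 within {0..T})"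
    "\<And>v. D 0 v = v"
    "\<And>v. ((\<lambda>t. D t v) has_vector_derivative frechet_derivative k (at x) v) (at 0 within {0..T})"
    "\<And>t v w. t \<in> {0..T} \<Longrightarrow> D t v \<bullet> (G c (\<Phi> t) *v D t w) = v \<bullet> (G c x *v w)"
    "\<And>t. t \<in> {0..T} \<Longrightarrow> rot (f c) (\<Phi> t) * (D t (axis 1 1) $ 1 * D t (axis 2 1) $ 2
       - D t (axis 2 1) $ 1 * D t (axis 1 1) $ 2) = rot (f c) x"
proof -
  define p where "p = chart_inv c x"
  have p: "p \<in> fst c" "snd c p = x" using chart_inv_in[OF c x] chart_of_inv[OF c x]
      by (simp_all add: p_def)
  have smK: "smooth_vector_field A K" using K by (simp add: almost_killing_def)
  obtain U \<epsilon> \<theta> where U: "open U" "p \<in> U" "\<epsilon> > 0" and flow: "local_flow A K U \<epsilon> \<theta>"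
    and iso: "\<And>t. \<bar>t\<bar> < \<epsilon> \<Longrightarrow> almost_isometry A F U (\<theta> t ` U) (\<theta> t)"
    using K unfolding almost_killing_def by meson
  define L where "L = frechet_derivative k (at x)"
  have "k differentiable (at x)"
    unfolding k_def using smooth_field_coord[OF smK c] x smooth_on_imp_differentiable by blast
  then have L: "bounded_linear L"
    unfolding L_def using has_frechet_derivative has_derivative_bounded_linear by blast
  have exp: "\<exists>\<rho> T. \<rho> > 0 \<and> 0 < T \<and> T < \<epsilon> \<and> (\<forall>y\<in>ball x \<rho>. \<forall>t\<in>{0..T}. \<theta> t (chart_inv c y) \<in> fst c \<and>
      norm (snd c (\<theta> t (chart_inv c y)) - snd c (\<theta> t p) - (y - x) - t *\<^sub>R L (y - x)) \<le> \<eta> * norm (y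
          - x) * t)"
    if \<eta>: "\<eta> > 0" for \<eta>
  proof -
    obtain \<rho> T where "\<rho> > 0" "0 < T" "T < \<epsilon>" "ball x \<rho> \<subseteq> snd c ` (fst c \<inter> U)"
    "\<And>y t. y \<in> ball x \<rho> \<Longrightarrow> t \<in> {0..T} \<Longrightarrow> \<theta> t (chart_inv c y) \<in> fst c"
    "\<And>y t. y \<in> ball x \<rho> \<Longrightarrow> t \<in> {0..T} \<Longrightarrow>
      norm (snd c (\<theta> t (chart_inv c y)) - snd c (\<theta> t p) - (y - x) - t *\<^sub>R L (y - x)) \<le> \<eta> * norm (y
          - x) * t"
      by (rule flow_expansion[OF smK flow U(1,3) c U(2) p(1) \<eta>, unfolded p(2), folded k_def, folded
          L_def]) (rule that)
    then show ?thesis by (intro exI[of _ \<rho>] exI[of _ T]) simp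
  qed
  obtain T \<rho> where T: "0 < T" "T < \<epsilon>" "\<rho> > 0" and "\<forall>y\<in>ball x \<rho>. \<forall>t\<in>{0..T}. \<theta> t (chart_inv c y) \<in> fst
      c"
    using exp[OF zero_less_one] by blast
  then have stay: "\<theta> t p \<in> fst c" if "t \<in> {0..T}" for t
    using that unfolding p_def by simp
  define \<Phi> where "\<Phi> t = snd c \<circ> \<theta> t \<circ> chart_inv c" for t
  define \<Omega> where "\<Omega> t = snd c ` {p \<in> U \<inter> fst c. \<theta> t p \<in> fst c}" for t
  define D where "D t = frechet_derivative (\<Phi> t) (at x)" for t
  have x\<Omega>: "x \<in> \<Omega> t" if "t \<in> {0..T}" for t
    using stay[OF that] U(2) p by (auto simp: \<Omega>_def)
  note ai = almost_isometry_coord[OF iso c, folded \<Phi>_def \<Omega>_def]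
  have abs: "\<bar>t\<bar> < \<epsilon>" if "t \<in> {0..T}" for t using that T by auto
  have dif: "\<Phi> t differentiable (at x)" if "t \<in> {0..T}" for t
    using ai(2)[OF abs[OF that]] x\<Omega>[OF that] smooth_on_imp_differentiable by blast
  \<comment> \<open>Increments of the time-t map are known up to
    \<open>\<eta> * norm (y - x) * t\<close>; this passes to the differential and gives the
    derivative of \<open>D t v\<close> at 0. The bound \<open>T'\<close> depends on
    \<open>e\<close>, while \<open>T\<close> is fixed.\<close>
  have est: "\<exists>T'>0. \<forall>t\<in>{0..T}. t < T' \<longrightarrow> norm (D t v - v - t *\<^sub>R L v) \<le> e * t" if "e > 0" for e v
  proof -
    define \<eta> where "\<eta> = e / (norm v + 1)"
    have "norm v + 1 > 0" by (simp add: add_nonneg_pos)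
    then have \<eta>: "\<eta> > 0" "\<eta> * (norm v + 1) = e" using that by (simp_all add: \<eta>_def)
    obtain \<rho> T' where E: "\<rho> > 0" "0 < T'" "\<forall>y\<in>ball x \<rho>. \<forall>t\<in>{0..T'}. \<theta> t (chart_inv c y) \<in> fst c \<and>
      norm (snd c (\<theta> t (chart_inv c y)) - snd c (\<theta> t p) - (y - x) - t *\<^sub>R L (y - x)) \<le> \<eta> * norm (y
          - x) * t"
      using exp[OF \<eta>(1)] by blast
    show ?thesis
    proof (intro exI[of _ T'] conjI E ballI impI)
      fix t assume t: "t \<in> {0..T}" "t < T'"
      have "norm (D t v - (v + t *\<^sub>R L v)) \<le> \<eta> * t * norm v"
      proof (rule has_derivative_bound[OF has_frechet_derivative[OF dif[OF t(1)], folded D_def] _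
          E(1)])
        show "linear (\<lambda>v. v + t *\<^sub>R L v)"
          using bounded_linear.linear[OF L] by (auto simp: linear_iff algebra_simps)
        show "norm (\<Phi> t y - \<Phi> t x - (y - x + t *\<^sub>R L (y - x))) \<le> \<eta> * t * norm (y - x)"
            if "y \<in> ball x \<rho>" for y
          using bspec[OF bspec[OF E(3) that], of t] t by (simp add: \<Phi>_def p_def[symmetric]
              algebra_simps)
      qed
      also have "\<dots> \<le> e * t"
        using \<eta> t by (auto simp: algebra_simps intro!: mult_right_mono)
      finally show "norm (D t v - v - t *\<^sub>R L v) \<le> e * t" by (simp add: algebra_simps)
    qed
  qed
  have D0: "D 0 v = v" for v
    using est[OF zero_less_one, of v] T by auto
  have \<Phi>0: "\<Phi> 0 x = x"
    using flow U(2) p by (auto simp: \<Phi>_def p_def[symmetric] local_flow_def)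
  have \<theta>0: "\<theta> 0 p = p" using flow U(2) by (simp add: local_flow_def)
  show ?thesis
  proof (rule that[OF T(1), of "\<lambda>t. \<Phi> t x" D])
    show "((\<lambda>t. \<Phi> t x) has_vector_derivative k x) (at 0 within {0..T})"
      using flow_coord_derivative[OF flow U(2) _ c, of 0] U(3) p \<theta>0
      by (auto simp: \<Phi>_def p_def[symmetric] k_def intro: has_vector_derivative_at_within)
    show "((\<lambda>t. D t v) has_vector_derivative frechet_derivative k (at x) v) (at 0 within {0..T})"
        for v
      unfolding has_vector_derivative_def has_derivative_within_alt L_def[symmetric]
    proof (intro conjI allI impI bounded_linear_scaleR_left)
      fix e :: real assume "e > 0"
      then obtain T' where "T' > 0" "\<forall>t\<in>{0..T}. t < T' \<longrightarrow> norm (D t v - v - t *\<^sub>R L v) \<le> e * t"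
        using est by blast
      then show "\<exists>d>0. \<forall>y\<in>{0..T}. norm (y - 0) < d \<longrightarrow> norm (D y v - D 0 v - (y - 0) *\<^sub>R L v)
          \<le> e * norm (y - 0)"
        by (intro exI[of _ T']) (auto simp: D0)
    qed
    show "D t v \<bullet> (G c (\<Phi> t x) *v D t w) = v \<bullet> (G c x *v w)" if "t \<in> {0..T}" for t v w
      unfolding D_def by (rule ai(3)[OF abs[OF that] x\<Omega>[OF that]])
    show "rot (f c) (\<Phi> t x) * (D t (axis 1 1) $ 1 * D t (axis 2 1) $ 2
       - D t (axis 2 1) $ 1 * D t (axis 1 1) $ 2) = rot (f c) x" if "t \<in> {0..T}" for t
      using ai(4)[OF abs[OF that] x\<Omega>[OF that]] unfolding D_def jac_def
          partial_vec_nth[OF dif[OF that]] .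
  qed (use D0 \<Phi>0 in auto)
qed

lemma smooth_form: "c \<in> A \<Longrightarrow> smooth_on (chart_image c) (f c)"
  using one_form by (simp add: smooth_one_form_def)

lemma smooth_rot_form: "c \<in> A \<Longrightarrow> smooth_on (chart_image c) (rot (f c))"
  unfolding rot_def[abs_def]
  by (intro smooth_on_diff smooth_on_partial smooth_on_vec_nth smooth_form open_image)

text \<open>The two expressions conserved in \<open>almost_killing_flow\<close> have vanishing right
  derivative at time 0. Since \<open>D 0\<close> is the identity, these derivatives are the Lie
  derivatives of \<open>g\<close> and of d\<tau>.\<close>

lemma almost_killing_coord:
  assumes K: "almost_killing A F K" and c: "c \<in> A"
  defines "k \<equiv> field_coord A c K"
  shows "killing_on (chart_image c) (G c) k"
    "x \<in> chart_image c \<Longrightarrow> k x $ 1 * partial 1 (rot (f c)) x + k x $ 2 * partial 2 (rot (f c)) x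
      + rot (f c) x * (partial 1 (\<lambda>y. k y $ 1) x + partial 2 (\<lambda>y. k y $ 2) x) = 0"
proof -
  interpret P: riemannian_patch "chart_image c" "G c" by (rule riemannian_patch[OF c])
  have smk: "smooth_on (chart_image c) k"
    unfolding k_def using smooth_field_coord[OF _ c] K by (simp add: almost_killing_def)
  have both: "(\<forall>i j. (\<Sum>l\<in>UNIV. k x $ l * partial l (\<lambda>y. G c y $ i $ j) x +
       G c x $ l $ j * partial i (\<lambda>y. k y $ l) x + G c x $ i $ l * partial j (\<lambda>y. k y $ l) x) = 0)
    \<and> k x $ 1 * partial 1 (rot (f c)) x + k x $ 2 * partial 2 (rot (f c)) x
      + rot (f c) x * (partial 1 (\<lambda>y. k y $ 1) x + partial 2 (\<lambda>y. k y $ 2) x) = 0"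
    if x: "x \<in> chart_image c" for x
  proof -
    obtain T \<Phi> D where T: "0 < T" and \<Phi>0: "\<Phi> 0 = x"
        and d\<Phi>: "((\<lambda>t. \<Phi> t) has_vector_derivative k x) (at 0 within {0..T})"
      and D0: "\<And>v. D 0 v = v"
      and dD: "\<And>v. ((\<lambda>t. D t v) has_vector_derivative frechet_derivative k (at x) v) (at 0 within
          {0..T})"
      and g: "\<And>t v w. t \<in> {0..T} \<Longrightarrow> D t v \<bullet> (G c (\<Phi> t) *v D t w) = v \<bullet> (G c x *v w)"
      and \<tau>: "\<And>t. t \<in> {0..T} \<Longrightarrow> rot (f c) (\<Phi> t) * (D t (axis 1 1) $ 1 * D t (axis 2 1) $ 2
         - D t (axis 2 1) $ 1 * D t (axis 1 1) $ 2) = rot (f c) x"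
      by (rule almost_killing_flow[OF K c x, folded k_def]) (rule that)
    have dk: "k differentiable (at x)" using smk x smooth_on_imp_differentiable by blast
    have Dn: "((\<lambda>t. D t (axis i 1) $ l) has_real_derivative partial i (\<lambda>y. k y $ l) x) (at 0 within
        {0..T})" for i l
      using bounded_linear.has_vector_derivative[OF bounded_linear_vec_nth dD[of "axis i 1"]]
      unfolding partial_vec_nth[OF dk] has_real_derivative_iff_has_vector_derivative .
    have comp: "((\<lambda>t. h (\<Phi> t)) has_real_derivative k x $ 1 * partial 1 h x + k x $ 2 * partial 2 h
        x) (at 0 within {0..T})"
      if "h differentiable (at x)" for h :: "real^2 \<Rightarrow> real"
    proof -
      have "(h has_derivative (\<lambda>v. v $ 1 * partial 1 h x + v $ 2 * partial 2 h x)) (at (\<Phi> 0) within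
          \<Phi> ` {0..T})"
        using has_derivative_at_withinI[OF has_derivative_partial[OF that]] by (simp add: \<Phi>0)
      from vector_derivative_diff_chain_within[OF d\<Phi> this] show ?thesis
        by (simp add: has_real_derivative_iff_has_vector_derivative o_def)
    qed
    have dG: "(\<lambda>y. G c y $ i $ j) differentiable (at x)" for i j
      by (intro smooth_on_imp_differentiable[OF P.smooth_G_nth x])
    have dr: "rot (f c) differentiable (at x)"
      by (rule smooth_on_imp_differentiable[OF smooth_rot_form[OF c] x])
    show ?thesis
    proof (intro conjI allI)
      fix i j :: 2
      let ?a = "\<lambda>t l. D t (axis i 1) $ l" and ?b = "\<lambda>t l. D t (axis j 1) $ l"
      \<comment> \<open>The pairing of two transported basis vectors, written out so that every
        factor can be differentiated in time.\<close>
      let ?h = "\<lambda>t. \<Sum>l\<in>UNIV. \<Sum>m\<in>UNIV. G c (\<Phi> t) $ l $ m * (?a t l * ?b t m)"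
      have "(?h has_real_derivative (\<Sum>l\<in>UNIV. \<Sum>m\<in>UNIV. (k x $ 1 * partial 1 (\<lambda>y. G c y $ l $ m) x
          + k x $ 2 * partial 2 (\<lambda>y. G c y $ l $ m) x) * (?a 0 l * ?b 0 m)
          + (partial i (\<lambda>y. k y $ l) x * ?b 0 m + partial j (\<lambda>y. k y $ m) x * ?a 0 l) * G c (\<Phi>
              0) $ l $ m)) (at 0 within {0..T})"
        by (intro DERIV_sum DERIV_mult comp dG Dn)
      moreover have "?h t = axis i 1 \<bullet> (G c x *v axis j 1)" if "t \<in> {0..T}" for t
        unfolding g[OF that, of "axis i 1" "axis j 1", symmetric]
        by (simp add: inner_vec_def sum_2 matrix_vector_mult_def algebra_simps)
      ultimately have "(\<Sum>l\<in>UNIV. \<Sum>m\<in>UNIV. (k x $ 1 * partial 1 (\<lambda>y. G c y $ l $ m) x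
          + k x $ 2 * partial 2 (\<lambda>y. G c y $ l $ m) x) * (?a 0 l * ?b 0 m)
          + (partial i (\<lambda>y. k y $ l) x * ?b 0 m + partial j (\<lambda>y. k y $ m) x * ?a 0 l) * G c (\<Phi>
              0) $ l $ m) = 0"
        by (rule constant_has_derivative_0[OF T])
      then show "(\<Sum>l\<in>UNIV. k x $ l * partial l (\<lambda>y. G c y $ i $ j) x +
       G c x $ l $ j * partial i (\<lambda>y. k y $ l) x + G c x $ i $ l * partial j (\<lambda>y. k y $ l) x) = 0"
        using exhaust_2[of i] exhaust_2[of j] unfolding D0 \<Phi>0 sum_2
        by (auto simp: axis_def algebra_simps)
    next
      let ?D = "\<lambda>t i l. D t (axis i 1) $ l"
      have "((\<lambda>t. rot (f c) (\<Phi> t) * (?D t 1 1 * ?D t 2 2 - ?D t 2 1 * ?D t 1 2)) has_real_derivative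
        (k x $ 1 * partial 1 (rot (f c)) x + k x $ 2 * partial 2 (rot (f c)) x) * (?D 0 1 1 * ?D 0 2
            2 - ?D 0 2 1 * ?D 0 1 2)
        + (partial 1 (\<lambda>y. k y $ 1) x * ?D 0 2 2 + partial 2 (\<lambda>y. k y $ 2) x * ?D 0 1 1
           - (partial 2 (\<lambda>y. k y $ 1) x * ?D 0 1 2 + partial 1 (\<lambda>y. k y $ 2) x * ?D 0 2 1)) * rot (f
               c) (\<Phi> 0)) (at 0 within {0..T})"
        by (intro DERIV_mult DERIV_diff comp dr Dn)
      from constant_has_derivative_0[OF T this \<tau>]
      show "k x $ 1 * partial 1 (rot (f c)) x + k x $ 2 * partial 2 (rot (f c)) x
      + rot (f c) x * (partial 1 (\<lambda>y. k y $ 1) x + partial 2 (\<lambda>y. k y $ 2) x) = 0"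
        unfolding D0 \<Phi>0 by (simp add: axis_def algebra_simps)
    qed
  qed
  then show "killing_on (chart_image c) (G c) k"
    using smk by (simp add: killing_on_def)
  show "x \<in> chart_image c \<Longrightarrow> k x $ 1 * partial 1 (rot (f c)) x + k x $ 2 * partial 2 (rot (f c)) x
      + rot (f c) x * (partial 1 (\<lambda>y. k y $ 1) x + partial 2 (\<lambda>y. k y $ 2) x) = 0"
    using both by blast
qed

end


section \<open>Three infinitesimal almost isometries force homogeneity\<close>

lemma killing_on_cong:
  assumes "open S" "\<And>x. x \<in> S \<Longrightarrow> k x = l x"
  shows "killing_on S H k \<longleftrightarrow> killing_on S H l"
proof -
  have "partial i (\<lambda>y. k y $ j) x = partial i (\<lambda>y. l y $ j) x" if "x \<in> S" for i j x
    by (rule partial_cong_open[OF assms(1) that]) (simp add: assms(2))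
  then show ?thesis
    unfolding killing_on_def using smooth_on_cong[OF assms] assms(2) by auto
qed

lemma rot_cong_open:
  "open S \<Longrightarrow> x \<in> S \<Longrightarrow> (\<And>y. y \<in> S \<Longrightarrow> \<sigma> y = \<sigma>' y) \<Longrightarrow> rot \<sigma> x = rot \<sigma>' x"
  unfolding rot_def by (intro arg_cong2[of _ _ _ _ "(-)"] partial_cong_open) auto

context riemannian_patch
begin

lemma killing_differentiable:
  "killing_on S G k \<Longrightarrow> x \<in> S \<Longrightarrow> (\<lambda>y. k y $ i) differentiable (at x)"
  by (rule smooth_on_imp_differentiable[OF smooth_killing])

lemma killing_add:
  assumes "killing_on S G k" "killing_on S G l"
  shows "killing_on S G (\<lambda>x. k x + l x)"
  unfolding killing_on_def
proof (intro conjI ballI allI)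
  show "smooth_on S (\<lambda>x. k x + l x)"
    using assms by (intro smooth_on_add open_S) (auto simp: killing_on_def)
  fix x i j assume x: "x \<in> S"
  note d = killing_differentiable[OF assms(1) x] killing_differentiable[OF assms(2) x]
  have "(\<Sum>n\<in>UNIV. k x $ n * partial n (\<lambda>y. G y $ i $ j) x +
     G x $ n $ j * partial i (\<lambda>y. k y $ n) x + G x $ i $ n * partial j (\<lambda>y. k y $ n) x) = 0"
    "(\<Sum>n\<in>UNIV. l x $ n * partial n (\<lambda>y. G y $ i $ j) x +
     G x $ n $ j * partial i (\<lambda>y. l y $ n) x + G x $ i $ n * partial j (\<lambda>y. l y $ n) x) = 0"
    using assms x unfolding killing_on_def by blast+
  then show "(\<Sum>n\<in>UNIV. (k x + l x) $ n * partial n (\<lambda>y. G y $ i $ j) x +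
     G x $ n $ j * partial i (\<lambda>y. (k y + l y) $ n) x + G x $ i $ n * partial j (\<lambda>y. (k y
         + l y) $ n) x) = 0"
    by (simp add: sum_2 partial_add d algebra_simps)
qed

lemma killing_scaleR:
  assumes "killing_on S G k"
  shows "killing_on S G (\<lambda>x. \<alpha> *\<^sub>R k x)"
  unfolding killing_on_def
proof (intro conjI ballI allI)
  show "smooth_on S (\<lambda>x. \<alpha> *\<^sub>R k x)"
    using assms by (intro smooth_on_bounded_linear[OF open_S bounded_linear_scaleR_right]) (auto
        simp: killing_on_def)
  fix x i j assume x: "x \<in> S"
  note d = killing_differentiable[OF assms(1) x]
  have "(\<Sum>n\<in>UNIV. k x $ n * partial n (\<lambda>y. G y $ i $ j) x +
     G x $ n $ j * partial i (\<lambda>y. k y $ n) x + G x $ i $ n * partial j (\<lambda>y. k y $ n) x) = 0"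
    using assms x unfolding killing_on_def by blast
  then have "\<alpha> * (\<Sum>n\<in>UNIV. k x $ n * partial n (\<lambda>y. G y $ i $ j) x +
     G x $ n $ j * partial i (\<lambda>y. k y $ n) x + G x $ i $ n * partial j (\<lambda>y. k y $ n) x) = 0"
    by simp
  then show "(\<Sum>n\<in>UNIV. (\<alpha> *\<^sub>R k x) $ n * partial n (\<lambda>y. G y $ i $ j) x +
     G x $ n $ j * partial i (\<lambda>y. (\<alpha> *\<^sub>R k y) $ n) x + G x $ i $ n * partial j (\<lambda>y. (\<alpha> *\<^sub>R k y) $ n)
         x) = 0"
    by (simp add: sum_2 partial_mult partial_const d algebra_simps)
qed

lemma rot_lower_add:
  assumes "killing_on S G k" "killing_on S G l" "x \<in> S"
  shows "rot (lower G (\<lambda>x. k x + l x)) x = rot (lower G k) x + rot (lower G l) x"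
  unfolding rot_lower[OF killing_add[OF assms(1,2)] assms(3)] rot_lower[OF assms(1,3)]
      rot_lower[OF assms(2,3)]
  using killing_differentiable[OF assms(1,3)] killing_differentiable[OF assms(2,3)]
  by (simp add: partial_add algebra_simps)

lemma rot_lower_scaleR:
  assumes "killing_on S G k" "x \<in> S"
  shows "rot (lower G (\<lambda>x. \<alpha> *\<^sub>R k x)) x = \<alpha> * rot (lower G k) x"
  unfolding rot_lower[OF killing_scaleR[OF assms(1)] assms(2)] rot_lower[OF assms]
  using killing_differentiable[OF assms]
  by (simp add: partial_mult partial_const algebra_simps)

text \<open>The quotient below is independent of the chart, whence so is the curvature, which can be
  read off from its derivative.\<close>

lemma rot_lower_square_derivative:
  assumes k: "killing_on S G k" and x: "x \<in> S"
  shows "((\<lambda>y. (rot (lower G k) y)\<^sup>2 / det (G y)) has_derivative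
    (\<lambda>v. 4 * rot (lower G k) x * curv G x * (k x $ 1 * v $ 2 - k x $ 2 * v $ 1))) (at x)"
proof -
  define m where "m = rot (lower G k)"
  define h where "h = (\<lambda>y. m y * m y / W y)"
  have m: "m differentiable (at x)"
    unfolding m_def by (rule smooth_on_imp_differentiable[OF smooth_rot_lower[OF k] x])
  have "smooth_on S W" by (intro smooth_on_intros open_S smooth_G)
  then have W: "W differentiable (at x)" using x smooth_on_imp_differentiable by blast
  have W0: "W x \<noteq> 0" using W_pos[OF x] by simp
  have "(\<lambda>y. m y * m y) differentiable (at x)" by (intro differentiable_mult m)
  note p = partial_divide[OF this W W0, folded h_def, unfolded partial_mult[OF m m]]
  \<comment> \<open>For \<open>m\<^sup>2 / w\<close> the quotient rule produces exactly the
    combination \<open>2 * w * q - m x * w'\<close> that \<open>rot_lower_derivative\<close>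
    prescribes.\<close>
  have alg: "((m x * q + q * m x) * w - m x * m x * w') / w\<^sup>2 = m x * t"
    if "2 * w * q - m x * w' = t * w\<^sup>2" "w \<noteq> 0" for w w' q t
  proof -
    have "(m x * q + q * m x) * w - m x * m x * w' = m x * (t * w\<^sup>2)"
      unfolding that(1)[symmetric] by (simp add: algebra_simps)
    then show ?thesis using that(2) by simp
  qed
  have "2 * W x * partial 1 m x - m x * partial 1 W x = (- 4 * curv G x * k x $ 2) * (W x)\<^sup>2"
    "2 * W x * partial 2 m x - m x * partial 2 W x = (4 * curv G x * k x $ 1) * (W x)\<^sup>2"
    using rot_lower_derivative[OF k x] by (simp_all add: m_def)
  from alg[OF this(1) W0] alg[OF this(2) W0] have hp: "partial 1 h x
      = m x * (- 4 * curv G x * k x $ 2)" "partial 2 h x = m x * (4 * curv G x * k x $ 1)"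
    unfolding p .
  have "h differentiable (at x)"
    unfolding h_def by (intro differentiable_divide differentiable_mult m W W0)
  then have "(h has_derivative (\<lambda>v. v $ 1 * (m x * (- 4 * curv G x * k x $ 2))
      + v $ 2 * (m x * (4 * curv G x * k x $ 1)))) (at x)"
    unfolding hp[symmetric] by (rule has_derivative_partial)
  moreover have "v $ 1 * (m x * (- 4 * curv G x * k x $ 2)) + v $ 2 * (m x * (4 * curv G x * k
      x $ 1))
     = 4 * m x * curv G x * (k x $ 1 * v $ 2 - k x $ 2 * v $ 1)" for v :: "real^2"
    by (simp add: algebra_simps)
  ultimately have "(h has_derivative (\<lambda>v. 4 * m x * curv G x * (k x $ 1 * v $ 2
      - k x $ 2 * v $ 1))) (at x)"
    by simp
  then show ?thesis
    unfolding m_def[symmetric]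
    by (rule has_derivative_transform_within_open[OF _ open_S x]) (simp add: h_def det_eq
        power2_eq_square)
qed

text \<open>\<open>r\<close> and \<open>sqrt (det G)\<close> are densities with vanishing Lie
  derivative, so their quotient is constant along \<open>k\<close>. The square of the quotient does
  not depend on an orientation.\<close>

lemma density_square_derivative:
  assumes k: "killing_on S G k" and x: "x \<in> S" and r: "r differentiable (at x)"
    and lie: "k x $ 1 * partial 1 r x + k x $ 2 * partial 2 r x
      + r x * (partial 1 (\<lambda>y. k y $ 1) x + partial 2 (\<lambda>y. k y $ 2) x) = 0"
  shows "(\<lambda>y. (r y)\<^sup>2 / det (G y)) differentiable (at x)"
    "k x $ 1 * partial 1 (\<lambda>y. (r y)\<^sup>2 / det (G y)) x + k x $ 2 * partial 2 (\<lambda>y. (r y)\<^sup>2 / det (G y))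
        x = 0"
proof -
  define h where "h = (\<lambda>y. r y * r y / W y)"
  have "smooth_on S W" by (intro smooth_on_intros open_S smooth_G)
  then have W: "W differentiable (at x)" using x smooth_on_imp_differentiable by blast
  have W0: "W x \<noteq> 0" using W_pos[OF x] by simp
  have hd: "h differentiable (at x)"
    unfolding h_def by (intro differentiable_divide differentiable_mult r W W0)
  have cong: "(r y)\<^sup>2 / det (G y) = h y" if "y \<in> S" for y
    using that by (simp add: h_def det_eq power2_eq_square)
  show "(\<lambda>y. (r y)\<^sup>2 / det (G y)) differentiable (at x)"
    using differentiable_cong_open[OF open_S x cong] hd by simp
  have "(\<lambda>y. r y * r y) differentiable (at x)" by (intro differentiable_mult r)
  note p = partial_divide[OF this W W0, folded h_def, unfolded partial_mult[OF r r]]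
  define \<delta> where "\<delta> = partial 1 (\<lambda>y. k y $ 1) x + partial 2 (\<lambda>y. k y $ 2) x"
  define R where "R = k x $ 1 * partial 1 r x + k x $ 2 * partial 2 r x"
  define V where "V = k x $ 1 * partial 1 W x + k x $ 2 * partial 2 W x"
  have e: "R + r x * \<delta> = 0" "V + 2 * W x * \<delta> = 0"
    using lie killing_det[OF k x] by (simp_all add: R_def V_def \<delta>_def)
  have "k x $ 1 * partial 1 h x + k x $ 2 * partial 2 h x = (2 * r x * W x * R
      - r x * r x * V) / (W x)\<^sup>2"
    unfolding p R_def V_def times_divide_eq_right add_divide_distrib[symmetric]
    by (rule arg_cong[of _ _ "\<lambda>z. z / (W x)\<^sup>2"]) (simp add: algebra_simps)
  also have "2 * r x * W x * R - r x * r x * V = 2 * r x * W x * (R + r x * \<delta>) - r x * r x * (V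
      + 2 * W x * \<delta>)"
    by (simp add: algebra_simps)
  finally have "k x $ 1 * partial 1 h x + k x $ 2 * partial 2 h x = 0" unfolding e by simp
  then show "k x $ 1 * partial 1 (\<lambda>y. (r y)\<^sup>2 / det (G y)) x + k x $ 2 * partial 2 (\<lambda>y. (r
      y)\<^sup>2 / det (G y)) x = 0"
    using partial_cong_open[OF open_S x cong] by simp
qed

end

text \<open>The case of \<open>rot_pullback\<close> in which the map is a transition between charts;
  the hypothesis on \<sigma> says that both functions are components of the same 1-form.\<close>

lemma (in smooth_surface) rot_change:
  assumes c: "c \<in> A" "c' \<in> A" "p \<in> fst c" "p \<in> fst c'"
    and \<sigma>: "\<And>q v. q \<in> fst c \<Longrightarrow> q \<in> fst c' \<Longrightarrow> \<sigma> (snd c q) \<bullet> v = \<sigma>' (snd c' q) \<bullet> change c c' q v"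
    and d: "\<And>j. (\<lambda>y. \<sigma>' y $ j) differentiable (at (snd c' p))"
  shows "rot \<sigma> (snd c p) = rot \<sigma>' (snd c' p) * jac_change c c' p"
proof -
  let ?O = "snd c ` (fst c \<inter> fst c')" and ?\<psi> = "snd c' \<circ> chart_inv c"
  have O: "open ?O" "snd c p \<in> ?O" using c open_overlap by auto
  have sm: "smooth_on ?O ?\<psi>" by (rule smooth_transition[OF c(1,2)])
  have \<psi>: "?\<psi> (snd c p) = snd c' p" using c by (simp add: chart_inv)
  have n: "partial i (\<lambda>z. ?\<psi> z $ j) (snd c q) = change c c' q (axis i 1) $ j"
      if "q \<in> fst c" "q \<in> fst c'" for q i j
    using partial_vec_nth[OF smooth_on_imp_differentiable[OF sm], of "snd c q"] that
    by (simp add: change_def)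
  have "rot \<sigma> (snd c p) = rot \<sigma>' (?\<psi> (snd c p)) * jac ?\<psi> (snd c p)"
  proof (rule rot_pullback(2)[OF O sm])
    show "(\<lambda>y. \<sigma>' y $ j) differentiable (at (?\<psi> (snd c p)))" for j using d \<psi> by simp
    fix y i assume "y \<in> ?O"
    then obtain q where q: "q \<in> fst c" "q \<in> fst c'" "y = snd c q" by auto
    have "\<sigma> y $ i = \<sigma>' (snd c' q) \<bullet> change c c' q (axis i 1)"
      using \<sigma>[OF q(1,2), of "axis i 1"] q(3) by (simp add: inner_axis)
    then show "\<sigma> y $ i = \<sigma>' (?\<psi> y) $ 1 * partial i (\<lambda>z. ?\<psi> z $ 1) y + \<sigma>' (?\<psi> y) $ 2 * partial i
        (\<lambda>z. ?\<psi> z $ 2) y"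
      unfolding q(3) n[OF q(1,2)] using chart_inv[OF c(1) q(1)] by (simp add: inner_vec_def sum_2)
  qed
  moreover have "jac ?\<psi> (snd c p) = jac_change c c' p"
    unfolding jac_def jac_change_eq n[OF c(3,4)] by simp
  ultimately show ?thesis using \<psi> by simp
qed

lemma (in smooth_surface) field_coord_eq:
  "c \<in> A \<Longrightarrow> p \<in> fst c \<Longrightarrow> field_coord A c V (snd c p) = change (chart_at A p) c p (V p)"
  by (simp add: field_coord_def comps_of_def chart_inv)

lemma (in smooth_surface) field_coord_change:
  assumes "c \<in> A" "c' \<in> A" "p \<in> fst c" "p \<in> fst c'"
  shows "change c c' p (field_coord A c V (snd c p)) = field_coord A c' V (snd c' p)"
  using assms by (simp add: field_coord_eq change_change chart_at)

lemma (in smooth_surface) field_coord_eq_0: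
  assumes "c \<in> A" "p \<in> fst c"
  shows "field_coord A c V (snd c p) = 0 \<longleftrightarrow> V p = 0"
  using change_inverse[OF chart_at(1) assms(1) chart_at(2) assms(2), of "V p"]
    linear_0[OF linear_change[OF assms(1) chart_at(1) assms(2) chart_at(2)]]
    linear_0[OF linear_change[OF chart_at(1) assms(1) chart_at(2) assms(2)]]
  by (auto simp: field_coord_eq[OF assms])

lemma (in smooth_surface) field_coord_combine:
  assumes "c \<in> A" "x \<in> chart_image c"
  shows "field_coord A c (\<lambda>p. a *\<^sub>R V p + b *\<^sub>R W p) x = a *\<^sub>R field_coord A c V x
      + b *\<^sub>R field_coord A c W x"
proof -
  have "linear (change (chart_at A (chart_inv c x)) c (chart_inv c x))"
    using assms chart_inv_in by (intro linear_change chart_at) auto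
  then show ?thesis
    unfolding field_coord_def comps_of_def by (simp only: linear_add linear_scale)
qed

section \<open>1-jets of infinitesimal almost isometries\<close>

context randers_surface
begin

text \<open>Almost Killing fields enter from here on only through Killing's equation and the
  vanishing Lie derivative of d\<tau>. Both are linear, so they are stable under linear
  combinations, which is not evident for conditions on flows.\<close>

definition infinitesimal :: "('a \<Rightarrow> real^2) \<Rightarrow> bool" where
  "infinitesimal V \<longleftrightarrow> (\<forall>c\<in>A. killing_on (chart_image c) (G c) (field_coord A c V) \<and>
    (\<forall>x\<in>chart_image c. field_coord A c V x $ 1 * partial 1 (rot (f c)) x
        + field_coord A c V x $ 2 * partial 2 (rot (f c)) x
      + rot (f c) x * (partial 1 (\<lambda>y. field_coord A c V y $ 1) x + partial 2 (\<lambda>y. field_coord A c V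
          y $ 2) x) = 0))"

lemma almost_killing_infinitesimal: "almost_killing A F K \<Longrightarrow> infinitesimal K"
  unfolding infinitesimal_def using almost_killing_coord by blast

lemma infinitesimal_combine:
  assumes "infinitesimal V" "infinitesimal W"
  shows "infinitesimal (\<lambda>p. a *\<^sub>R V p + b *\<^sub>R W p)"
  unfolding infinitesimal_def
proof (intro ballI conjI)
  fix c assume c: "c \<in> A"
  interpret P: riemannian_patch "chart_image c" "G c" by (rule riemannian_patch[OF c])
  let ?v = "field_coord A c V" and ?w = "field_coord A c W" and ?u = "field_coord A c (\<lambda>p. a *\<^sub>R V p
      + b *\<^sub>R W p)"
  have k: "killing_on (chart_image c) (G c) ?v" "killing_on (chart_image c) (G c) ?w"
    using assms c by (auto simp: infinitesimal_def)
  have u: "?u x = a *\<^sub>R ?v x + b *\<^sub>R ?w x" if "x \<in> chart_image c" for x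
    by (rule field_coord_combine[OF c that])
  show "killing_on (chart_image c) (G c) ?u"
  proof (rule iffD2[OF killing_on_cong[OF open_image[OF c]]])
    show "killing_on (chart_image c) (G c) (\<lambda>x. a *\<^sub>R ?v x + b *\<^sub>R ?w x)"
      by (intro P.killing_add P.killing_scaleR k)
  qed (rule u)
  fix x assume x: "x \<in> chart_image c"
  have p: "partial i (\<lambda>y. ?u y $ j) x = a * partial i (\<lambda>y. ?v y $ j) x + b * partial i (\<lambda>y. ?w
      y $ j) x" for i j
  proof -
    have "partial i (\<lambda>y. ?u y $ j) x = partial i (\<lambda>y. a * ?v y $ j + b * ?w y $ j) x"
      by (rule partial_cong_open[OF open_image[OF c] x]) (simp add: u)
    then show ?thesis
      using P.killing_differentiable[OF k(1) x] P.killing_differentiable[OF k(2) x]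
      by (simp add: partial_add partial_mult partial_const)
  qed
  have "?v x $ 1 * partial 1 (rot (f c)) x + ?v x $ 2 * partial 2 (rot (f c)) x
      + rot (f c) x * (partial 1 (\<lambda>y. ?v y $ 1) x + partial 2 (\<lambda>y. ?v y $ 2) x) = 0"
    "?w x $ 1 * partial 1 (rot (f c)) x + ?w x $ 2 * partial 2 (rot (f c)) x
      + rot (f c) x * (partial 1 (\<lambda>y. ?w y $ 1) x + partial 2 (\<lambda>y. ?w y $ 2) x) = 0"
    using assms c x by (auto simp: infinitesimal_def)
  note e = this
  have "?u x $ 1 * partial 1 (rot (f c)) x + ?u x $ 2 * partial 2 (rot (f c)) x
      + rot (f c) x * (partial 1 (\<lambda>y. ?u y $ 1) x + partial 2 (\<lambda>y. ?u y $ 2) x)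
    = a * (?v x $ 1 * partial 1 (rot (f c)) x + ?v x $ 2 * partial 2 (rot (f c)) x
      + rot (f c) x * (partial 1 (\<lambda>y. ?v y $ 1) x + partial 2 (\<lambda>y. ?v y $ 2) x))
    + b * (?w x $ 1 * partial 1 (rot (f c)) x + ?w x $ 2 * partial 2 (rot (f c)) x
      + rot (f c) x * (partial 1 (\<lambda>y. ?w y $ 1) x + partial 2 (\<lambda>y. ?w y $ 2) x))"
    unfolding p u[OF x] by (simp add: algebra_simps)
  then show "?u x $ 1 * partial 1 (rot (f c)) x + ?u x $ 2 * partial 2 (rot (f c)) x
      + rot (f c) x * (partial 1 (\<lambda>y. ?u y $ 1) x + partial 2 (\<lambda>y. ?u y $ 2) x) = 0"
    unfolding e by simp
qed

text \<open>The covariant derivative of a Killing field is skew, so its 1-jet at a point is given by its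
  value and by one more number.\<close>

definition jet :: "'a chart \<Rightarrow> ('a \<Rightarrow> real^2) \<Rightarrow> real^2 \<Rightarrow> real^3" where
  "jet c V x = vector [field_coord A c V x $ 1, field_coord A c V x $ 2, rot (lower (G c)
      (field_coord A c V)) x]"

lemma jet_nth: "jet c V x $ 1 = field_coord A c V x $ 1" "jet c V x $ 2 = field_coord A c V x $ 2"
  "jet c V x $ 3 = rot (lower (G c) (field_coord A c V)) x"
  by (simp_all add: jet_def)

lemma jet_eq_0: "jet c V x = 0 \<longleftrightarrow> field_coord A c V x = 0 \<and> rot (lower (G c) (field_coord A c V)) x
    = 0"
  by (auto simp: vec_eq_iff forall_2 forall_3 jet_nth)

lemma jet_combine:
  assumes "infinitesimal V" "infinitesimal W" "c \<in> A" "x \<in> chart_image c"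
  shows "jet c (\<lambda>p. a *\<^sub>R V p + b *\<^sub>R W p) x = a *\<^sub>R jet c V x + b *\<^sub>R jet c W x"
proof -
  interpret P: riemannian_patch "chart_image c" "G c" by (rule riemannian_patch[OF assms(3)])
  have k: "killing_on (chart_image c) (G c) (field_coord A c V)" "killing_on (chart_image c) (G c)
      (field_coord A c W)"
    using assms by (auto simp: infinitesimal_def)
  have "rot (lower (G c) (field_coord A c (\<lambda>p. a *\<^sub>R V p + b *\<^sub>R W p))) x
      = rot (lower (G c) (\<lambda>x. a *\<^sub>R field_coord A c V x + b *\<^sub>R field_coord A c W x)) x"
    by (rule rot_cong_open[OF open_image[OF assms(3)] assms(4)]) (simp add: lower_def
        field_coord_combine assms(3))
  also have "\<dots> = a * rot (lower (G c) (field_coord A c V)) x + b * rot (lower (G c) (field_coord A c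
      W)) x"
    by (simp add: P.rot_lower_add P.rot_lower_scaleR P.killing_scaleR k assms(4))
  finally show ?thesis
    by (simp add: vec_eq_iff forall_3 jet_nth field_coord_combine assms(3,4))
qed

lemma infinitesimal_vanishes_near:
  assumes "infinitesimal V" "c \<in> A" "p \<in> fst c" "jet c V (snd c p) = 0"
  obtains U where "open U" "p \<in> U" "\<And>q. q \<in> U \<Longrightarrow> V q = 0"
proof -
  interpret P: riemannian_patch "chart_image c" "G c" by (rule riemannian_patch[OF assms(2)])
  have k: "killing_on (chart_image c) (G c) (field_coord A c V)"
    using assms by (auto simp: infinitesimal_def)
  have x: "snd c p \<in> chart_image c" using assms(3) by simp
  obtain \<rho> where \<rho>: "\<rho> > 0" "\<forall>x\<in>ball (snd c p) \<rho>. field_coord A c V x = 0"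
    using P.killing_unique[OF k x] assms(4) jet_eq_0 by blast
  let ?U = "{q \<in> fst c. snd c q \<in> ball (snd c p) \<rho>}"
  show ?thesis
  proof (rule that)
    show "open ?U" by (rule open_chart_preimage[OF assms(2) open_ball])
    show "p \<in> ?U" using assms(3) \<rho>(1) by simp
    show "V q = 0" if "q \<in> ?U" for q
      using that \<rho>(2) field_coord_eq_0[OF assms(2), of q V] by auto
  qed
qed

lemma vanishing_jet:
  assumes "open U" "p \<in> U" "\<And>q. q \<in> U \<Longrightarrow> V q = 0" "c \<in> A" "p \<in> fst c"
  shows "jet c V (snd c p) = 0"
proof -
  let ?O = "snd c ` (fst c \<inter> U)"
  have O: "open ?O" "snd c p \<in> ?O" using open_chart_image[OF assms(4,1)] assms by auto
  have 0: "field_coord A c V y = 0" if "y \<in> ?O" for y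
    using that assms(3) field_coord_eq_0[OF assms(4)] by auto
  have "rot (lower (G c) (field_coord A c V)) (snd c p) = rot (\<lambda>_. 0) (snd c p)"
    by (rule rot_cong_open[OF O]) (simp add: lower_def 0)
  then show ?thesis using 0[OF O(2)] by (simp add: jet_eq_0 rot_def partial_const)
qed

lemma continuous_on_jet:
  assumes "infinitesimal V" "c \<in> A"
  shows "continuous_on (chart_image c) (jet c V)"
proof -
  interpret P: riemannian_patch "chart_image c" "G c" by (rule riemannian_patch[OF assms(2)])
  have k: "killing_on (chart_image c) (G c) (field_coord A c V)"
    using assms by (auto simp: infinitesimal_def)
  have "continuous_on (chart_image c) (\<lambda>x. jet c V x $ i)" for i
    using exhaust_3[of i] smooth_on_imp_continuous_on[OF P.smooth_killing[OF k]]
      smooth_on_imp_continuous_on[OF P.smooth_rot_lower[OF k]] by (auto simp: jet_nth)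
  then have "continuous_on (chart_image c) (\<lambda>x. \<chi> i. jet c V x $ i)"
      by (rule continuous_on_vec_lambda)
  then show ?thesis by simp
qed

text \<open>Unique continuation: the interior \<open>Z\<close> of the zero set is open. A point
  outside it has a nonzero jet, which stays nonzero nearby, while jets vanish on \<open>Z\<close>;
  so the complement is open as well.\<close>

lemma infinitesimal_eq_0:
  assumes "connected (UNIV :: 'a set)" "infinitesimal V" "c \<in> A" "p \<in> fst c" "jet c V (snd c p) = 0"
  shows "V q = 0"
proof -
  define Z where "Z = {p. \<exists>U. open U \<and> p \<in> U \<and> (\<forall>q\<in>U. V q = 0)}"
  have "Z = \<Union>{U. open U \<and> (\<forall>q\<in>U. V q = 0)}" by (auto simp: Z_def)
  then have "open Z" by (simp add: open_Union)
  moreover have "open (- Z)"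
  proof (rule Topological_Spaces.openI)
    fix q assume q: "q \<in> - Z"
    define b where "b = chart_at A q"
    have b: "b \<in> A" "q \<in> fst b" using chart_at by (auto simp: b_def)
    let ?O = "chart_image b \<inter> jet b V -` (- {0})"
    have "open ?O"
      by (rule continuous_open_preimage[OF continuous_on_jet[OF assms(2) b(1)] open_image[OF b(1)]])
          auto
    then have "open {p \<in> fst b. snd b p \<in> ?O}" by (rule open_chart_preimage[OF b(1)])
    moreover have "jet b V (snd b q) \<noteq> 0"
    proof
      assume "jet b V (snd b q) = 0"
      then obtain U where "open U" "q \<in> U" "\<And>p. p \<in> U \<Longrightarrow> V p = 0"
        by (rule infinitesimal_vanishes_near[OF assms(2) b]) (rule that)
      then have "q \<in> Z" unfolding Z_def by auto
      then show False using q by simp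
    qed
    moreover have "jet b V (snd b p) = 0" if "p \<in> Z" "p \<in> fst b" for p
      using that vanishing_jet[OF _ _ _ b(1)] unfolding Z_def by blast
    ultimately show "\<exists>T. open T \<and> q \<in> T \<and> T \<subseteq> - Z"
      using b(2) by (intro exI[of _ "{p \<in> fst b. snd b p \<in> ?O}"]) auto
  qed
  moreover have "p \<in> Z"
  proof -
    obtain U where "open U" "p \<in> U" "\<And>q. q \<in> U \<Longrightarrow> V q = 0"
      by (rule infinitesimal_vanishes_near[OF assms(2-5)]) (rule that)
    then show ?thesis unfolding Z_def by auto
  qed
  ultimately have "Z = UNIV"
    using connectedD[OF assms(1), of Z "- Z"] by auto
  then show ?thesis unfolding Z_def by auto
qed

text \<open>The jet at one point depends linearly on the three coefficients. By unique continuation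
  a combination with zero jet vanishes identically, so this linear map is injective, and equal
  dimensions make it onto.\<close>

lemma infinitesimal_with_jet:
  assumes "connected (UNIV :: 'a set)"
    and K: "infinitesimal K1" "infinitesimal K2" "infinitesimal K3"
    and indep: "\<And>\<alpha> \<beta> \<gamma>. (\<And>p. \<alpha> *\<^sub>R K1 p + \<beta> *\<^sub>R K2 p + \<gamma> *\<^sub>R K3 p = 0) \<Longrightarrow> \<alpha> = 0 \<and> \<beta> = 0 \<and> \<gamma> = 0"
    and c: "c \<in> A" "x \<in> chart_image c"
  obtains V where "infinitesimal V" "jet c V x = j"
proof -
  \<comment> \<open>The factor 1 gives the sum of the first two terms the shape that
    \<open>infinitesimal_combine\<close> expects.\<close>
  define V where "V \<alpha> = (\<lambda>p. 1 *\<^sub>R (\<alpha> $ 1 *\<^sub>R K1 p + \<alpha> $ 2 *\<^sub>R K2 p) + \<alpha> $ 3 *\<^sub>R K3 p)"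
      for \<alpha> :: "real^3"
  have inf: "infinitesimal (V \<alpha>)" for \<alpha> unfolding V_def by (intro infinitesimal_combine K)
  define J where "J \<alpha> = \<alpha> $ 1 *\<^sub>R jet c K1 x + \<alpha> $ 2 *\<^sub>R jet c K2 x + \<alpha> $ 3 *\<^sub>R jet c K3 x"
      for \<alpha> :: "real^3"
  have J: "jet c (V \<alpha>) x = J \<alpha>" for \<alpha>
    unfolding V_def jet_combine[OF infinitesimal_combine[OF K(1,2)] K(3) c] jet_combine[OF K(1,2) c]
        J_def by simp
  have lin: "linear J"
    by (rule linearI) (simp_all add: J_def algebra_simps)
  obtain p where p: "p \<in> fst c" "x = snd c p" using c(2) by auto
  have "inj J"
    unfolding linear_injective_0[OF lin]
  proof (intro allI impI)
    fix \<alpha> assume "J \<alpha> = 0"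
    then have "V \<alpha> q = 0" for q
      using infinitesimal_eq_0[OF assms(1) inf c(1) p(1)] J p(2) by metis
    then have "\<alpha> $ 1 = 0 \<and> \<alpha> $ 2 = 0 \<and> \<alpha> $ 3 = 0" by (intro indep) (simp add: V_def)
    then show "\<alpha> = 0" by (simp add: vec_eq_iff forall_3)
  qed
  then have "surj J" using linear_injective_imp_surjective[OF lin] by simp
  then obtain \<alpha> where "J \<alpha> = j" by (metis surjD)
  then show ?thesis using that[OF inf] J by metis
qed

end

section \<open>Constancy of the curvature and of the square of d\<tau>\<close>

locale homogeneous_randers_surface = randers_surface A g \<tau> for A :: "'a::t2_space chart set"
    and g \<tau> +
  assumes connected: "connected (UNIV :: 'a set)"
    and realise: "c \<in> A \<Longrightarrow> x \<in> chart_image c \<Longrightarrow> \<exists>V. infinitesimal V \<and> jet c V x = j"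
begin

lemma realise_field:
  assumes "c \<in> A" "x \<in> chart_image c"
  obtains V where "infinitesimal V" "field_coord A c V x = v" "rot (lower (G c) (field_coord A c V))
      x = s"
proof -
  obtain V where V: "infinitesimal V" "jet c V x = vector [v $ 1, v $ 2, s]"
    using realise[OF assms] by blast
  have "field_coord A c V x = v" "rot (lower (G c) (field_coord A c V)) x = s"
    using jet_nth[of c V x] unfolding V(2) by (auto simp: vec_eq_iff forall_2)
  then show ?thesis using that V(1) by blast
qed

lemma zero_derivative:
  fixes h :: "real^2 \<Rightarrow> real"
  assumes "c \<in> A" "x \<in> chart_image c" "h differentiable (at x)"
    and "\<And>V. infinitesimal V \<Longrightarrow> field_coord A c V x $ 1 * partial 1 h x
        + field_coord A c V x $ 2 * partial 2 h x = 0"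
  shows "(h has_derivative (\<lambda>v. 0)) (at x)"
proof -
  have "v $ 1 * partial 1 h x + v $ 2 * partial 2 h x = 0" for v :: "real^2"
  proof -
    obtain V where "infinitesimal V" "field_coord A c V x = v"
      using realise_field[OF assms(1,2)] by metis
    then show ?thesis using assms(4) by metis
  qed
  then show ?thesis using has_derivative_partial[OF assms(3)] by simp
qed

text \<open>Chart functions that agree on overlaps form one function on the surface; it is locally
  constant by the vanishing derivatives and constant by connectedness.\<close>

lemma constantI:
  fixes h :: "'a chart \<Rightarrow> real^2 \<Rightarrow> real"
  assumes D: "\<And>c x. c \<in> A \<Longrightarrow> x \<in> chart_image c \<Longrightarrow> (h c has_derivative (\<lambda>v. 0)) (at x)"
    and change: "\<And>c c' p. c \<in> A \<Longrightarrow> c' \<in> A \<Longrightarrow> p \<in> fst c \<Longrightarrow> p \<in> fst c' \<Longrightarrow> h c (snd c p) = h c' (snd c' p)"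
  shows "\<exists>C. \<forall>c\<in>A. \<forall>p\<in>fst c. h c (snd c p) = C"
proof -
  define H where "H p = h (chart_at A p) (snd (chart_at A p) p)" for p
  have H: "h c (snd c p) = H p" if "c \<in> A" "p \<in> fst c" for c p
    unfolding H_def using that chart_at by (intro change) auto
  have "H constant_on UNIV"
  proof (rule locally_constant_imp_constant[OF connected])
    fix p :: 'a
    define c where "c = chart_at A p"
    have c: "c \<in> A" "p \<in> fst c" using chart_at by (auto simp: c_def)
    have "snd c p \<in> chart_image c" using c(2) by simp
    then obtain r where r: "r > 0" "ball (snd c p) r \<subseteq> chart_image c"
      using open_image[OF c(1)] open_contains_ball by blast
    have "\<exists>C. \<forall>y\<in>ball (snd c p) r. h c y = C"
    proof (rule has_derivative_zero_constant[OF convex_ball])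
      fix y assume "y \<in> ball (snd c p) r"
      then have "y \<in> chart_image c" using r(2) by blast
      then show "(h c has_derivative (\<lambda>v. 0)) (at y within ball (snd c p) r)"
        by (rule has_derivative_at_withinI[OF D[OF c(1)]])
    qed
    then obtain C where C: "\<forall>y\<in>ball (snd c p) r. h c y = C" ..
    let ?U = "{q \<in> fst c. snd c q \<in> ball (snd c p) r}"
    have "open ?U" by (rule open_chart_preimage[OF c(1) open_ball])
    then have "openin (top_of_set UNIV) ?U" by (rule open_subset[OF subset_UNIV])
    moreover have "p \<in> ?U" using c r by simp
    moreover have "\<forall>q\<in>?U. H q = H p"
    proof
      fix q assume "q \<in> ?U"
      then have "H q = C" using C H[OF c(1), of q] by simp
      moreover have "H p = C" using C H[OF c] r(1) by simp
      ultimately show "H q = H p" by simp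
    qed
    ultimately show "\<exists>T. openin (top_of_set UNIV) T \<and> p \<in> T \<and> (\<forall>q\<in>T. H q = H p)"
      by (intro exI[of _ ?U] conjI)
  qed
  then obtain C where "\<And>p. H p = C" unfolding constant_on_def by blast
  then show ?thesis using H by auto
qed

text \<open>\<open>(rot (lower G k))\<^sup>2 / det G\<close> is a scalar whose differential contains
  the curvature as a factor. Its two chart expressions are compared for a field whose jet makes the
  other factors nonzero.\<close>

lemma curv_change:
  assumes c: "c \<in> A" "c' \<in> A" "p \<in> fst c" "p \<in> fst c'"
  shows "curv (G c) (snd c p) = curv (G c') (snd c' p)"
proof -
  interpret P: riemannian_patch "chart_image c" "G c" by (rule riemannian_patch[OF c(1)])
  interpret P': riemannian_patch "chart_image c'" "G c'" by (rule riemannian_patch[OF c(2)])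
  let ?x = "snd c p" and ?x' = "snd c' p"
  have x: "?x \<in> chart_image c" "?x' \<in> chart_image c'" using c by auto
  \<comment> \<open>For this jet the differential of the scalar in direction \<open>axis 2 1\<close>
    is four times the curvature.\<close>
  obtain V where V: "infinitesimal V" "field_coord A c V ?x = axis 1 1"
      "rot (lower (G c) (field_coord A c V)) ?x = 1"
    using realise_field[OF c(1) x(1)] by metis
  define k k' where "k = field_coord A c V" and "k' = field_coord A c' V"
  define m m' where "m = rot (lower (G c) k)" and "m' = rot (lower (G c') k')"
  have k: "killing_on (chart_image c) (G c) k" "killing_on (chart_image c') (G c') k'"
    using V(1) c by (auto simp: infinitesimal_def k_def k'_def)
  have m: "m (snd c q) = m' (snd c' q) * jac_change c c' q" if "q \<in> fst c" "q \<in> fst c'" for q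
    unfolding m_def m'_def
  proof (rule rot_change[OF c(1,2) that])
    fix r v assume r: "r \<in> fst c" "r \<in> fst c'"
    have "v \<bullet> (G c (snd c r) *v k (snd c r)) = change c c' r v \<bullet> (G c' (snd c' r) *v k' (snd c' r))"
      unfolding metric_coord_change[OF c(1,2) r] k_def k'_def field_coord_change[OF c(1,2) r] ..
    then show "lower (G c) k (snd c r) \<bullet> v = lower (G c') k' (snd c' r) \<bullet> change c c' r v"
      by (simp add: lower_def inner_commute)
  next
    have "smooth_on (chart_image c') (\<lambda>y. lower (G c') k' y $ j)" for j
      unfolding lower_def matrix_vector_mult_def
      by (simp add: sum_2) (intro smooth_on_intros open_image c P'.smooth_G
          P'.smooth_killing[OF k(2)])
    then show "(\<lambda>y. lower (G c') k' y $ j) differentiable (at (snd c' q))" for j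
      using that by (intro smooth_on_imp_differentiable) auto
  qed
  let ?M = "\<lambda>y. (m y)\<^sup>2 / det (G c y)" and ?M' = "\<lambda>y. (m' y)\<^sup>2 / det (G c' y)"
  let ?O = "snd c ` (fst c \<inter> fst c')" and ?\<psi> = "snd c' \<circ> chart_inv c"
  have O: "open ?O" "?x \<in> ?O" using c open_overlap by auto
  have MM: "?M y = ?M' (?\<psi> y)" if y: "y \<in> ?O" for y
  proof -
    obtain q where q: "q \<in> fst c" "q \<in> fst c'" "y = snd c q" using y by auto
    have "jac_change c c' q \<noteq> 0" using jac_change_inverse[OF c(1,2) q(1,2)] by auto
    then show ?thesis
      unfolding q(3) m[OF q(1,2)] det_metric_change[OF c(1,2) q(1,2)]
      using chart_inv[OF c(1) q(1)] by (simp add: power_mult_distrib)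
  qed
  have "((\<lambda>y. ?M' (?\<psi> y)) has_derivative (\<lambda>v. 4 * m' ?x' * curv (G c') ?x' * (k' ?x' $ 1 * change c
      c' p v $ 2 - k' ?x' $ 2 * change c c' p v $ 1))) (at ?x)"
  proof (rule has_derivative_compose[OF transition_has_derivative[OF c]])
    have "?\<psi> ?x = ?x'" using chart_inv[OF c(1,3)] by simp
    then show "(?M' has_derivative (\<lambda>v. 4 * m' ?x' * curv (G c') ?x' * (k' ?x' $ 1 * v $ 2
        - k' ?x' $ 2 * v $ 1))) (at (?\<psi> ?x))"
      using P'.rot_lower_square_derivative[OF k(2) x(2)] by (simp add: m'_def)
  qed
  then have "(?M has_derivative (\<lambda>v. 4 * m' ?x' * curv (G c') ?x' * (k' ?x' $ 1 * change c c' p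
      v $ 2 - k' ?x' $ 2 * change c c' p v $ 1))) (at ?x)"
    using has_derivative_cong_open[OF O MM] by simp
  from has_derivative_unique[OF this P.rot_lower_square_derivative[OF k(1) x(1), folded m_def]]
  have "4 * m' ?x' * curv (G c') ?x' * (k' ?x' $ 1 * change c c' p v $ 2 - k' ?x' $ 2 * change c c'
      p v $ 1)
      = 4 * m ?x * curv (G c) ?x * (k ?x $ 1 * v $ 2 - k ?x $ 2 * v $ 1)" for v
    by (rule fun_cong)
  moreover have "k' ?x' $ 1 * change c c' p v $ 2 - k' ?x' $ 2 * change c c' p v $ 1
      = jac_change c c' p * (k ?x $ 1 * v $ 2 - k ?x $ 2 * v $ 1)" for v
    using change_wedge[OF c, of "k ?x" v] field_coord_change[OF c, of V] by (simp add: k_def k'_def)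
  ultimately have "4 * m' ?x' * curv (G c') ?x' * (jac_change c c' p * (k ?x $ 1 * v $ 2
      - k ?x $ 2 * v $ 1))
      = 4 * m ?x * curv (G c) ?x * (k ?x $ 1 * v $ 2 - k ?x $ 2 * v $ 1)" for v :: "real^2"
    by simp
  from this[of "axis 2 1"] have "m' ?x' * jac_change c c' p * curv (G c') ?x'
      = m ?x * curv (G c) ?x"
    using V(2) by (simp add: k_def axis_def mult_ac)
  then show ?thesis using m[OF c(3,4)] V(3) by (simp add: m_def k_def)
qed

lemma constant_curv: "\<exists>C. \<forall>c\<in>A. \<forall>p\<in>fst c. curv (G c) (snd c p) = C"
proof (rule constantI[where h = "\<lambda>c. curv (G c)"])
  fix c x assume c: "c \<in> A" "x \<in> chart_image c"
  interpret P: riemannian_patch "chart_image c" "G c" by (rule riemannian_patch[OF c(1)])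
  show "(curv (G c) has_derivative (\<lambda>v. 0)) (at x)"
    using c P.killing_curv smooth_on_imp_differentiable[OF P.smooth_curv]
    by (intro zero_derivative[OF c]) (auto simp: infinitesimal_def)
qed (rule curv_change)

lemma rot_form_change:
  assumes c: "c \<in> A" "c' \<in> A" "p \<in> fst c" "p \<in> fst c'"
  shows "rot (f c) (snd c p) = rot (f c') (snd c' p) * jac_change c c' p"
proof (rule rot_change[OF c])
  show "f c (snd c q) \<bullet> v = f c' (snd c' q) \<bullet> change c c' q v" if "q \<in> fst c" "q \<in> fst c'" for q v
    using that c by (simp add: form_coord_apply change_change chart_at)
  show "(\<lambda>y. f c' y $ j) differentiable (at (snd c' p))" for j
    by (intro differentiable_vec_nth smooth_on_imp_differentiable[OF smooth_form]) (use c in auto)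
qed

text \<open>Under a change of charts the numerator and the denominator both acquire the squared
  Jacobian, so the quotient is a function on the surface: the squared norm of d\<tau>.\<close>

lemma constant_rot: "\<exists>C. \<forall>c\<in>A. \<forall>p\<in>fst c. (rot (f c) (snd c p))\<^sup>2 / det (G c (snd c p)) = C"
proof (rule constantI[where h = "\<lambda>c x. (rot (f c) x)\<^sup>2 / det (G c x)"])
  fix c x assume c: "c \<in> A" "x \<in> chart_image c"
  interpret P: riemannian_patch "chart_image c" "G c" by (rule riemannian_patch[OF c(1)])
  have r: "rot (f c) differentiable (at x)"
    by (rule smooth_on_imp_differentiable[OF smooth_rot_form c(2)]) (rule c)
  have k: "killing_on (chart_image c) (G c) (field_coord A c V)"
    "field_coord A c V x $ 1 * partial 1 (rot (f c)) x + field_coord A c V x $ 2 * partial 2 (rot (f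
        c)) x
      + rot (f c) x * (partial 1 (\<lambda>y. field_coord A c V y $ 1) x + partial 2 (\<lambda>y. field_coord A c V
          y $ 2) x) = 0"
    if "infinitesimal V" for V
    using that c by (auto simp: infinitesimal_def)
  obtain V0 where "infinitesimal V0" using realise[OF c] by blast
  then show "((\<lambda>y. (rot (f c) y)\<^sup>2 / det (G c y)) has_derivative (\<lambda>v. 0)) (at x)"
    using P.density_square_derivative[OF k(1) c(2) r k(2)]
    by (intro zero_derivative[OF c]) auto
next
  fix c c' p assume c: "c \<in> A" "c' \<in> A" "p \<in> fst c" "p \<in> fst c'"
  have "jac_change c c' p \<noteq> 0" using jac_change_inverse[OF c] by auto
  then show "(rot (f c) (snd c p))\<^sup>2 / det (G c (snd c p)) = (rot (f c') (snd c' p))\<^sup>2 / det (G c'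
      (snd c' p))"
    unfolding rot_form_change[OF c] det_metric_change[OF c] by (simp add: power_mult_distrib)
qed

end


section \<open>The orientation defined by a nowhere vanishing 2-form\<close>

definition swap_coords :: "real^2 \<Rightarrow> real^2" where
  "swap_coords x = vector [x $ 2, x $ 1]"

lemma swap_coords_nth [simp]: "swap_coords x $ 1 = x $ 2" "swap_coords x $ 2 = x $ 1"
  by (simp_all add: swap_coords_def)

lemma swap_coords_swap_coords: "swap_coords (swap_coords x) = x"
  by (simp add: vec_eq_iff forall_2)

lemma bounded_linear_swap_coords: "bounded_linear swap_coords"
  unfolding linear_conv_bounded_linear[symmetric]
  by (rule linearI) (simp_all add: vec_eq_iff forall_2)

context smooth_surface
begin

text \<open>A chart of \<open>A\<close> restricted to an open set and followed by a linear
  involution, in use the identity or the exchange of the coordinates. As \<open>L\<close> is its own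
  inverse, it also leads back to \<open>c\<close>.\<close>

definition subchart :: "'a chart \<Rightarrow> 'a chart \<Rightarrow> (real^2 \<Rightarrow> real^2) \<Rightarrow> bool" where
  "subchart b c L \<longleftrightarrow> c \<in> A \<and> open (fst b) \<and> fst b \<subseteq> fst c \<and> snd b = L \<circ> snd c
    \<and> bounded_linear L \<and> (\<forall>x. L (L x) = x)"

lemma subchart_self: "c \<in> A \<Longrightarrow> subchart c c (\<lambda>x. x)"
  unfolding subchart_def using open_dom by (auto simp: bounded_linear_ident o_def)

lemma subchart_inv:
  assumes b: "subchart b c L" and p: "p \<in> fst b"
  shows "chart_inv b (snd b p) = p" "chart_inv c (L (snd b p)) = p" "L (snd b p) = snd c p"
proof -
  have c: "c \<in> A" "fst b \<subseteq> fst c" "\<And>q. snd b q = L (snd c q)" "\<And>x. L (L x) = x"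
    using b by (auto simp: subchart_def)
  have "inj_on (snd b) (fst b)"
  proof (rule inj_onI)
    fix q r assume qr: "q \<in> fst b" "r \<in> fst b" "snd b q = snd b r"
    then have "L (L (snd c q)) = L (L (snd c r))" using c(3) by simp
    then have "chart_inv c (snd c q) = chart_inv c (snd c r)" using c(4) by simp
    then show "q = r" using qr c(2) chart_inv[OF c(1)] by (metis subsetD)
  qed
  then show "chart_inv b (snd b p) = p" using p by simp
  show "L (snd b p) = snd c p" using c by simp
  then show "chart_inv c (L (snd b p)) = p" using chart_inv[OF c(1)] p c(2) by auto
qed

lemma subchart_open_image:
  assumes b: "subchart b c L" and U: "open U"
  shows "open (snd b ` (fst b \<inter> U))"
proof -
  have c: "c \<in> A" "fst b \<subseteq> fst c" "\<And>q. snd b q = L (snd c q)" "\<And>x. L (L x) = x" "bounded_linear L"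
      "open (fst b)"
    using b by (auto simp: subchart_def)
  have "snd b ` (fst b \<inter> U) = L -` (snd c ` (fst c \<inter> (fst b \<inter> U)))"
  proof (intro subset_antisym subsetI)
    fix y assume "y \<in> snd b ` (fst b \<inter> U)"
    then obtain q where q: "q \<in> fst b" "q \<in> U" "y = snd b q" by auto
    then have "L y = snd c q" using c by simp
    then show "y \<in> L -` (snd c ` (fst c \<inter> (fst b \<inter> U)))" using q c(2) by auto
  next
    fix y assume "y \<in> L -` (snd c ` (fst c \<inter> (fst b \<inter> U)))"
    then obtain q where q: "q \<in> fst b" "q \<in> U" "L y = snd c q" by auto
    then have "y = snd b q" using c(3,4) by metis
    then show "y \<in> snd b ` (fst b \<inter> U)" using q by simp
  qed
  moreover have "open (L -` (snd c ` (fst c \<inter> (fst b \<inter> U))))"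
    by (intro open_vimage[OF open_chart_image[OF c(1) open_Int[OF c(6) U]]
        linear_continuous_on[OF c(5)]])
  ultimately show ?thesis by simp
qed

lemma subchart_is_chart:
  assumes b: "subchart b c L"
  shows "is_chart b"
proof -
  have c: "c \<in> A" "fst b \<subseteq> fst c" "snd b = L \<circ> snd c" "\<And>x. L (L x) = x" "bounded_linear L"
      "open (fst b)"
    using b by (auto simp: subchart_def)
  have "continuous_on (fst b) (snd b)"
    unfolding c(3)
    by (rule continuous_on_compose[OF continuous_on_subset[OF continuous_on_chart[OF c(1)] c(2)]
        linear_continuous_on[OF c(5)]])
  moreover have "continuous_on (chart_image b) (chart_inv b)"
  proof -
    have "continuous_on (chart_image b) (\<lambda>y. chart_inv c (L y))"
    proof (rule continuous_on_compose2[OF continuous_on_chart_inv[OF c(1)]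
        linear_continuous_on[OF c(5)]])
      show "L ` chart_image b \<subseteq> chart_image c" using subchart_inv(3)[OF b] c(2) by auto
    qed
    then show ?thesis
      by (rule continuous_on_eq) (use subchart_inv[OF b] in auto)
  qed
  ultimately have "homeomorphism (fst b) (chart_image b) (snd b) (chart_inv b)"
    using subchart_inv(1)[OF b] by (auto simp: homeomorphism_def image_image)
  then show ?thesis
    using subchart_open_image[OF b open_UNIV] c(6) by (simp add: is_chart_def)
qed

lemma subchart_smooth:
  assumes b: "subchart b c L" and b': "subchart b' c' L'"
  shows "smooth_on (snd b ` (fst b \<inter> fst b')) (snd b' \<circ> chart_inv b)"
proof -
  let ?O = "snd b ` (fst b \<inter> fst b')"
  have c: "c \<in> A" "fst b \<subseteq> fst c" "bounded_linear L" "c' \<in> A" "fst b' \<subseteq> fst c'" "bounded_linear L'"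
      "snd b' = L' \<circ> snd c'" "open (fst b')"
    using b b' by (auto simp: subchart_def)
  have O: "open ?O" by (rule subchart_open_image[OF b c(8)])
  have sm: "smooth_on ?O (\<lambda>y. L' ((snd c' \<circ> chart_inv c) (L y)))"
  proof (intro smooth_on_bounded_linear[OF O c(6)] smooth_on_compose_bounded_linear[OF O c(3) _
      smooth_transition[OF c(1,4)]])
    show "L ` ?O \<subseteq> snd c ` (fst c \<inter> fst c')" using subchart_inv(3)[OF b] c(2,5) by auto
  qed
  have "(snd b' \<circ> chart_inv b) y = L' ((snd c' \<circ> chart_inv c) (L y))" if y: "y \<in> ?O" for y
    using y subchart_inv[OF b] c(7) by auto
  with sm show ?thesis by (subst smooth_on_cong[OF O])
qed

lemma subchart_atlas:
  assumes "\<And>b. b \<in> B \<Longrightarrow> \<exists>c L. subchart b c L" "(\<Union>b\<in>B. fst b) = UNIV"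
  shows "smooth_atlas B"
  unfolding smooth_atlas_def
proof (intro conjI ballI assms(2))
  fix b b' assume "b \<in> B" "b' \<in> B"
  then show "smooth_on (snd b ` (fst b \<inter> fst b')) (snd b' \<circ> chart_inv b)"
    using assms(1) subchart_smooth by blast
qed (use assms(1) subchart_is_chart in blast)

lemma subchart_change:
  assumes b: "subchart b c L" and c': "c' \<in> A" "p \<in> fst b" "p \<in> fst c'"
  shows "change b c' p v = change c c' p (L v)"
proof -
  let ?O = "snd b ` (fst b \<inter> fst c')"
  have c: "c \<in> A" "fst b \<subseteq> fst c" "bounded_linear L"
    using b by (auto simp: subchart_def)
  have O: "open ?O" "snd b p \<in> ?O" using subchart_open_image[OF b open_dom[OF c'(1)]] c' by auto
  have "(L has_derivative L) (at (snd b p))" by (rule bounded_linear_imp_has_derivative[OF c(3)])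
  moreover have "((snd c' \<circ> chart_inv c) has_derivative change c c' p) (at (L (snd b p)))"
    unfolding subchart_inv(3)[OF b c'(2)] by (rule transition_has_derivative) (use c c' in auto)
  ultimately have "((\<lambda>y. (snd c' \<circ> chart_inv c) (L y)) has_derivative (\<lambda>v. change c c' p (L v))) (at
      (snd b p))"
    by (rule has_derivative_compose)
  then have "((snd c' \<circ> chart_inv b) has_derivative (\<lambda>v. change c c' p (L v))) (at (snd b p))"
    by (rule has_derivative_transform_within_open[OF _ O]) (use subchart_inv[OF b] in auto)
  from frechet_derivative_at[OF this] show ?thesis unfolding change_def by metis
qed

text \<open>\<open>\<omega> p\<close> is the coefficient of a 2-form in \<open>chart_at A p\<close>;
  its product with the Jacobian is the coefficient in another chart. Where that is positive the
  chart is kept, where it is negative the coordinates are exchanged, and continuity makes these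
  domains open.\<close>

lemma orientation_atlas:
  assumes \<omega>: "\<And>p. \<omega> p \<noteq> 0"
    and cont: "\<And>c. c \<in> A \<Longrightarrow> continuous_on (fst c) (\<lambda>p. \<omega> p * jac_change c (chart_at A p) p)"
  shows "\<exists>B. oriented_atlas A B \<and> (\<forall>b\<in>B. \<forall>p\<in>fst b. 0 < \<omega> p * jac_change b (chart_at A p) p)"
proof -
  \<comment> \<open>Taking all subcharts with positive coefficient at once builds positivity into
    \<open>B\<close> and leaves the covering to be proved.\<close>
  define B where "B = {b. (\<exists>c L. subchart b c L) \<and> (\<forall>p\<in>fst b. 0 < \<omega> p * jac_change b (chart_at A p)
      p)}"
  have cover: "\<exists>b\<in>B. p \<in> fst b" for p
  proof -
    define c where "c = chart_at A p"
    have c: "c \<in> A" "p \<in> fst c" using chart_at by (auto simp: c_def)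
    define s where "s q = \<omega> q * jac_change c (chart_at A q) q" for q
    have sp: "s p = \<omega> p" using jac_change_self[OF c] by (simp add: s_def c_def[symmetric])
    have op: "open (fst c \<inter> s -` T)" if "open T" for T
      unfolding s_def by (rule continuous_open_preimage[OF cont[OF c(1)] open_dom[OF c(1)] that])
    show ?thesis
    proof (cases "\<omega> p > 0")
      case True
      let ?b = "(fst c \<inter> s -` {0<..}, snd c)"
      have d: "subchart ?b c (\<lambda>x. x)"
        unfolding subchart_def using c(1) op[of "{0<..}"] by (auto simp: bounded_linear_ident o_def)
      have "0 < \<omega> q * jac_change ?b (chart_at A q) q" if "q \<in> fst ?b" for q
        using that subchart_change[OF d chart_at(1) that chart_at(2)] by (simp add: jac_change_eq
            s_def)
      then have "?b \<in> B" using d unfolding B_def by blast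
      then show ?thesis using True sp c(2) by (intro bexI[of _ ?b]) auto
    next
      case False
      then have neg: "\<omega> p < 0" using \<omega>[of p] by simp
      let ?b = "(fst c \<inter> s -` {..<0}, swap_coords \<circ> snd c)"
      have d: "subchart ?b c swap_coords"
        unfolding subchart_def using c(1) op[of "{..<0}"] bounded_linear_swap_coords
            swap_coords_swap_coords by auto
      have sw: "swap_coords (axis 1 1) = axis 2 1" "swap_coords (axis 2 1) = axis 1 1"
        by (simp_all add: vec_eq_iff forall_2 axis_def)
      have "0 < \<omega> q * jac_change ?b (chart_at A q) q" if "q \<in> fst ?b" for q
      proof -
        have "jac_change ?b (chart_at A q) q = - jac_change c (chart_at A q) q"
          using subchart_change[OF d chart_at(1) that chart_at(2)] by (simp add: jac_change_eq sw)
        then show ?thesis using that by (simp add: s_def)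
      qed
      then have "?b \<in> B" using d unfolding B_def by blast
      then show ?thesis using neg sp c(2) by (intro bexI[of _ ?b]) auto
    qed
  qed
  have B: "smooth_atlas B" using cover by (intro subchart_atlas) (auto simp: B_def)
  have AB: "smooth_atlas (A \<union> B)"
  proof (rule subchart_atlas)
    show "\<exists>c L. subchart b c L" if "b \<in> A \<union> B" for b
      using that subchart_self[of b] unfolding B_def by blast
    show "(\<Union>b\<in>A \<union> B. fst b) = UNIV" using cover by blast
  qed
  interpret AB: smooth_surface "A \<union> B" by unfold_locales (rule AB)
  have "det (matrix (change b b' p)) > 0" if b: "b \<in> B" "b' \<in> B" "p \<in> fst b" "p \<in> fst b'" for b b' p
  proof -
    let ?c = "chart_at A p"
    \<comment> \<open>The transition Jacobian is the ratio of the coefficients of the 2-form in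
      \<open>b\<close> and in \<open>b'\<close>, both of which are positive.\<close>
    have "jac_change b ?c p = jac_change b' ?c p * jac_change b b' p"
      using b chart_at[of p] by (intro AB.jac_change_change) auto
    moreover have "0 < \<omega> p * jac_change b ?c p" "0 < \<omega> p * jac_change b' ?c p"
      using b by (auto simp: B_def)
    ultimately have "0 < (\<omega> p * jac_change b' ?c p) * jac_change b b' p" "0 < \<omega> p * jac_change b' ?c
        p"
      by (simp_all add: mult.assoc)
    then show ?thesis unfolding jac_change_def by (simp only: zero_less_mult_pos)
  qed
  then have "oriented_atlas A B" using B AB by (auto simp: oriented_atlas_def)
  then show ?thesis by (intro exI[of _ B]) (auto simp: B_def)
qed

end

text \<open>Charts of \<open>B\<close> may lie outside \<open>A\<close>, so the determinant of the
  metric in them is obtained from that in \<open>chart_at A p\<close>. It changes by the squared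
  Jacobian, whose root is an absolute value.\<close>

lemma (in riemannian_surface) volume_form_eq:
  assumes "oriented_atlas A B"
  defines "b p \<equiv> chart_at B p" and "c p \<equiv> chart_at A p"
  shows "volume_form A B g p v w = sqrt (det (G (c p) (snd (c p) p))) * \<bar>jac_change (b p) (c p) p\<bar>
    * (jac_change (c p) (b p) p * (v $ 1 * w $ 2 - v $ 2 * w $ 1))"
proof -
  interpret B: smooth_surface B by unfold_locales (use assms in \<open>simp add: oriented_atlas_def\<close>)
  interpret AB: smooth_surface "A \<union> B" by unfold_locales (use assms in \<open>simp add:
      oriented_atlas_def\<close>)
  have b: "b p \<in> A \<union> B" "p \<in> fst (b p)" using B.chart_at by (auto simp: b_def)
  have c: "c p \<in> A" "c p \<in> A \<union> B" "p \<in> fst (c p)" using chart_at by (auto simp: c_def)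
  let ?T = "change (b p) (c p) p" and ?M = "G (c p) (snd (c p) p)"
  have M: "g p v w = v \<bullet> (?M *v w)" for v w
    using metric_coord_apply[OF c(1,3), of v w] change_self[OF c(1,3)] by (simp add: c_def)
  have "G (b p) (snd (b p) p) $ i $ j = ?T (axis i 1) \<bullet> (?M *v ?T (axis j 1))" for i j
    unfolding M[symmetric] by (simp add: metric_coord_def coord_vec_def AB.chart_inv[OF b] c_def)
  then have "det (G (b p) (snd (b p) p)) = det ?M * (jac_change (b p) (c p) p)\<^sup>2"
    unfolding det_2 jac_change_eq
    by (simp add: inner_vec_def sum_2 matrix_vector_mult_def power2_eq_square algebra_simps)
  then have "sqrt (det (G (b p) (snd (b p) p))) = sqrt (det ?M) * \<bar>jac_change (b p) (c p) p\<bar>"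
    by (simp add: real_sqrt_mult)
  then show ?thesis
    unfolding volume_form_def Let_def comps_of_def b_def[symmetric] c_def[symmetric]
      AB.change_wedge[OF c(2) b(1) c(3) b(2)] by simp
qed

lemma (in randers_surface) ext_deriv_eq:
  defines "c p \<equiv> chart_at A p"
  shows "ext_deriv A \<tau> p v w = rot (f (c p)) (snd (c p) p) * (v $ 1 * w $ 2 - v $ 2 * w $ 1)"
proof -
  have c: "c p \<in> A" "p \<in> fst (c p)" using chart_at by (auto simp: c_def)
  have "f (c p) differentiable (at (snd (c p) p))"
    by (rule smooth_on_imp_differentiable[OF smooth_form[OF c(1)]]) (use c in auto)
  note d = frechet_derivative_vec_nth[OF this]
  show ?thesis
    unfolding ext_deriv_def Let_def c_def[symmetric] rot_def
    by (simp add: inner_vec_def sum_2 d algebra_simps)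
qed

lemma (in riemannian_surface) gauss_curvature_eq:
  "gauss_curvature A g p = curv (G (chart_at A p)) (snd (chart_at A p) p)"
  by (simp add: gauss_curvature_def curv_def Let_def)

context homogeneous_randers_surface
begin

lemma constant_curvature: "constant_curvature A g"
  using constant_curv chart_at unfolding constant_curvature_def gauss_curvature_eq by blast

text \<open>The coefficient of d\<tau> and the area density have a ratio that is constant up to
  sign. The orientation is chosen to make the sign positive, and the constant sought is the root of
  the one from \<open>constant_rot\<close>.\<close>

lemma ext_deriv_volume_form:
  assumes "\<not> closed_form A \<tau>"
  shows "\<exists>B c. oriented_atlas A B \<and> c \<noteq> 0 \<and> (\<forall>p v w. ext_deriv A \<tau> p v w
      = c * volume_form A B g p v w)"
proof -
  define c where "c p = chart_at A p" for p
  have c: "c p \<in> A" "p \<in> fst (c p)" for p using chart_at by (auto simp: c_def)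
  define \<omega> where "\<omega> p = rot (f (c p)) (snd (c p) p)" for p
  define \<mu> where "\<mu> p = det (G (c p) (snd (c p) p))" for p
  have \<mu>: "\<mu> p > 0" for p
    unfolding \<mu>_def using riemannian_patch.det_pos[OF riemannian_patch[OF c(1)]] c(2) by blast
  obtain C where "\<forall>b\<in>A. \<forall>p\<in>fst b. (rot (f b) (snd b p))\<^sup>2 / det (G b (snd b p)) = C"
    using constant_rot by blast
  then have quot: "(\<omega> p)\<^sup>2 / \<mu> p = C" for p using c by (simp add: \<omega>_def \<mu>_def)
  have C: "(\<omega> p)\<^sup>2 = C * \<mu> p" for p using \<mu>[of p] by (simp add: quot[of p, symmetric])
  \<comment> \<open>One point where d\<tau> does not vanish makes the constant positive, and thereby
    d\<tau> nonzero everywhere.\<close>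
  obtain p0 v0 w0 where "ext_deriv A \<tau> p0 v0 w0 \<noteq> 0"
    using assms unfolding closed_form_def by blast
  then have "\<omega> p0 \<noteq> 0" unfolding ext_deriv_eq by (auto simp: \<omega>_def c_def)
  then have "0 < C * \<mu> p0" unfolding C[symmetric] by simp
  then have C0: "C > 0" using \<mu>[of p0] by (simp add: zero_less_mult_iff)
  have \<omega>0: "\<omega> p \<noteq> 0" for p using C[of p] C0 \<mu>[of p] by auto
  have abs: "\<bar>\<omega> p\<bar> = sqrt C * sqrt (\<mu> p)" for p
    using arg_cong[OF C[of p], of sqrt] by (simp add: real_sqrt_mult)
  have cont: "continuous_on (fst b) (\<lambda>p. \<omega> p * jac_change b (chart_at A p) p)" if b: "b \<in> A" for b
  proof (rule continuous_on_eq)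
    show "continuous_on (fst b) (\<lambda>p. rot (f b) (snd b p))"
      by (rule continuous_on_compose2[OF smooth_on_imp_continuous_on[OF smooth_rot_form[OF b]]
          continuous_on_chart[OF b]]) simp
    show "rot (f b) (snd b p) = \<omega> p * jac_change b (chart_at A p) p" if "p \<in> fst b" for p
      using rot_form_change[OF b c(1) that c(2)] by (simp add: \<omega>_def c_def)
  qed
  obtain B where B: "oriented_atlas A B" "\<forall>b\<in>B. \<forall>p\<in>fst b. 0 < \<omega> p * jac_change b (chart_at A p) p"
    using orientation_atlas[OF \<omega>0 cont] by blast
  interpret B: smooth_surface B by unfold_locales (use B in \<open>simp add: oriented_atlas_def\<close>)
  interpret AB: smooth_surface "A \<union> B" by unfold_locales (use B in \<open>simp add: oriented_atlas_def\<close>)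
  have "ext_deriv A \<tau> p v w = sqrt C * volume_form A B g p v w" for p v w
  proof -
    let ?b = "chart_at B p"
    have b: "?b \<in> B" "p \<in> fst ?b" using B.chart_at by auto
    let ?J = "jac_change ?b (c p) p" and ?J' = "jac_change (c p) ?b p"
    have J: "?J * ?J' = 1" using b c[of p] by (intro AB.jac_change_inverse) auto
    have "0 < \<omega> p * ?J" using B(2) b by (simp add: c_def)
    \<comment> \<open>Positivity in the charts of \<open>B\<close> removes the absolute values,
      after which the two mutually inverse Jacobians cancel.\<close>
    then have "\<bar>\<omega> p\<bar> * \<bar>?J\<bar> = \<omega> p * ?J" by (simp flip: abs_mult)
    then have "sqrt C * (sqrt (\<mu> p) * \<bar>?J\<bar>) = \<omega> p * ?J" unfolding abs by simp
    then have E: "sqrt C * (sqrt (\<mu> p) * \<bar>?J\<bar> * (?J' * t)) = \<omega> p * t" for t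
      using J by (metis mult.assoc mult.right_neutral mult_1)
    show ?thesis
      unfolding volume_form_eq[OF B(1)] ext_deriv_eq c_def[symmetric] \<omega>_def[symmetric]
          \<mu>_def[symmetric]
      by (rule E[symmetric])
  qed
  then show ?thesis using B(1) C0 by (intro exI[of _ B] exI[of _ "sqrt C"]) auto
qed

end

lemma three_independent_fields:
  fixes X :: "('a \<Rightarrow> real^2) set"
  assumes "dim_at_least 3 X"
  obtains K1 K2 K3 where "K1 \<in> X" "K2 \<in> X" "K3 \<in> X"
    "\<And>\<alpha> \<beta> \<gamma>. (\<And>p. \<alpha> *\<^sub>R K1 p + \<beta> *\<^sub>R K2 p + \<gamma> *\<^sub>R K3 p = 0) \<Longrightarrow> \<alpha> = 0 \<and> \<beta> = 0 \<and> \<gamma> = 0"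
proof -
  obtain S where S: "S \<subseteq> X" "independent S" "card S = 3"
    using assms unfolding dim_at_least_def by blast
  obtain K1 K2 K3 where K: "S = {K1, K2, K3}" "K1 \<noteq> K2" "K2 \<noteq> K3" "K1 \<noteq> K3"
    using S(3) unfolding card_3_iff by blast
  have "\<alpha> = 0 \<and> \<beta> = 0 \<and> \<gamma> = 0" if 0: "\<And>p. \<alpha> *\<^sub>R K1 p + \<beta> *\<^sub>R K2 p + \<gamma> *\<^sub>R K3 p = 0" for \<alpha> \<beta> \<gamma>
  proof -
    define u where "u K = (if K = K1 then \<alpha> else if K = K2 then \<beta> else \<gamma>)" for K
    have "(\<Sum>K\<in>S. u K *\<^sub>R K) = \<alpha> *\<^sub>R K1 + (\<beta> *\<^sub>R K2 + \<gamma> *\<^sub>R K3)"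
      using K(2-4) by (simp add: K(1) u_def)
    also have "\<dots> = 0" using 0 by (simp add: fun_eq_iff scaleR_fun_def plus_fun_def zero_fun_def
        add.assoc)
    finally have "u K = 0" if "K \<in> S" for K
      using independentD[OF S(2) _ order_refl] that K(1) by simp
    from this[of K1] this[of K2] this[of K3] show ?thesis
      using K by (auto simp: u_def)
  qed
  then show ?thesis using that[of K1 K2 K3] S(1) K(1) by blast
qed

theorem theorem8:
  fixes A :: "'a::{t2_space, second_countable_topology} chart set"
    and g :: "'a \<Rightarrow> real^2 \<Rightarrow> real^2 \<Rightarrow> real"
    and \<tau> :: "'a \<Rightarrow> real^2 \<Rightarrow> real"
  assumes "smooth_atlas A"
    and "connected (UNIV :: 'a set)"
    and "riemannian_metric A g"
    and "smooth_one_form A \<tau>"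
    and "\<And>p. form_norm g \<tau> p < 1"
    and "\<not> (constant_curvature A g \<and> closed_form A \<tau>)"
    and "dim_at_least 3 {K. almost_killing A (randers g \<tau>) K}"
  shows "constant_curvature A g \<and>
    (\<exists>B c. oriented_atlas A B \<and> c \<noteq> 0 \<and>
      (\<forall>p v w. ext_deriv A \<tau> p v w = c * volume_form A B g p v w))"
proof -
  interpret randers_surface A g \<tau>
    by unfold_locales (use assms in auto)
  obtain K1 K2 K3 where K: "infinitesimal K1" "infinitesimal K2" "infinitesimal K3"
    and indep: "\<And>\<alpha> \<beta> \<gamma>. (\<And>p. \<alpha> *\<^sub>R K1 p + \<beta> *\<^sub>R K2 p + \<gamma> *\<^sub>R K3 p = 0) \<Longrightarrow> \<alpha> = 0 \<and> \<beta> = 0 \<and> \<gamma> = 0"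
    by (rule three_independent_fields[OF assms(7)]) (use almost_killing_infinitesimal in blast)
  interpret homogeneous_randers_surface A g \<tau>
  proof
    show "connected (UNIV :: 'a set)" by (rule assms(2))
    fix c x j assume c: "c \<in> A" "x \<in> chart_image c"
    show "\<exists>V. infinitesimal V \<and> jet c V x = j"
    proof (rule infinitesimal_with_jet[OF assms(2) K _ c, where j = j])
      show "\<alpha> = 0 \<and> \<beta> = 0 \<and> \<gamma> = 0" if "\<And>p. \<alpha> *\<^sub>R K1 p + \<beta> *\<^sub>R K2 p + \<gamma> *\<^sub>R K3 p = 0" for \<alpha> \<beta> \<gamma>
        using that by (rule indep)
    qed blast
  qed
  \<comment> \<open>The curvature is constant in any case, so the hypothesis on the pair says that
    \<tau> is not closed.\<close>
  show ?thesis
    using constant_curvature ext_deriv_volume_form assms(6) by blast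
qed

end
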